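(* Let $C \subset \mathbb{P}^{2}$ be an irreducible and reduced curve in the complex projective plane of degree $d = \deg C \geq 3$ with singular locus $\mathrm{Sing}(C) = \{p_{1}, \ldots, p_{s}\}$ consisting of $s \geq 3$ distinct points, and let $m_{i} = \mathrm{mult}_{p_{i}}(C) \geq 2$ denote the multiplicity of $C$ at $p_{i}$, with the points labelled so that $m_{1} \geq \cdots \geq m_{s}$. Then $$C^{2} = d^{2} > \sum_{i=1}^{s} m_{i}\left(m_{i}-\frac{3}{2}\right) + \frac{3}{2}\, \mathrm{gon}(C).$$
   Context: We work over the complex numbers. The gonality $\mathrm{gon}(C)$ of a complex curve $C$ is the smallest degree of a non-constant map, defined over the complex numbers, from $C$ to the complex projective line $\mathbb{P}^{1}$. $C^2$ denotes the self-intersection number of $C$ in $\mathbb{P}^2$, which equals $d^2$. *)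

theory Defs
  imports
    "HOL-Analysis.Analysis"
    "HOL-Library.Poly_Mapping"
    "HOL-Computational_Algebra.Fraction_Field"
    "HOL-Algebra.QuotRing"
    "HOL-Algebra.Generated_Fields"
    "HOL-Algebra.Embedded_Algebras"
    "HOL-Algebra.Algebraic_Closure_Type"
begin

section \<open>Ternary forms over the complex numbers\<close>

text \<open>
  The variables are indexed by the three-element type \<open>3\<close>. As a type, the polynomial ring is an
  integral domain; irreducibility is that of \<open>Factorial_Ring\<close>, not the one of HOL-Algebra.
\<close>

type_synonym poly3 = "(3 \<Rightarrow>\<^sub>0 nat) \<Rightarrow>\<^sub>0 complex"

definition mdeg :: "(3 \<Rightarrow>\<^sub>0 nat) \<Rightarrow> nat" where
  "mdeg m = (\<Sum>i\<in>UNIV. Poly_Mapping.lookup m i)"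

definition homogeneous :: "nat \<Rightarrow> poly3 \<Rightarrow> bool" where
  "homogeneous k F \<longleftrightarrow> (\<forall>m\<in>Poly_Mapping.keys F. mdeg m = k)"

definition const :: "complex \<Rightarrow> poly3" where
  "const c = Poly_Mapping.single 0 c"

definition var :: "3 \<Rightarrow> poly3" where
  "var i = Poly_Mapping.single (Poly_Mapping.single i 1) 1"

text \<open>Apply \<open>h\<close> to the coefficients and replace the \<open>i\<close>-th variable by \<open>f i\<close>.\<close>

definition insertion :: "(complex \<Rightarrow> 'a::comm_ring_1) \<Rightarrow> (3 \<Rightarrow> 'a) \<Rightarrow> poly3 \<Rightarrow> 'a" where
  "insertion h f F =
    (\<Sum>m\<in>Poly_Mapping.keys F.
      h (Poly_Mapping.lookup F m) * (\<Prod>i\<in>UNIV. f i ^ Poly_Mapping.lookup m i))"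

definition evalp :: "poly3 \<Rightarrow> complex ^ 3 \<Rightarrow> complex" where
  "evalp F v = insertion id (($) v) F"

definition gradient :: "poly3 \<Rightarrow> complex ^ 3 \<Rightarrow> complex ^ 3" where
  "gradient F v = (\<chi> i. deriv (\<lambda>t. evalp F (v + t *s axis i 1)) 0)"


section \<open>Plane curves\<close>

text \<open>
  A point of the projective plane is the set of all its homogeneous coordinate vectors.
  A reduced and irreducible plane curve of degree \<open>d\<close> is given by its equation, an irreducible
  form \<open>F\<close> of degree \<open>d\<close>, which is unique up to a nonzero constant factor.
\<close>

definition proj_point :: "complex ^ 3 \<Rightarrow> (complex ^ 3) set" where
  "proj_point v = {c *s v | c. c \<noteq> 0}"

definition proj_plane :: "(complex ^ 3) set set" where
  "proj_plane = proj_point ` {v. v \<noteq> 0}"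

definition irreducible_plane_curve :: "nat \<Rightarrow> poly3 \<Rightarrow> bool" where
  "irreducible_plane_curve d F \<longleftrightarrow> homogeneous d F \<and> Factorial_Ring.irreducible F"

definition curve_points :: "poly3 \<Rightarrow> (complex ^ 3) set set" where
  "curve_points F = {p \<in> proj_plane. \<forall>v\<in>p. evalp F v = 0}"

definition singular_locus :: "poly3 \<Rightarrow> (complex ^ 3) set set" where
  "singular_locus F = {p \<in> curve_points F. \<forall>v\<in>p. gradient F v = 0}"

text \<open>
  If \<open>v $ i = 1\<close>, this is the equation of the curve in the affine chart where the \<open>i\<close>-th
  coordinate is \<open>1\<close>, with the origin moved to the point with homogeneous coordinates \<open>v\<close>.
\<close>

definition local_equation :: "poly3 \<Rightarrow> complex ^ 3 \<Rightarrow> 3 \<Rightarrow> poly3" where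
  "local_equation F v i = insertion const (\<lambda>j. const (v $ j) + (if j = i then 0 else var j)) F"

text \<open>
  The multiplicity is the degree of the lowest nonzero homogeneous part of a local equation.
  It does not depend on the chart, so the least value over the charts containing the point
  is the value in each of them.
\<close>

definition multiplicity_at :: "poly3 \<Rightarrow> (complex ^ 3) set \<Rightarrow> nat" where
  "multiplicity_at F p =
    (LEAST k. \<exists>v\<in>p. \<exists>i. v $ i = 1 \<and>
      (\<exists>m\<in>Poly_Mapping.keys (local_equation F v i). mdeg m = k))"


section \<open>Self-intersection\<close>

definition meet_transversally :: "poly3 \<Rightarrow> poly3 \<Rightarrow> bool" where
  "meet_transversally G H \<longleftrightarrow>
    (\<forall>v. v \<noteq> 0 \<and> evalp G v = 0 \<and> evalp H v = 0 \<longrightarrow>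
      (\<forall>a b. a *s gradient G v + b *s gradient H v = 0 \<longrightarrow> a = 0 \<and> b = 0))"

text \<open>
  The intersection number of two divisor classes is the number of common points of any two
  curves in these classes that meet transversally. Two plane curves are linearly equivalent
  iff their degrees agree, so for the self-intersection both curves have the degree of \<open>F\<close>.
\<close>

definition self_intersection :: "poly3 \<Rightarrow> nat" where
  "self_intersection F =
    (THE n. \<forall>k G H. homogeneous k F \<and> homogeneous k G \<and> homogeneous k H \<and> meet_transversally G H
      \<longrightarrow> card (curve_points G \<inter> curve_points H) = n)"


section \<open>Function field and gonality\<close>

text \<open>
  The local ring of the plane at the generic point of the curve \<open>F\<close>, i.e. the quotients of forms
  of equal degree whose denominator does not vanish identically on the curve. The function
  field of the curve is its residue field.
\<close>

definition generic_local_ring :: "poly3 \<Rightarrow> poly3 fract ring" where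
  "generic_local_ring F = ring_of_type_algebra
    \<lparr>carrier := {Fract A B | A B k. homogeneous k A \<and> homogeneous k B \<and> \<not> F dvd B}\<rparr>"

definition generic_ideal :: "poly3 \<Rightarrow> poly3 fract set" where
  "generic_ideal F =
    {Fract A B | A B k. homogeneous k A \<and> homogeneous k B \<and> \<not> F dvd B \<and> F dvd A}"

definition function_field :: "poly3 \<Rightarrow> poly3 fract set ring" where
  "function_field F = generic_local_ring F Quot generic_ideal F"

definition rat_fun :: "poly3 \<Rightarrow> poly3 \<Rightarrow> poly3 \<Rightarrow> poly3 fract set" where
  "rat_fun F A B = generic_ideal F +>\<^bsub>generic_local_ring F\<^esub> Fract A B"

text \<open>
  Maps from the possibly singular curve \<open>F\<close> to the projective line are rational maps (equivalently,
  morphisms on the normalization), so that the gonality is a birational invariant. Such a map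
  sends \<open>x\<close> to \<open>[A(x) : B(x)]\<close> with forms \<open>A\<close>, \<open>B\<close> of equal degree that do not both vanish on the
  curve. It is constant iff the curve maps into \<open>[a : b]\<close> for some \<open>a\<close>, \<open>b\<close>.
\<close>

definition rational_map_to_P1 :: "poly3 \<Rightarrow> poly3 \<Rightarrow> poly3 \<Rightarrow> bool" where
  "rational_map_to_P1 F A B \<longleftrightarrow>
    (\<exists>k. homogeneous k A \<and> homogeneous k B) \<and> \<not> (F dvd A \<and> F dvd B)"

definition constant_map :: "poly3 \<Rightarrow> poly3 \<Rightarrow> poly3 \<Rightarrow> bool" where
  "constant_map F A B \<longleftrightarrow>
    (\<exists>a b. (a, b) \<noteq> (0, 0) \<and> F dvd (const b * A - const a * B))"

text \<open>
  The degree of a nonconstant map is the degree of the function field of the curve over the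
  pulled-back function field of the projective line. The latter is generated over the constants by
  \<open>A / B\<close>, the pullback of the affine coordinate; here \<open>B\<close> is not divisible by \<open>F\<close>, because
  otherwise the map would be constant.
\<close>

definition has_map_degree :: "poly3 \<Rightarrow> poly3 \<Rightarrow> poly3 \<Rightarrow> nat \<Rightarrow> bool" where
  "has_map_degree F A B n \<longleftrightarrow>
    ring.dimension (function_field F) n
      (generate_field (function_field F)
        (insert (rat_fun F A B) (range (\<lambda>c. rat_fun F (const c) 1))))
      (carrier (function_field F))"

definition gonality :: "poly3 \<Rightarrow> nat" where
  "gonality F = (LEAST n. \<exists>A B. rational_map_to_P1 F A B \<and> \<not> constant_map F A B \<and>
    has_map_degree F A B n)"

end

theory Submission
  imports Defs "Subresultants.Subresultant_Gcd"
begin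

text \<open>
  Two estimates in terms of the degree \<open>d\<close> of the curve carry the inequality.

  Projecting the curve from a coordinate point that is chosen so that the corresponding variable
  \<open>x\<^sub>k\<close> occurs in the equation gives a nonconstant map to the line of degree at most \<open>d\<close>:
  dividing the equation by a power of another variable makes \<open>x\<^sub>k / x\<^sub>j\<close> a root of a polynomial of
  degree at most \<open>d\<close> over the function field of the line. Hence the gonality is at most \<open>d\<close>
  (\<open>gonality_le_degree\<close>).

  The multiplicities satisfy \<open>\<Sum> m\<^sub>i (m\<^sub>i - 1) \<le> d (d - 1)\<close> (\<open>sum_multiplicities_le\<close>). In general
  position the equation becomes a polynomial of degree \<open>d\<close> in one variable \<open>z\<close>, with coefficients
  in \<open>\<complex>[x]\<close>, and its discriminant, the resultant with its \<open>z\<close>-derivative, is a nonzero polynomial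
  in \<open>x\<close> of degree at most \<open>d (d - 1)\<close>. At the abscissa of a point of multiplicity \<open>m\<close> it vanishes to
  order at least \<open>m (m - 1)\<close>, because there the coefficients of \<open>z\<^sup>j\<close> in the two polynomials are
  divisible by the powers \<open>m - j\<close> and \<open>m - 1 - j\<close> of the local parameter (\<open>power_dvd_resultant\<close>).
  General position gives distinct abscissas to distinct points, so these orders add up.

  Let \<open>S\<close> be the sum of the multiplicities and \<open>g\<close> the gonality. If \<open>S > d\<close>, then
  \<open>\<Sum> m\<^sub>i (m\<^sub>i - 3/2) = \<Sum> m\<^sub>i (m\<^sub>i - 1) - S/2 < d\<^sup>2 - 3/2 d\<close> and \<open>3/2 g \<le> 3/2 d\<close>. If \<open>S \<le> d\<close>, every
  multiplicity is at most \<open>S - 4\<close>, since there are two other singular points of multiplicity at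
  least two, and the sum is at most \<open>S (S - 11/2) \<le> d (d - 11/2)\<close>
  (\<open>multiplicity_sum_inequality\<close>).

  The self-intersection number is \<open>d\<^sup>2\<close> by Bezout's theorem for curves that meet transversally
  (\<open>transversal_intersection_card\<close>), together with one example of such a pair of curves of degree
  \<open>d\<close>. In general position the resultant of the two equations has degree exactly \<open>d\<^sup>2\<close>, its zeros
  correspond to the common points, and transversality makes each zero simple.
\<close>

text \<open>
  Below, \<open>$\<close> is the component of a finite Cartesian product; matrices of variable size occur
  only as Sylvester matrices.
\<close>

no_notation Matrix.vec_index (infixl "$" 100)
no_notation Formal_Power_Series.fps_nth (infixl "$" 75)
no_notation Matrix.scalar_prod (infix "\<bullet>" 70)
hide_const (open) Polynomials.degree Polynomials.lead_coeff
  up_ring.monom up_ring.coeff module.smult Divisibility.irreducible Coset.order Matrix.mat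
  Determinant.det

section \<open>Substitution homomorphisms\<close>

lemma insertion_superset:
  assumes "h 0 = 0" "finite A" "Poly_Mapping.keys F \<subseteq> A"
  shows "insertion h f F = (\<Sum>m\<in>A. h (Poly_Mapping.lookup F m) * (\<Prod>i\<in>UNIV. f i ^ Poly_Mapping.lookup m i))"
  unfolding insertion_def using assms
  by (intro sum.mono_neutral_left) (auto simp: in_keys_iff)

lemma insertion_zero [simp]: "insertion h f 0 = 0"
  by (simp add: insertion_def)

lemma insertion_single:
  assumes "comm_ring_hom h"
  shows "insertion h f (Poly_Mapping.single m c) = h c * (\<Prod>i\<in>UNIV. f i ^ Poly_Mapping.lookup m i)"
proof -
  interpret comm_ring_hom h by fact
  show ?thesis by (subst insertion_superset[where A = "{m}"]) auto
qed

lemma insertion_add: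
  assumes "comm_ring_hom h"
  shows "insertion h f (F + G) = insertion h f F + insertion h f G"
proof -
  interpret comm_ring_hom h by fact
  let ?A = "Poly_Mapping.keys F \<union> Poly_Mapping.keys G"
  have "Poly_Mapping.keys (F + G) \<subseteq> ?A" by (rule Poly_Mapping.keys_add)
  then show ?thesis
    by (simp add: insertion_superset[where A = ?A] lookup_add hom_add ring_distribs sum.distrib)
qed

text \<open>
  Splitting off one monomial at a time suffices to prove identities that are additive in the polynomial.
\<close>

lemma poly3_induct [case_names zero single]:
  assumes "P 0" "\<And>m c F. P F \<Longrightarrow> P (Poly_Mapping.single m c + F)"
  shows "P (F :: poly3)"
proof -
  have "\<forall>F. Poly_Mapping.keys F = A \<longrightarrow> P F" if "finite A" for A
    using that
  proof (induction A)
    case empty then show ?case using assms(1) by simp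
  next
    case (insert a A)
    show ?case
    proof (intro allI impI)
      fix F :: poly3 assume k: "Poly_Mapping.keys F = insert a A"
      define G where "G = F - Poly_Mapping.single a (Poly_Mapping.lookup F a)"
      have "Poly_Mapping.keys G = A"
      proof (rule Set.set_eqI)
        fix m
        have "Poly_Mapping.lookup G m = (if m = a then 0 else Poly_Mapping.lookup F m)"
          by (simp add: G_def lookup_minus lookup_single when_def)
        then show "m \<in> Poly_Mapping.keys G \<longleftrightarrow> m \<in> A"
          using k insert(2) by (metis in_keys_iff insert_iff)
      qed
      then have "P G" using insert by blast
      then have "P (Poly_Mapping.single a (Poly_Mapping.lookup F a) + G)" by (rule assms(2))
      also have "Poly_Mapping.single a (Poly_Mapping.lookup F a) + G = F" by (simp add: G_def)
      finally show "P F" .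
    qed
  qed
  from this[OF finite_keys[of F]] show ?thesis by simp
qed

lemma insertion_mult:
  assumes "comm_ring_hom h"
  shows "insertion h f (F * G) = insertion h f F * insertion h f G"
proof -
  interpret comm_ring_hom h by fact
  have t: "insertion h f (Poly_Mapping.single (k + l) (a * b)) =
      insertion h f (Poly_Mapping.single k a) * insertion h f (Poly_Mapping.single l b)" for k l a b
  proof -
    have "(\<Prod>i\<in>UNIV. f i ^ Poly_Mapping.lookup (k + l) i) =
        (\<Prod>i\<in>UNIV. f i ^ Poly_Mapping.lookup k i) * (\<Prod>i\<in>UNIV. f i ^ Poly_Mapping.lookup l i)"
      by (simp add: lookup_add power_add prod.distrib)
    then show ?thesis
      by (simp only: insertion_single[OF assms] hom_mult mult.assoc mult.left_commute)
  qed
  have s: "insertion h f (Poly_Mapping.single m c * G) = insertion h f (Poly_Mapping.single m c) * insertion h f G" for m c G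
  proof (induction G rule: poly3_induct)
    case zero
    then show ?case by simp
  next
    case (single m' c' G)
    show ?case unfolding distrib_left insertion_add[OF assms] single mult_single t ..
  qed
  show ?thesis
  proof (induction F rule: poly3_induct)
    case zero
    then show ?case by simp
  next
    case (single m' c' G)
    show ?case unfolding distrib_right insertion_add[OF assms] single s ..
  qed
qed

lemma insertion_const [simp]:
  assumes "comm_ring_hom h"
  shows "insertion h f (const c) = h c"
proof -
  interpret comm_ring_hom h by fact
  show ?thesis by (simp add: const_def insertion_single[OF assms])
qed

lemma insertion_var [simp]:
  assumes "comm_ring_hom h"
  shows "insertion h f (var i) = f i"
proof -
  interpret comm_ring_hom h by fact
  have "(\<Prod>j\<in>UNIV. f j ^ Poly_Mapping.lookup (Poly_Mapping.single i (1::nat)) j) = (\<Prod>j\<in>{i}. f j)"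
    by (rule prod.mono_neutral_cong_right) (auto simp: lookup_single when_def)
  then show ?thesis by (simp add: var_def insertion_single[OF assms])
qed

lemma const_hom: "comm_ring_hom const"
  by standard (auto simp: const_def single_add mult_single single_one)

lemma const_0 [simp]: "const 0 = 0"
  by (simp add: const_def)

lemma comm_ring_hom_insertion:
  assumes "comm_ring_hom h"
  shows "comm_ring_hom (insertion h f)"
proof -
  interpret comm_ring_hom h by fact
  have one: "(1 :: poly3) = const 1" by (simp add: const_def)
  show ?thesis
    by standard (auto simp: insertion_add[OF assms] insertion_mult[OF assms], simp add: one assms)
qed

lemma hom_insertion:
  assumes "comm_ring_hom g"
  shows "g (insertion h f F) = insertion (\<lambda>c. g (h c)) (\<lambda>i. g (f i)) F"
proof -
  interpret comm_ring_hom g by fact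
  show ?thesis by (simp add: insertion_def hom_sum hom_mult hom_prod hom_power)
qed

lemma var_power: "var k ^ n = Poly_Mapping.single (Poly_Mapping.single k n) 1"
  by (induction n) (auto simp: var_def mult_single single_add[symmetric])

lemma monomial_eq_prod: "Poly_Mapping.single m c = const c * (\<Prod>i\<in>UNIV. var i ^ Poly_Mapping.lookup m i)"
proof -
  have q: "(\<Prod>i\<in>A. Poly_Mapping.single (g i) (1::complex)) = Poly_Mapping.single (\<Sum>i\<in>A. g i) 1" if "finite A" for A and g :: "3 \<Rightarrow> (3 \<Rightarrow>\<^sub>0 nat)"
    using that by induction (auto simp: mult_single)
  have r: "(\<Sum>i\<in>UNIV. Poly_Mapping.single i (Poly_Mapping.lookup m i)) = m"
    by (rule poly_mapping_eqI) (simp add: lookup_sum lookup_single when_def)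
  show ?thesis by (simp add: var_power q r const_def mult_single)
qed

lemma insertion_const_var [simp]: "insertion const var F = F"
proof (induction F rule: poly3_induct)
  case zero
  then show ?case by simp
next
  case (single m c F)
  show ?case
    unfolding insertion_add[OF const_hom] single insertion_single[OF const_hom] monomial_eq_prod[symmetric] ..
qed

lemma insertion_homogeneous:
  fixes f :: "3 \<Rightarrow> 'a::comm_ring_1"
  assumes "homogeneous k F"
  shows "insertion h (\<lambda>i. a * f i) F = a ^ k * insertion h f F"
proof -
  show ?thesis unfolding insertion_def sum_distrib_left
  proof (rule sum.cong[OF refl])
    fix m assume "m \<in> Poly_Mapping.keys F"
    then have "sum (Poly_Mapping.lookup m) UNIV = k" using assms by (simp add: homogeneous_def mdeg_def)
    then have "(\<Prod>i\<in>UNIV. a ^ Poly_Mapping.lookup m i) = a ^ k" using power_sum[of a "Poly_Mapping.lookup m" UNIV] by simp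
    then have *: "(\<Prod>i\<in>UNIV. (a * f i) ^ Poly_Mapping.lookup m i) = a ^ k * (\<Prod>i\<in>UNIV. f i ^ Poly_Mapping.lookup m i)"
      unfolding power_mult_distrib prod.distrib by simp
    show "h (Poly_Mapping.lookup F m) * (\<Prod>i\<in>UNIV. (a * f i) ^ Poly_Mapping.lookup m i) =
        a ^ k * (h (Poly_Mapping.lookup F m) * (\<Prod>i\<in>UNIV. f i ^ Poly_Mapping.lookup m i))"
      unfolding * by (rule mult.left_commute)
  qed
qed

lemma id_hom: "comm_ring_hom (id :: 'a::comm_ring_1 \<Rightarrow> 'a)" by standard simp_all

lemma evalp_hom: "comm_ring_hom (\<lambda>F. evalp F v)"
  unfolding evalp_def by (rule comm_ring_hom_insertion[OF id_hom])

lemma evalp_homogeneous: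
  "homogeneous k F \<Longrightarrow> evalp F (a *s v) = a ^ k * evalp F v"
proof -
  have "($) (a *s v) = (\<lambda>i. a * v $ i)" by (simp add: fun_eq_iff)
  then show "homogeneous k F \<Longrightarrow> evalp F (a *s v) = a ^ k * evalp F v"
    by (simp add: evalp_def insertion_homogeneous)
qed

section \<open>Linear changes of coordinates\<close>

text \<open>
  Row \<open>k\<close> of \<open>B\<close> is the \<open>k\<close>-th vector of a new basis, so the \<open>i\<close>-th old coordinate of
  \<open>x B\<^sub>1 + y B\<^sub>2 + z B\<^sub>3\<close> is a polynomial in \<open>x\<close>, \<open>y\<close>, \<open>z\<close>. The variable \<open>z\<close> is the outermost one: resultants
  will be taken with respect to it.
\<close>

definition coord_poly :: "complex ^ 3 ^ 3 \<Rightarrow> 3 \<Rightarrow> complex poly poly poly" where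
  "coord_poly B i = [:[:[:0, B $ 1 $ i:], [:B $ 2 $ i:]:], [:[:B $ 3 $ i:]:]:]"

definition to_poly :: "complex ^ 3 ^ 3 \<Rightarrow> poly3 \<Rightarrow> complex poly poly poly" where
  "to_poly B = insertion (\<lambda>c. [:[:[:c:]:]:]) (coord_poly B)"

definition lin :: "complex ^ 3 \<Rightarrow> poly3" where
  "lin a = (\<Sum>i\<in>UNIV. const (a $ i) * var i)"

lemma const3_hom: "comm_ring_hom (\<lambda>c. [:[:[:c:]:]:])"
  by standard (simp_all add: pCons_one)

lemma to_poly_hom: "comm_ring_hom (to_poly B)"
  unfolding to_poly_def by (rule comm_ring_hom_insertion[OF const3_hom])

text \<open>
  The inverse of \<open>to_poly\<close>, if \<open>L k\<close> is the linear form that reads off the \<open>k\<close>-th new coordinate.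
\<close>

definition from_poly :: "(3 \<Rightarrow> poly3) \<Rightarrow> complex poly poly poly \<Rightarrow> poly3" where
  "from_poly L P = poly (map_poly (\<lambda>Q. poly (map_poly (\<lambda>R. poly (map_poly const R) (L 1)) Q) (L 2)) P) (L 3)"

lemma poly_map_hom:
  assumes "comm_ring_hom h"
  shows "comm_ring_hom (\<lambda>P. poly (map_poly h P) x)"
proof -
  interpret comm_ring_hom h by fact
  interpret map: map_poly_comm_ring_hom h ..
  show ?thesis by standard (simp_all add: map.hom_add map.hom_mult)
qed

lemma from_poly_hom: "comm_ring_hom (from_poly L)"
  unfolding from_poly_def by (intro poly_map_hom const_hom)

lemma poly_map_pCons:
  assumes "comm_ring_hom h"
  shows "poly (map_poly h (pCons a P)) x = h a + x * poly (map_poly h P) x"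
proof -
  interpret comm_ring_hom h by fact
  show ?thesis by (simp add: map_poly_pCons_hom)
qed

lemma from_to_poly:
  assumes "\<And>i. const (B $ 1 $ i) * L 1 + const (B $ 2 $ i) * L 2 + const (B $ 3 $ i) * L 3 = var i"
  shows "from_poly L (to_poly B F) = F"
proof -
  have "from_poly L (to_poly B F) = insertion (\<lambda>c. from_poly L [:[:[:c:]:]:]) (\<lambda>i. from_poly L (coord_poly B i)) F"
    unfolding to_poly_def by (rule hom_insertion[OF from_poly_hom])
  also have "(\<lambda>c. from_poly L [:[:[:c:]:]:]) = const"
    by (simp add: from_poly_def poly_map_pCons[OF poly_map_hom[OF poly_map_hom[OF const_hom]]] poly_map_pCons[OF poly_map_hom[OF const_hom]] poly_map_pCons[OF const_hom])
  also have "(\<lambda>i. from_poly L (coord_poly B i)) = var"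
    using assms by (simp add: coord_poly_def fun_eq_iff from_poly_def poly_map_pCons[OF poly_map_hom[OF poly_map_hom[OF const_hom]]] poly_map_pCons[OF poly_map_hom[OF const_hom]] poly_map_pCons[OF const_hom] algebra_simps)
  finally show ?thesis by simp
qed

lemma to_from_poly:
  assumes "to_poly B (L 1) = [:[:[:0, 1:]:]:]" "to_poly B (L 2) = [:[:0, 1:]:]" "to_poly B (L 3) = [:0, 1:]"
  shows "to_poly B (from_poly L P) = P"
proof -
  interpret T: comm_ring_hom "to_poly B" by (rule to_poly_hom)
  have 1: "to_poly B (poly (map_poly const R) (L 1)) = [:[:R:]:]" for R
    by (induction R) (simp_all add: poly_map_pCons[OF const_hom] T.hom_add T.hom_mult assms, simp add: to_poly_def const3_hom)
  have 2: "to_poly B (poly (map_poly (\<lambda>R. poly (map_poly const R) (L 1)) Q) (L 2)) = [:Q:]" for Q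
    by (induction Q) (simp_all add: poly_map_pCons[OF poly_map_hom[OF const_hom]] T.hom_add T.hom_mult assms 1)
  show ?thesis unfolding from_poly_def
    by (induction P) (simp_all add: poly_map_pCons[OF poly_map_hom[OF poly_map_hom[OF const_hom]]] T.hom_add T.hom_mult assms 2)
qed

text \<open>
  The columns of the inverse matrix are the coefficients of the new coordinates as linear forms.
  This isomorphism to an iterated univariate ring makes unique factorization and resultants
  available for forms.
\<close>

lemma to_poly_inverse:
  assumes "invertible B"
  shows "\<exists>L. (\<forall>F. from_poly L (to_poly B F) = F) \<and> (\<forall>P. to_poly B (from_poly L P) = P)"
proof -
  obtain A where A: "A ** B = mat 1" "B ** A = mat 1"
    using assms by (auto simp: invertible_def)
  define L where "L k = lin (\<chi> i. A $ i $ k)" for k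
  have e1: "(\<Sum>j\<in>UNIV. A $ i $ j * B $ j $ k) = (if i = k then 1 else 0)" for i k
    using arg_cong[OF A(1), of "\<lambda>M. M $ i $ k"] by (simp add: matrix_matrix_mult_def Finite_Cartesian_Product.mat_def)
  have e2: "(\<Sum>j\<in>UNIV. B $ i $ j * A $ j $ k) = (if i = k then 1 else 0)" for i k
    using arg_cong[OF A(2), of "\<lambda>M. M $ i $ k"] by (simp add: matrix_matrix_mult_def Finite_Cartesian_Product.mat_def)
  interpret c: comm_ring_hom const by (rule const_hom)
  interpret T: comm_ring_hom "to_poly B" by (rule to_poly_hom)
  have 1: "const (B $ 1 $ i) * L 1 + const (B $ 2 $ i) * L 2 + const (B $ 3 $ i) * L 3 = var i" for i
  proof -
    have "const (B $ 1 $ i) * L 1 + const (B $ 2 $ i) * L 2 + const (B $ 3 $ i) * L 3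
      = (\<Sum>k\<in>UNIV. const (B $ k $ i) * L k)" by (simp add: sum_3)
    also have "\<dots> = (\<Sum>k\<in>UNIV. \<Sum>j\<in>UNIV. const (A $ j $ k * B $ k $ i) * var j)"
      unfolding L_def lin_def sum_distrib_left c.hom_mult
      by (intro sum.cong refl) (simp add: mult.commute mult.left_commute)
    also have "\<dots> = (\<Sum>j\<in>UNIV. const (\<Sum>k\<in>UNIV. A $ j $ k * B $ k $ i) * var j)"
      by (subst sum.swap) (simp add: c.hom_sum sum_distrib_right)
    also have "\<dots> = var i" by (simp add: e1 if_distrib[of const] if_distrib[of "\<lambda>x. x * _"] sum.delta cong: if_cong)
    finally show ?thesis .
  qed
  have 2: "to_poly B (L k) = (\<Sum>j\<in>UNIV. if j = k then (if j = 1 then [:[:[:0, 1:]:]:] else if j = 2 then [:[:0, 1:]:] else [:0, 1:]) else 0)" for k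
  proof -
    have c: "coord_poly B i = (\<Sum>j\<in>UNIV. [:[:[:B $ j $ i:]:]:] * (if j = 1 then [:[:[:0, 1:]:]:] else if j = 2 then [:[:0, 1:]:] else [:0, 1:]))" for i
      by (simp add: sum_3 coord_poly_def)
    have "to_poly B (L k) = (\<Sum>i\<in>UNIV. [:[:[:A $ i $ k:]:]:] * coord_poly B i)"
    proof -
      have "to_poly B (const c) = [:[:[:c:]:]:]" "to_poly B (var i) = coord_poly B i" for c i
        by (simp_all add: to_poly_def const3_hom)
      then show ?thesis by (simp add: L_def lin_def T.hom_sum T.hom_mult)
    qed
    also have "\<dots> = (\<Sum>j\<in>UNIV. (\<Sum>i\<in>UNIV. [:[:[:B $ j $ i * A $ i $ k:]:]:]) * (if j = 1 then [:[:[:0, 1:]:]:] else if j = 2 then [:[:0, 1:]:] else [:0, 1:]))"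
      by (simp add: sum_3 c algebra_simps)
    also have "\<dots> = (\<Sum>j\<in>UNIV. [:[:[:if j = k then 1 else 0:]:]:] * (if j = 1 then [:[:[:0, 1:]:]:] else if j = 2 then [:[:0, 1:]:] else [:0, 1:]))"
      by (intro sum.cong refl) (simp only: e2[symmetric] sum_3 add_pCons add_0_right)
    finally show ?thesis by (simp add: sum_3 pCons_one)
  qed
  have "from_poly L (to_poly B F) = F" for F by (rule from_to_poly) (rule 1)
  moreover have "to_poly B (from_poly L P) = P" for P
    by (rule to_from_poly) (simp_all add: 2)
  ultimately show ?thesis by blast
qed

lemma irreducible_to_poly:
  assumes "invertible B" "irreducible F"
  shows "irreducible (to_poly B F)"
proof -
  obtain L where L: "\<And>F. from_poly L (to_poly B F) = F" "\<And>P. to_poly B (from_poly L P) = P"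
    using to_poly_inverse[OF assms(1)] by auto
  interpret T: comm_ring_hom "to_poly B" by (rule to_poly_hom)
  interpret S: comm_ring_hom "from_poly L" by (rule from_poly_hom)
  show ?thesis
  proof (rule Factorial_Ring.irreducibleI)
    show "to_poly B F \<noteq> 0" using assms(2) L(1)[of F] by auto
    show "\<not> to_poly B F dvd 1"
      using assms(2) S.hom_dvd_1[of "to_poly B F"] unfolding L(1) by (auto simp: Factorial_Ring.irreducible_def)
    fix P Q assume "to_poly B F = P * Q"
    then have "from_poly L (to_poly B F) = from_poly L P * from_poly L Q" by (simp only: S.hom_mult)
    then have "from_poly L P dvd 1 \<or> from_poly L Q dvd 1" unfolding L(1) by (rule Factorial_Ring.irreducibleD[OF assms(2)])
    then show "P dvd 1 \<or> Q dvd 1" using T.hom_dvd_1[of "from_poly L P"] T.hom_dvd_1[of "from_poly L Q"] unfolding L(2) by blast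
  qed
qed

text \<open>
  Irreducible elements are prime because the iterated univariate ring over a field is factorial.
\<close>

lemma irreducible_poly3_dvd_mult_iff:
  assumes "irreducible (F :: poly3)"
  shows "F dvd A * B \<longleftrightarrow> F dvd A \<or> F dvd B"
proof -
  have inv: "invertible (mat 1 :: complex ^ 3 ^ 3)" by (auto simp: invertible_def intro!: exI[of _ "mat 1"])
  obtain L where L: "\<And>F. from_poly L (to_poly (mat 1) F) = F" "\<And>P. to_poly (mat 1) (from_poly L P) = P"
    using to_poly_inverse[OF inv] by auto
  interpret T: comm_ring_hom "to_poly (mat 1)" by (rule to_poly_hom)
  interpret S: comm_ring_hom "from_poly L" by (rule from_poly_hom)
  have d: "F dvd G \<longleftrightarrow> to_poly (mat 1) F dvd to_poly (mat 1) G" for G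
  proof
    assume "to_poly (mat 1) F dvd to_poly (mat 1) G"
    from S.hom_dvd[OF this] show "F dvd G" by (simp only: L(1))
  qed (rule T.hom_dvd)
  have "prime_elem (to_poly (mat 1) F)"
    using irreducible_to_poly[OF inv assms] by (simp add: irreducible_imp_prime_elem)
  then show ?thesis unfolding d T.hom_mult by (rule prime_elem_dvd_mult_iff)
qed

section \<open>Restriction of forms to lines and planes\<close>

lemma coeff_mult_bound:
  assumes "degree p \<le> m" "degree q \<le> n"
  shows "coeff (p * q) (m + n) = coeff p m * coeff (q :: 'a::comm_semiring_1 poly) n"
proof (cases "degree p = m \<and> degree q = n")
  case True
  then show ?thesis using coeff_mult_degree_sum by blast
next
  case False
  then have "degree p + degree q < m + n" using assms by linarith
  then have "degree (p * q) < m + n" using degree_mult_le[of p q] by linarith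
  moreover have "coeff p m = 0 \<or> coeff q n = 0" using False assms by (metis coeff_eq_0 le_neq_implies_less)
  ultimately show ?thesis by (auto simp: coeff_eq_0)
qed

lemma coeff_power_bound:
  assumes "degree p \<le> 1"
  shows "degree (p ^ n) \<le> n \<and> coeff (p ^ n) n = coeff (p :: 'a::comm_semiring_1 poly) 1 ^ n"
proof (induction n)
  case (Suc n)
  then show ?case using assms coeff_mult_bound[OF assms, of "p ^ n" n] degree_mult_le[of p "p ^ n"] by auto
qed simp

lemma coeff_prod_bound:
  assumes "finite A" "\<And>i. i \<in> A \<Longrightarrow> degree (p i) \<le> n i"
  shows "degree (prod p A) \<le> sum n A \<and> coeff (prod p A) (sum n A) = (\<Prod>i\<in>A. coeff (p i :: 'a::comm_semiring_1 poly) (n i))"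
  using assms
proof induction
  case (insert i A)
  have "degree (p i * prod p A) \<le> n i + sum n A"
    using degree_mult_le[of "p i" "prod p A"] insert by (meson add_mono insertCI order_trans)
  then show ?case using insert coeff_mult_bound[of "p i" "n i" "prod p A" "sum n A"] by auto
qed simp

text \<open>
  Every variable is replaced by a polynomial of degree at most one, so a monomial of degree \<open>d\<close>
  becomes a product of \<open>d\<close> such polynomials, and its leading term only sees the leading terms of
  the factors.
\<close>

lemma pencil_degree:
  fixes a b :: "3 \<Rightarrow> 'a::comm_ring_1"
  assumes "homogeneous d F"
  shows "degree (insertion (\<lambda>c. [:h c:]) (\<lambda>i. [:a i, b i:]) F) \<le> d"
    and "coeff (insertion (\<lambda>c. [:h c:]) (\<lambda>i. [:a i, b i:]) F) d = insertion h b F"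
proof -
  have 1: "degree (\<Prod>i\<in>UNIV. [:a i, b i:] ^ Poly_Mapping.lookup m i) \<le> d \<and>
      coeff (\<Prod>i\<in>UNIV. [:a i, b i:] ^ Poly_Mapping.lookup m i) d = (\<Prod>i\<in>UNIV. b i ^ Poly_Mapping.lookup m i)"
    if "m \<in> Poly_Mapping.keys F" for m
  proof -
    have d: "d = sum (Poly_Mapping.lookup m) UNIV" using that assms by (auto simp: homogeneous_def mdeg_def)
    have p: "degree ([:a i, b i:] ^ n) \<le> n \<and> coeff ([:a i, b i:] ^ n) n = b i ^ n" for i n
      using coeff_power_bound[of "[:a i, b i:]" n] by simp
    show ?thesis
      using coeff_prod_bound[of UNIV "\<lambda>i. [:a i, b i:] ^ Poly_Mapping.lookup m i" "Poly_Mapping.lookup m"]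
      unfolding d by (simp add: p)
  qed
  show "degree (insertion (\<lambda>c. [:h c:]) (\<lambda>i. [:a i, b i:]) F) \<le> d"
    unfolding insertion_def
  proof (rule degree_sum_le[OF finite_keys])
    fix m assume "m \<in> Poly_Mapping.keys F"
    then have "degree (\<Prod>i\<in>UNIV. [:a i, b i:] ^ Poly_Mapping.lookup m i) \<le> d" using 1 by blast
    then show "degree ([:h (Poly_Mapping.lookup F m):] * (\<Prod>i\<in>UNIV. [:a i, b i:] ^ Poly_Mapping.lookup m i)) \<le> d"
      using degree_smult_le[of "h (Poly_Mapping.lookup F m)" "\<Prod>i\<in>UNIV. [:a i, b i:] ^ Poly_Mapping.lookup m i"]
      by simp
  qed
  show "coeff (insertion (\<lambda>c. [:h c:]) (\<lambda>i. [:a i, b i:]) F) d = insertion h b F"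
    unfolding insertion_def coeff_sum by (intro sum.cong refl) (simp add: 1)
qed

text \<open>The univariate polynomial \<open>F (v + z e)\<close> in \<open>z\<close>.\<close>

definition line_poly :: "poly3 \<Rightarrow> complex ^ 3 \<Rightarrow> complex ^ 3 \<Rightarrow> complex poly" where
  "line_poly F v e = insertion (\<lambda>c. [:c:]) (\<lambda>i. [:v $ i, e $ i:]) F"

text \<open>
  The polynomial \<open>F (u + x w + z e)\<close> in \<open>z\<close> with coefficients in \<open>\<complex>[x]\<close>: the affine equation of the
  curve in the chart spanned by \<open>w\<close> and \<open>e\<close> around \<open>u\<close>.
\<close>

definition plane_poly :: "poly3 \<Rightarrow> complex ^ 3 \<Rightarrow> complex ^ 3 \<Rightarrow> complex ^ 3 \<Rightarrow> complex poly poly" where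
  "plane_poly F u w e = insertion (\<lambda>c. [:[:c:]:]) (\<lambda>i. [:[:u $ i, w $ i:], [:e $ i:]:]) F"

lemma poly_hom: "comm_ring_hom (\<lambda>p. poly p x)"
  by standard simp_all

lemma map_poly_comm_ring_hom:
  assumes "comm_ring_hom h"
  shows "comm_ring_hom (map_poly h)"
proof -
  interpret comm_ring_hom h by fact
  interpret map: map_poly_comm_ring_hom h ..
  show ?thesis by standard (simp_all add: map.hom_add map.hom_mult)
qed

lemma poly_line_poly: "poly (line_poly F v e) t = evalp F (v + t *s e)"
proof -
  have "poly (line_poly F v e) t = insertion (\<lambda>c. c) (\<lambda>i. v $ i + t * e $ i) F"
    unfolding line_poly_def by (subst hom_insertion[OF poly_hom]) simp
  moreover have "(\<lambda>i. v $ i + t * e $ i) = ($) (v + t *s e)" by (simp add: fun_eq_iff)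
  ultimately show ?thesis by (simp add: evalp_def id_def del: vector_add_component)
qed

lemma map_poly_hom_pCons:
  assumes "comm_ring_hom h"
  shows "map_poly h (pCons a p) = pCons (h a) (map_poly h p)"
proof -
  interpret comm_ring_hom h by fact
  show ?thesis by (rule map_poly_pCons_hom)
qed

lemma map_plane_poly: "map_poly (\<lambda>p. poly p x) (plane_poly F u w e) = line_poly F (u + x *s w) e"
  unfolding plane_poly_def line_poly_def
  by (subst hom_insertion[OF map_poly_comm_ring_hom[OF poly_hom]])
    (simp add: map_poly_hom_pCons[OF poly_hom])

lemma poly2_hom: "comm_ring_hom (\<lambda>p. poly (poly p [:y:]) x)"
  by standard simp_all

lemma map_to_poly: "map_poly (\<lambda>p. poly (poly p [:y:]) x) (to_poly B F) = line_poly F (x *s B $ 1 + y *s B $ 2) (B $ 3)"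
  unfolding to_poly_def line_poly_def
  by (subst hom_insertion[OF map_poly_comm_ring_hom[OF poly2_hom]])
    (simp add: map_poly_hom_pCons[OF poly2_hom] coord_poly_def add.commute mult.commute)

lemma line_poly_degree:
  assumes "homogeneous d F"
  shows "degree (line_poly F v e) \<le> d" "coeff (line_poly F v e) d = evalp F e"
  using pencil_degree[OF assms, where h = "\<lambda>c. c" and a = "($) v" and b = "($) e"] by (auto simp: line_poly_def evalp_def id_def)

lemma plane_poly_degree:
  assumes "homogeneous d F"
  shows "degree (plane_poly F u w e) \<le> d" "coeff (plane_poly F u w e) d = [:evalp F e:]"
proof -
  have "comm_ring_hom (\<lambda>c::complex. [:c:])" by standard (simp_all add: pCons_one)
  from hom_insertion[OF this, of id "($) e" F]
  show "coeff (plane_poly F u w e) d = [:evalp F e:]"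
    using pencil_degree(2)[OF assms, where h = "\<lambda>c. [:c:]" and a = "\<lambda>i. [:u $ i, w $ i:]" and b = "\<lambda>i. [:e $ i:]"]
    by (simp add: plane_poly_def evalp_def)
  show "degree (plane_poly F u w e) \<le> d"
    using pencil_degree(1)[OF assms, where h = "\<lambda>c. [:c:]" and a = "\<lambda>i. [:u $ i, w $ i:]" and b = "\<lambda>i. [:e $ i:]"]
    by (simp add: plane_poly_def)
qed

lemma to_poly_degree:
  assumes "homogeneous d F"
  shows "degree (to_poly B F) \<le> d" "coeff (to_poly B F) d = [:[:evalp F (B $ 3):]:]"
proof -
  have "comm_ring_hom (\<lambda>c::complex. [:[:c:]:])" by standard (simp_all add: pCons_one)
  from hom_insertion[OF this, of id "($) (B $ 3)" F]
  show "coeff (to_poly B F) d = [:[:evalp F (B $ 3):]:]"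
    using pencil_degree(2)[OF assms, where h = "\<lambda>c. [:[:c:]:]" and a = "\<lambda>i. [:[:0, B $ 1 $ i:], [:B $ 2 $ i:]:]" and b = "\<lambda>i. [:[:B $ 3 $ i:]:]"]
    by (simp add: to_poly_def evalp_def coord_poly_def[abs_def])
  show "degree (to_poly B F) \<le> d"
    using pencil_degree(1)[OF assms, where h = "\<lambda>c. [:[:c:]:]" and a = "\<lambda>i. [:[:0, B $ 1 $ i:], [:B $ 2 $ i:]:]" and b = "\<lambda>i. [:[:B $ 3 $ i:]:]"]
    by (simp add: to_poly_def coord_poly_def[abs_def])
qed

lemma poly_poly_eq_0:
  assumes "\<And>x y. poly (poly P [:y:]) x = 0"
  shows "(P :: complex poly poly) = 0"
proof (rule ccontr)
  assume "P \<noteq> 0"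
  then have f: "finite {q. poly P q = 0}" by (rule poly_roots_finite)
  have "poly P [:y:] = 0" for y
  proof -
    have "\<forall>x. poly (poly P [:y:]) x = 0" using assms by blast
    then show "poly P [:y:] = 0" by (simp only: poly_all_0_iff_0)
  qed
  then have "range (\<lambda>y. [:y:]) \<subseteq> {q. poly P q = 0}" by auto
  with f have "finite (range (\<lambda>y. [:y:] :: complex poly))" by (rule finite_subset[rotated])
  then have "finite (UNIV :: complex set)" by (rule finite_imageD) (simp add: inj_def)
  then show False by (simp add: infinite_UNIV_char_0)
qed

lemma line_poly_eq_0:
  assumes "\<And>t. evalp F (v + t *s e) = 0"
  shows "line_poly F v e = 0"
proof -
  have "\<forall>t. poly (line_poly F v e) t = 0" by (simp add: poly_line_poly assms)
  then show ?thesis by (simp only: poly_all_0_iff_0)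
qed

text \<open>
  A polynomial is determined by its values since the field is infinite; in the iterated univariate
  ring this is the univariate fact, applied to one variable after the other.
\<close>

lemma evalp_eq_0_imp:
  assumes "\<And>v. evalp F v = 0"
  shows "F = 0"
proof -
  have inv: "invertible (mat 1 :: complex ^ 3 ^ 3)" by (auto simp: invertible_def intro!: exI[of _ "mat 1"])
  obtain L where L: "\<And>F. from_poly L (to_poly (mat 1) F) = F" "\<And>P. to_poly (mat 1) (from_poly L P) = P"
    using to_poly_inverse[OF inv] by auto
  have "coeff (to_poly (mat 1) F) n = 0" for n
  proof (rule poly_poly_eq_0)
    fix x y
    have "map_poly (\<lambda>p. poly (poly p [:y:]) x) (to_poly (mat 1) F) = 0"
      unfolding map_to_poly by (rule line_poly_eq_0[OF assms])
    from arg_cong[OF this, of "\<lambda>p. coeff p n"]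
    show "poly (poly (coeff (to_poly (mat 1) F) n) [:y:]) x = 0"
      by (simp add: coeff_map_poly)
  qed
  then have "to_poly (mat 1) F = 0" by (simp add: poly_eq_iff)
  interpret S: comm_ring_hom "from_poly L" by (rule from_poly_hom)
  show ?thesis using L(1)[of F] \<open>to_poly (mat 1) F = 0\<close> by simp
qed

lemma evalp_lin: "evalp (lin a) v = (\<Sum>i\<in>UNIV. a $ i * v $ i)"
proof -
  interpret comm_ring_hom "\<lambda>F. evalp F v" by (rule evalp_hom)
  show ?thesis
    by (simp add: lin_def hom_sum hom_mult) (simp add: evalp_def id_hom)
qed

text \<open>
  The product of finitely many nonzero polynomials is nonzero. All choices in general position
  below come from this.
\<close>

lemma ex_evalp_nonzero:
  assumes "finite A" "\<And>F. F \<in> A \<Longrightarrow> F \<noteq> 0"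
  shows "\<exists>v. \<forall>F\<in>A. evalp F v \<noteq> 0"
proof -
  have "\<Prod>A \<noteq> 0" using assms by auto
  then obtain v where "evalp (\<Prod>A) v \<noteq> 0" using evalp_eq_0_imp[of "\<Prod>A"] by blast
  interpret comm_ring_hom "\<lambda>F. evalp F v" by (rule evalp_hom)
  have "evalp (\<Prod>A) v = (\<Prod>F\<in>A. evalp F v)" by (simp add: hom_prod)
  with \<open>evalp (\<Prod>A) v \<noteq> 0\<close> show ?thesis using assms(1) by auto
qed

section \<open>Resultants of complex polynomials\<close>

text \<open>Multisets keep the multiplicities of the roots.\<close>

definition linprod :: "complex multiset \<Rightarrow> complex poly" where
  "linprod A = (\<Prod>\<alpha>\<in>#A. [:- \<alpha>, 1:])"

lemma linprod_nonzero [simp]: "linprod A \<noteq> 0"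
  by (auto simp: linprod_def prod_mset_zero_iff)

lemma degree_linprod [simp]: "degree (linprod A) = size A"
proof (induction A)
  case (add x A)
  have "linprod (add_mset x A) = [:-x, 1:] * linprod A" by (simp add: linprod_def)
  then have "degree (linprod (add_mset x A)) = degree [:-x, 1:] + degree (linprod A)"
    by (simp only:) (rule degree_mult_eq, auto)
  then show ?case using add by simp
qed (simp add: linprod_def)

lemma lead_coeff_linprod [simp]: "coeff (linprod A) (size A) = 1"
proof -
  have "lead_coeff (linprod A) = 1"
  proof (induction A)
    case (add x A)
    have "linprod (add_mset x A) = [:-x, 1:] * linprod A" by (simp add: linprod_def)
    then have "lead_coeff (linprod (add_mset x A)) = lead_coeff [:-x, 1:] * lead_coeff (linprod A)"
      by (simp only: lead_coeff_mult)
    then show ?case using add by simp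
  qed (simp add: linprod_def)
  then show ?thesis by simp
qed

lemma poly_linprod: "poly (linprod A) x = (\<Prod>\<alpha>\<in>#A. x - \<alpha>)"
  unfolding linprod_def by (induction A) (simp_all del: mult_pCons_left)

lemma poly_linprod_eq_0_iff [simp]: "poly (linprod A) x = 0 \<longleftrightarrow> x \<in># A"
  by (auto simp: poly_linprod prod_mset_zero_iff image_iff)

lemma complex_poly_split:
  assumes "p \<noteq> (0 :: complex poly)"
  shows "\<exists>a A. a \<noteq> 0 \<and> p = smult a (linprod A) \<and> degree p = size A \<and> lead_coeff p = a"
proof -
  have "p = smult (lead_coeff p) (linprod (proots p))"
    unfolding linprod_def by (rule complex_poly_decompose_multiset[symmetric])
  moreover have "lead_coeff p \<noteq> 0" using assms by simp
  ultimately show ?thesis using size_proots_complex[of p, symmetric] by blast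
qed

text \<open>
  Both sides are \<open>a ^ size B * b ^ size A\<close> times the product of all differences of a root in \<open>A\<close> and
  a root in \<open>B\<close>, up to the sign of the differences.
\<close>

lemma root_products_symmetric:
  fixes a b :: complex
  shows "a ^ size B * (\<Prod>\<alpha>\<in>#A. poly (smult b (linprod B)) \<alpha>) =
    (- 1) ^ (size A * size B) * (b ^ size A * (\<Prod>\<beta>\<in>#B. poly (smult a (linprod A)) \<beta>))"
proof -
  have s: "(\<Prod>\<alpha>\<in>#A. c * f \<alpha>) = c ^ size A * (\<Prod>\<alpha>\<in>#A. f \<alpha>)" for c :: complex and f :: "complex \<Rightarrow> complex" and A
    by (simp add: prod_mset.distrib)
  have "(\<Prod>\<alpha>\<in>#A. \<Prod>\<beta>\<in>#B. \<alpha> - \<beta>) = (\<Prod>\<beta>\<in>#B. \<Prod>\<alpha>\<in>#A. \<alpha> - \<beta>)"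
    by (rule prod_mset.swap)
  also have "(\<lambda>\<beta>. \<Prod>\<alpha>\<in>#A. \<alpha> - \<beta>) = (\<lambda>\<beta>. (- 1) ^ size A * (\<Prod>\<alpha>\<in>#A. \<beta> - \<alpha>))"
  proof
    fix \<beta>
    show "(\<Prod>\<alpha>\<in>#A. \<alpha> - \<beta>) = (- 1) ^ size A * (\<Prod>\<alpha>\<in>#A. \<beta> - \<alpha>)"
      using s[of "- 1" "\<lambda>\<alpha>. \<beta> - \<alpha>" A] by simp
  qed
  finally have "(\<Prod>\<alpha>\<in>#A. \<Prod>\<beta>\<in>#B. \<alpha> - \<beta>) = (- 1) ^ (size A * size B) * (\<Prod>\<beta>\<in>#B. \<Prod>\<alpha>\<in>#A. \<beta> - \<alpha>)"
    by (simp add: s power_mult)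
  then show ?thesis by (simp add: poly_linprod s)
qed

text \<open>
  This is the case of index zero of the behaviour of subresultants under one division step; for a
  constant remainder the general formula does not apply and its companion is used.
\<close>

lemma resultant_euclid_step:
  fixes F G H B :: "complex poly"
  assumes "F + B * G = H" "degree G \<le> degree F" "degree H < degree G"
  shows "resultant F G = (- 1) ^ (degree F * degree G) * lead_coeff G ^ (degree F - degree H) * resultant G H"
proof (cases "degree H = 0")
  case True
  have "subresultant 0 F G = smult ((- 1) ^ (degree F * degree G) * lead_coeff G ^ degree F * lead_coeff H ^ (degree G - 1)) H"
    using BT_lemma_1_13[OF assms(1,2)] assms(3) True by simp
  from arg_cong[OF this, of "\<lambda>p. coeff p 0"]
  have "resultant F G = (- 1) ^ (degree F * degree G) * lead_coeff G ^ degree F * (lead_coeff H ^ (degree G - 1) * coeff H 0)"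
    by (simp add: coeff_subresultant_0_0_resultant mult.assoc)
  also have "lead_coeff H ^ (degree G - 1) * coeff H 0 = resultant G H"
  proof -
    obtain h where h: "H = [:h:]" using degree_eq_zeroE[OF True] .
    obtain n where "degree G = Suc n" using assms(3) by (cases "degree G") auto
    then show ?thesis unfolding h by simp
  qed
  finally show ?thesis using True by simp
next
  case False
  have "subresultant 0 F G = smult ((- 1) ^ (degree F * degree G) * lead_coeff G ^ (degree F - degree H)) (subresultant 0 G H)"
    using BT_lemma_1_12[OF assms(1,2), of 0] assms(3) False by simp
  from arg_cong[OF this, of "\<lambda>p. coeff p 0"]
  show ?thesis by (simp add: coeff_subresultant_0_0_resultant)
qed

text \<open>
  The Euclidean algorithm: replacing \<open>f\<close> by its remainder \<open>f mod g\<close> does not change the values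
  at the roots of \<open>g\<close>, and the product over the roots of \<open>f\<close> can be exchanged with the one over
  the roots of \<open>g\<close> by \<open>root_products_symmetric\<close>.
\<close>

lemma resultant_roots:
  assumes "g \<noteq> 0" "a \<noteq> 0"
  shows "resultant (smult a (linprod A)) g = a ^ degree g * (\<Prod>\<alpha>\<in>#A. poly g \<alpha>)"
  using assms
proof (induction "degree g" arbitrary: g a A rule: less_induct)
  case less
  define f where "f = smult a (linprod A)"
  have f: "f \<noteq> 0" "degree f = size A" using less.prems by (auto simp: f_def)
  obtain b B where g: "b \<noteq> 0" "g = smult b (linprod B)" "degree g = size B" "lead_coeff g = b"
    using complex_poly_split[OF less.prems(1)] by blast
  consider "degree g = 0" | "degree g > 0" "degree g \<le> degree f" | "degree f < degree g" by linarith
  then have "resultant f g = a ^ degree g * (\<Prod>\<alpha>\<in>#A. poly g \<alpha>)"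
  proof cases
    case 1
    then obtain c where c: "g = [:c:]" using degree_eq_zeroE by blast
    have "(\<Prod>\<alpha>\<in>#A. c) = c ^ size A" by simp
    then show ?thesis using f by (simp add: c)
  next
    case 2
    define H where "H = f mod g"
    have e: "f + (- (f div g)) * g = H" unfolding H_def minus_div_mult_eq_mod[symmetric] by simp
    have dH: "degree H < degree g" using degree_mod_less[of g f] 2(1) less.prems(1) unfolding H_def by (cases "f mod g = 0") auto
    have Hb: "poly H \<beta> = poly f \<beta>" if "\<beta> \<in># B" for \<beta>
    proof -
      have "poly g \<beta> = 0" using that by (simp add: g(2))
      then show ?thesis unfolding e[symmetric] by simp
    qed
    have Hp: "(\<Prod>\<beta>\<in>#B. poly H \<beta>) = (\<Prod>\<beta>\<in>#B. poly f \<beta>)"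
      using Hb by (intro arg_cong[where f = prod_mset] image_mset_cong) auto
    have "resultant f g = (- 1) ^ (degree f * degree g) * b ^ (degree f - degree H) * resultant g H"
      using resultant_euclid_step[OF e 2(2) dH] g(4) by simp
    also have "\<dots> = (- 1) ^ (degree f * degree g) * (b ^ degree f * (\<Prod>\<beta>\<in>#B. poly f \<beta>))"
    proof (cases "H = 0")
      case True
      have "B \<noteq> {#}" using 2(1) g(3) by auto
      then obtain \<beta> where "\<beta> \<in># B" by blast
      then have "(\<Prod>\<beta>\<in>#B. poly f \<beta>) = 0" using Hb[of \<beta>] True by auto
      then show ?thesis using True 2(1) by simp
    next
      case False
      have "resultant g H = b ^ degree H * (\<Prod>\<beta>\<in>#B. poly H \<beta>)"
        using less.hyps[OF dH False g(1), of B] g(2) by simp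
      moreover have "b ^ degree f = b ^ (degree f - degree H) * b ^ degree H"
        using dH 2(2) by (simp add: power_add[symmetric])
      ultimately show ?thesis by (simp add: Hp)
    qed
    also have "\<dots> = a ^ degree g * (\<Prod>\<alpha>\<in>#A. poly g \<alpha>)"
      using root_products_symmetric[of a B b A] f(2) g(3) unfolding g(2)[symmetric] f_def[symmetric] by simp
    finally show ?thesis .
  next
    case 3
    have "resultant g f = b ^ degree f * (\<Prod>\<beta>\<in>#B. poly f \<beta>)"
      using less.hyps[OF 3 f(1) g(1), of B] g(2) by simp
    then have "resultant f g = (- 1) ^ (degree f * degree g) * (b ^ degree f * (\<Prod>\<beta>\<in>#B. poly f \<beta>))"
      by (subst resultant_swap) simp
    also have "\<dots> = a ^ degree g * (\<Prod>\<alpha>\<in>#A. poly g \<alpha>)"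
      using root_products_symmetric[of a B b A] f(2) g(3) unfolding g(2)[symmetric] f_def[symmetric] by simp
    finally show ?thesis .
  qed
  then show ?case unfolding f_def .
qed

lemma complex_resultant_eq_0_iff:
  assumes "f \<noteq> 0" "g \<noteq> (0 :: complex poly)"
  shows "resultant f g = 0 \<longleftrightarrow> (\<exists>z. poly f z = 0 \<and> poly g z = 0)"
proof -
  obtain a A where f: "a \<noteq> 0" "f = smult a (linprod A)" using complex_poly_split[OF assms(1)] by blast
  have "poly f z = 0 \<longleftrightarrow> z \<in># A" for z using f(1) by (simp add: f(2))
  then show ?thesis using resultant_roots[OF assms(2) f(1), of A] f by auto
qed

text \<open>
  The roots of \<open>f'\<close> are the images of the roots of \<open>f\<close> under \<open>z \<mapsto> \<mu> z + c\<close>.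
\<close>

lemma resultant_substitution:
  fixes f g f' g' :: "complex poly"
  assumes "f \<noteq> 0" "g \<noteq> 0" "\<mu> \<noteq> 0" "degree f' = degree f" "degree g' = degree g"
    and "lead_coeff f' = lead_coeff f"
    and "\<And>z. poly f' (\<mu> * z + c) = \<mu> ^ degree f * poly f z"
    and "\<And>z. poly g' (\<mu> * z + c) = \<mu> ^ degree g * poly g z"
  shows "resultant f' g' = \<mu> ^ (degree f * degree g) * resultant f g"
proof -
  obtain a A where f: "a \<noteq> 0" "f = smult a (linprod A)" "degree f = size A" "lead_coeff f = a"
    using complex_poly_split[OF assms(1)] by blast
  have f'0: "f' \<noteq> 0" using assms(1,6) by auto
  have g'0: "g' \<noteq> 0"
  proof
    assume "g' = 0"
    then have "\<forall>z. poly g z = 0" using assms(3,8) by simp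
    then show False using assms(2) by (simp only: poly_all_0_iff_0)
  qed
  define A' where "A' = image_mset (\<lambda>z. \<mu> * z + c) A"
  have "poly f' w = poly (smult a (linprod A')) w" for w
  proof -
    have w: "w = \<mu> * ((w - c) / \<mu>) + c" using assms(3) by simp
    have "poly f' w = \<mu> ^ size A * poly f ((w - c) / \<mu>)"
      using assms(7)[of "(w - c) / \<mu>"] w f(3) by simp
    also have "\<dots> = a * (\<Prod>\<alpha>\<in>#A. \<mu> * ((w - c) / \<mu> - \<alpha>))"
      by (simp add: f(2) poly_linprod prod_mset.distrib)
    also have "(\<lambda>\<alpha>. \<mu> * ((w - c) / \<mu> - \<alpha>)) = (\<lambda>\<alpha>. w - (\<mu> * \<alpha> + c))"
      using assms(3) by (simp add: fun_eq_iff field_simps)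
    finally show ?thesis by (simp add: poly_linprod A'_def image_mset.compositionality comp_def)
  qed
  then have "f' = smult a (linprod A')" by (simp add: poly_eq_poly_eq_iff[symmetric] fun_eq_iff)
  then have "resultant f' g' = a ^ degree g * (\<Prod>\<alpha>\<in>#A'. poly g' \<alpha>)"
    using resultant_roots[OF g'0 f(1), of A'] assms(5) by simp
  also have "(\<Prod>\<alpha>\<in>#A'. poly g' \<alpha>) = (\<Prod>\<alpha>\<in>#A. \<mu> ^ degree g * poly g \<alpha>)"
    by (simp add: A'_def image_mset.compositionality comp_def assms(8))
  also have "\<dots> = \<mu> ^ (degree f * degree g) * (\<Prod>\<alpha>\<in>#A. poly g \<alpha>)"
    by (simp add: f(3) prod_mset.distrib power_mult[symmetric] mult.commute)
  finally show ?thesis using resultant_roots[OF assms(2) f(1), of A] f(2) by simp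
qed

lemma resultant_linear_factor:
  fixes f g :: "complex poly"
  assumes "f \<noteq> 0" "g \<noteq> 0"
  shows "resultant ([:- \<zeta>, 1:] * f) g = poly g \<zeta> * resultant f g"
proof -
  obtain a A where f: "a \<noteq> 0" "f = smult a (linprod A)" using complex_poly_split[OF assms(1)] by blast
  have "[:- \<zeta>, 1:] * f = smult a (linprod (add_mset \<zeta> A))"
    by (simp add: f(2) linprod_def del: mult_pCons_left)
  then show ?thesis using resultant_roots[OF assms(2) f(1), of A] resultant_roots[OF assms(2) f(1), of "add_mset \<zeta> A"] f
    by (simp add: mult.left_commute)
qed

section \<open>Divisibility of resultants\<close>

text \<open>
  Weights \<open>r\<close> on the rows and \<open>c\<close> on the columns are collected in every term of the Leibniz
  expansion, whatever the permutation is.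
\<close>

lemma power_dvd_det:
  fixes a :: "'a::idom" and A :: "'a mat"
  assumes A: "A \<in> carrier_mat N N"
    and dvd: "\<And>i j. i < N \<Longrightarrow> j < N \<Longrightarrow> a ^ c j dvd a ^ r i * A $$ (i, j)"
  shows "a ^ (\<Sum>j<N. c j) dvd a ^ (\<Sum>i<N. r i) * Determinant.det A"
proof -
  have "a ^ (\<Sum>i<N. r i) * Determinant.det A =
     (\<Sum>p\<in>{p. p permutes {0..<N}}. signof p * (\<Prod>i=0..<N. a ^ r i * A $$ (i, p i)))"
    unfolding det_def'[OF A] sum_distrib_left prod.distrib
    by (intro sum.cong refl) (simp add: power_sum atLeast0LessThan mult.left_commute)
  moreover have "a ^ (\<Sum>j<N. c j) dvd signof p * (\<Prod>i=0..<N. a ^ r i * A $$ (i, p i))"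
    if "p permutes {0..<N}" for p
  proof -
    have "(\<Sum>j<N. c j) = (\<Sum>i=0..<N. c (p i))"
      using sum.permute[OF that, of c] by (simp add: atLeast0LessThan comp_def)
    then have "a ^ (\<Sum>j<N. c j) = (\<Prod>i=0..<N. a ^ c (p i))" by (simp add: power_sum)
    also have "\<dots> dvd (\<Prod>i=0..<N. a ^ r i * A $$ (i, p i))"
    proof (rule prod_dvd_prod)
      fix i assume "i \<in> {0..<N}"
      moreover from this have "p i \<in> {0..<N}" using permutes_in_image[OF that] by blast
      ultimately show "a ^ c (p i) dvd a ^ r i * A $$ (i, p i)" by (intro dvd) auto
    qed
    finally show ?thesis by (rule dvd_mult)
  qed
  ultimately show ?thesis by (metis (no_types, lifting) dvd_sum mem_Collect_eq)
qed

lemma sum_truncated: "2 * (\<Sum>s<k + n. n - s) = n * (n + 1 :: nat)"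
proof -
  have "(\<Sum>s<k + n. n - s) = (\<Sum>s<n. n - s)"
    by (rule sum.mono_neutral_right) auto
  also have "\<dots> = (\<Sum>s<n. Suc (n - Suc s))" by (intro sum.cong) auto
  also have "\<dots> = (\<Sum>s<n. Suc s)" by (rule sum.nat_diff_reindex)
  finally have e: "(\<Sum>s<k + n. n - s) = (\<Sum>s<n. Suc s)" .
  show ?thesis unfolding e by (induction n) auto
qed

lemma sum_lessThan_add: "(\<Sum>i<a + b. f i) = (\<Sum>i<a. f i) + (\<Sum>i<b. f (a + i) :: nat)"
  for a b :: nat
  by (induction b) simp_all

text \<open>
  Two polynomials in \<open>z\<close> over \<open>\<complex>[x]\<close> that vanish at a point to the orders \<open>m\<close> and \<open>n\<close> have a resultant
  that vanishes to order \<open>m n\<close>. The Sylvester matrix has weights for \<open>power_dvd_det\<close>: scaling the row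
  that belongs to \<open>z\<^sup>s f\<close> by \<open>a ^ (n - s)\<close>, and the one of \<open>z\<^sup>s g\<close> by \<open>a ^ (m - s)\<close>, makes the column of
  \<open>z\<^sup>t\<close> divisible by \<open>a ^ (m + n - t)\<close>. The exponents of the columns exceed those of the rows by
  \<open>m n\<close> in total.
\<close>

lemma power_dvd_resultant:
  fixes f g :: "'a::idom poly"
  assumes "a \<noteq> 0" "\<And>j. a ^ (m - j) dvd coeff f j" "\<And>j. a ^ (n - j) dvd coeff g j"
    and "m \<le> degree f" "n \<le> degree g"
  shows "a ^ (m * n) dvd resultant f g"
proof -
  let ?D = "degree f" and ?E = "degree g" and ?N = "degree f + degree g"
  \<comment> \<open>Row \<open>i\<close> belongs to \<open>z\<^sup>s f\<close> with \<open>s = ?E - 1 - i\<close>, or to \<open>z\<^sup>s g\<close> with \<open>s = ?N - 1 - i\<close>; column \<open>j\<close>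
    belongs to \<open>z\<^sup>t\<close> with \<open>t = ?N - 1 - j\<close>.\<close>
  define r where "r i = (if i < ?E then n - (?E - 1 - i) else m - (?N - 1 - i))" for i
  define c where "c j = m + n - (?N - 1 - j)" for j
  have "a ^ c j dvd a ^ r i * sylvester_mat f g $$ (i, j)" if ij: "i < ?N" "j < ?N" for i j
  proof -
    have *: "a ^ c j dvd a ^ s * x" if "a ^ t dvd x" "c j \<le> s + t" for s t and x :: 'a
    proof -
      have "a ^ c j dvd a ^ (s + t)" using that(2) by (rule le_imp_power_dvd)
      also have "a ^ (s + t) dvd a ^ s * x" unfolding power_add using that(1) by (intro mult_dvd_mono dvd_refl)
      finally show "a ^ c j dvd a ^ s * x" .
    qed
    show ?thesis
    proof (cases "i < ?E")
      case True
      show ?thesis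
      proof (cases "i \<le> j \<and> j - i \<le> ?D")
        case t: True
        have "?N - 1 - j = (?E - 1 - i) + (?D + i - j)" using True t ij by linarith
        then have "c j \<le> r i + (m - (?D + i - j))" unfolding c_def r_def using True by simp
        from *[OF assms(2) this] show ?thesis using True t ij by (simp add: sylvester_index_mat)
      next
        case False
        then show ?thesis using True ij by (auto simp: sylvester_index_mat)
      qed
    next
      case False
      show ?thesis
      proof (cases "i - ?E \<le> j \<and> j \<le> i")
        case t: True
        have "?N - 1 - j = (?N - 1 - i) + (i - j)" using False t ij by linarith
        moreover have "m + n - ((?N - 1 - i) + (i - j)) \<le> (m - (?N - 1 - i)) + (n - (i - j))" by linarith
        ultimately have "c j \<le> r i + (n - (i - j))" unfolding c_def r_def using False by (simp only: if_False)
        from *[OF assms(3) this] show ?thesis using False t ij by (simp add: sylvester_index_mat)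
      next
        case f: False
        then show ?thesis using False ij by (auto simp: sylvester_index_mat)
      qed
    qed
  qed
  from power_dvd_det[OF sylvester_carrier_mat this]
  have d: "a ^ (\<Sum>j<?N. c j) dvd a ^ (\<Sum>i<?N. r i) * resultant f g" by (simp add: resultant_def)
  have "(\<Sum>j<?N. c j) = (\<Sum>s<?N. m + n - s)"
    unfolding c_def using sum.nat_diff_reindex[of "\<lambda>s. m + n - s" ?N] by simp
  then have c: "2 * (\<Sum>j<?N. c j) = (m + n) * (m + n + 1)"
    using sum_truncated[where k = "?N - (m + n)" and n = "m + n"] assms(4,5) by simp
  have "(\<Sum>i<?N. r i) = (\<Sum>i<?E. r i) + (\<Sum>i<?D. r (?E + i))"
    by (subst add.commute) (rule sum_lessThan_add)
  also have "(\<Sum>i<?E. r i) = (\<Sum>s<?E. n - s)"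
    using sum.nat_diff_reindex[of "\<lambda>s. n - s" ?E] by (simp add: r_def)
  also have "(\<Sum>i<?D. r (?E + i)) = (\<Sum>s<?D. m - s)"
    using sum.nat_diff_reindex[of "\<lambda>s. m - s" ?D] by (simp add: r_def add.commute)
  finally have r: "2 * (\<Sum>i<?N. r i) = n * (n + 1) + m * (m + 1)"
    using sum_truncated[where k = "?E - n" and n = n] sum_truncated[where k = "?D - m" and n = m] assms(4,5)
    by (simp add: add_mult_distrib2)
  have "(m + n) * (m + n + 1) = n * (n + 1) + m * (m + 1) + 2 * (m * n)"
    by (simp add: algebra_simps)
  with c have "2 * (\<Sum>j<?N. c j) = n * (n + 1) + m * (m + 1) + 2 * (m * n)" by (rule trans)
  also have "\<dots> = 2 * (\<Sum>i<?N. r i) + 2 * (m * n)" by (simp only: r)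
  also have "\<dots> = 2 * ((\<Sum>i<?N. r i) + m * n)" by (simp only: distrib_left)
  finally have e: "(\<Sum>j<?N. c j) = (\<Sum>i<?N. r i) + m * n" by (simp only: mult_cancel1) simp
  have "a ^ (\<Sum>i<?N. r i) * a ^ (m * n) dvd a ^ (\<Sum>i<?N. r i) * resultant f g"
    using d by (simp only: e power_add)
  moreover have "a ^ (\<Sum>i<?N. r i) \<noteq> 0" using assms(1) by simp
  ultimately show ?thesis by (simp only: dvd_mult_cancel_left) simp
qed

lemma prod_diff_dvd:
  fixes f g :: "'b \<Rightarrow> 'a::comm_ring_1"
  assumes "finite A" "\<And>i. i \<in> A \<Longrightarrow> a dvd f i - g i"
  shows "a dvd prod f A - prod g A"
  using assms
proof induction
  case (insert i A)
  have "f i * prod f A - g i * prod g A = (f i - g i) * prod f A + g i * (prod f A - prod g A)"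
    by (simp add: algebra_simps)
  moreover have "a dvd (f i - g i) * prod f A" by (rule dvd_mult2) (simp add: insert.prems)
  moreover have "a dvd g i * (prod f A - prod g A)"
    by (rule dvd_mult, rule insert.IH) (simp add: insert.prems)
  ultimately show ?case using insert.hyps by (simp add: dvd_add)
qed simp

lemma det_diff_dvd:
  fixes A B :: "'a::comm_ring_1 mat"
  assumes "A \<in> carrier_mat N N" "B \<in> carrier_mat N N"
    and "\<And>i j. i < N \<Longrightarrow> j < N \<Longrightarrow> a dvd A $$ (i, j) - B $$ (i, j)"
  shows "a dvd Determinant.det A - Determinant.det B"
proof -
  have "a dvd (\<Prod>i=0..<N. A $$ (i, p i)) - (\<Prod>i=0..<N. B $$ (i, p i))" if "p permutes {0..<N}" for p
    using permutes_in_image[OF that] by (intro prod_diff_dvd) (auto intro!: assms(3))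
  then show ?thesis
    unfolding det_def'[OF assms(1)] det_def'[OF assms(2)] sum_subtractf[symmetric] right_diff_distrib[symmetric]
    by (intro dvd_sum dvd_mult) auto
qed

text \<open>
  The resultant is a polynomial in the coefficients once the degrees are fixed, so it respects
  congruences.
\<close>

lemma resultant_diff_dvd:
  fixes f f' g :: "'a::comm_ring_1 poly"
  assumes "degree f' = degree f" "\<And>j. a dvd coeff f j - coeff f' j"
  shows "a dvd resultant f g - resultant f' g"
proof -
  have "a dvd sylvester_mat f g $$ (i, j) - sylvester_mat f' g $$ (i, j)"
    if "i < degree f + degree g" "j < degree f + degree g" for i j
    using that assms by (simp add: sylvester_index_mat)
  then show ?thesis unfolding resultant_def
    using sylvester_carrier_mat[of f g] sylvester_carrier_mat[of f' g] assms(1)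
    by (intro det_diff_dvd[of _ "degree f + degree g"]) auto
qed

section \<open>Products and divisors of forms\<close>

lemma homogeneous_add: "homogeneous k A \<Longrightarrow> homogeneous k B \<Longrightarrow> homogeneous k (A + B)"
  using Poly_Mapping.keys_add[of A B] by (auto simp: homogeneous_def)

lemma homogeneous_minus: "homogeneous k A \<Longrightarrow> homogeneous k (- A)"
  by (simp add: homogeneous_def)

lemma mdeg_add: "mdeg (m + n) = mdeg m + mdeg n"
  by (simp add: mdeg_def lookup_add sum.distrib)

lemma homogeneous_mult: "homogeneous k A \<Longrightarrow> homogeneous l B \<Longrightarrow> homogeneous (k + l) (A * B)"
  using Poly_Mapping.keys_mult[of A B] by (fastforce simp: homogeneous_def mdeg_add)

lemma homogeneous_const [simp]: "homogeneous 0 (const c)"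
  by (auto simp: homogeneous_def const_def mdeg_def)

lemma homogeneous_1 [simp]: "homogeneous 0 1"
  using homogeneous_const[of 1] by (simp add: const_def)

lemma mdeg_single: "mdeg (Poly_Mapping.single i n) = n"
  by (simp add: mdeg_def lookup_single when_def)

lemma homogeneous_var [simp]: "homogeneous 1 (var i)"
  by (auto simp: homogeneous_def var_def mdeg_single)

lemma homogeneous_power: "homogeneous k A \<Longrightarrow> homogeneous (n * k) (A ^ n)"
  by (induction n) (auto intro: homogeneous_mult)

text \<open>
  Along a line through the origin the form \<open>A\<close> is a monomial of degree \<open>e\<close>, and it is divisible by the
  monomial of degree \<open>d\<close> that \<open>F\<close> becomes.
\<close>

lemma homogeneous_dvd_degree_le:
  assumes "homogeneous d F" "homogeneous e A" "A \<noteq> 0" "F dvd A"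
  shows "d \<le> e"
proof -
  obtain G where A: "A = F * G" using assms(4) by (auto simp: dvd_def)
  obtain v where v: "evalp A v \<noteq> 0" using evalp_eq_0_imp[of A] assms(3) by blast
  interpret ev: comm_ring_hom "\<lambda>F. evalp F w" for w by (rule evalp_hom)
  have "poly (monom (evalp A v) e) t = poly (monom (evalp F v) d * line_poly G 0 v) t" for t
  proof -
    have "poly (monom (evalp A v) e) t = evalp A (t *s v)"
      by (simp add: poly_monom evalp_homogeneous[OF assms(2)])
    also have "\<dots> = evalp F (t *s v) * evalp G (t *s v)" by (simp only: A ev.hom_mult)
    also have "\<dots> = poly (monom (evalp F v) d * line_poly G 0 v) t"
      by (simp add: poly_monom evalp_homogeneous[OF assms(1)] poly_line_poly)
    finally show "poly (monom (evalp A v) e) t = poly (monom (evalp F v) d * line_poly G 0 v) t" .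
  qed
  then have eq: "monom (evalp A v) e = monom (evalp F v) d * line_poly G 0 v"
    by (simp only: poly_eq_poly_eq_iff[symmetric] fun_eq_iff) simp
  then have "monom (evalp F v) d \<noteq> 0" "line_poly G 0 v \<noteq> 0" using v by auto
  then have "degree (monom (evalp A v) e) = degree (monom (evalp F v) d) + degree (line_poly G 0 v)"
    unfolding eq by (rule degree_mult_eq)
  moreover have "evalp F v \<noteq> 0" using \<open>monom (evalp F v) d \<noteq> 0\<close> by auto
  ultimately show ?thesis using v by (simp add: degree_monom_eq)
qed

text \<open>
  Evaluating a polynomial stays in any set that contains the constants and the values of the
  variables that occur and is closed under the ring operations.
\<close>

lemma insertion_closed:
  assumes "0 \<in> T" "1 \<in> T" "\<And>a b. a \<in> T \<Longrightarrow> b \<in> T \<Longrightarrow> a + b \<in> T" "\<And>a b. a \<in> T \<Longrightarrow> b \<in> T \<Longrightarrow> a * b \<in> T"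
    and "\<And>c. h c \<in> T" "\<And>m i. m \<in> Poly_Mapping.keys A \<Longrightarrow> Poly_Mapping.lookup m i \<noteq> 0 \<Longrightarrow> f i \<in> T"
  shows "insertion h f A \<in> T"
proof -
  have pw: "x ^ n \<in> T" if "x \<in> T" for x n by (induction n) (auto simp: assms that)
  have "f i ^ Poly_Mapping.lookup m i \<in> T" if "m \<in> Poly_Mapping.keys A" for m i
    using assms(6)[OF that, of i] pw assms(2) by (cases "Poly_Mapping.lookup m i = 0") auto
  moreover have pr: "(\<And>i. i \<in> S \<Longrightarrow> g i \<in> T) \<Longrightarrow> prod g S \<in> T" for S :: "3 set" and g
    by (induction S rule: infinite_finite_induct) (auto simp: assms)
  moreover have sm: "(\<And>i. i \<in> S \<Longrightarrow> g i \<in> T) \<Longrightarrow> sum g S \<in> T" for S :: "(3 \<Rightarrow>\<^sub>0 nat) set" and g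
    by (induction S rule: infinite_finite_induct) (auto simp: assms)
  ultimately show ?thesis unfolding insertion_def by (intro sm assms(4,5) pr) auto
qed

text \<open>
  Quotients of forms are polynomials in the ratios of the variables. Hence these ratios generate
  the function field.
\<close>

lemma fract_dehomogenize:
  assumes "homogeneous k A" "Y \<noteq> 0"
  shows "Fract A (Y ^ k) = insertion (\<lambda>c. Fract (const c) 1) (\<lambda>i. Fract (var i) Y) A"
proof -
  have hom: "comm_ring_hom (\<lambda>A::poly3. Fract A 1)"
    by standard (simp_all add: One_fract_def Zero_fract_def)
  have "Fract (var i) Y = Fract 1 Y * Fract (var i) 1" for i by simp
  then have "insertion (\<lambda>c. Fract (const c) 1) (\<lambda>i. Fract (var i) Y) A =
      Fract 1 Y ^ k * insertion (\<lambda>c. Fract (const c) 1) (\<lambda>i. Fract (var i) 1) A"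
    by (simp only: insertion_homogeneous[OF assms(1)])
  also have "insertion (\<lambda>c. Fract (const c) 1) (\<lambda>i. Fract (var i) 1) A = Fract A 1"
    using hom_insertion[OF hom, of const var A] by simp
  also have "Fract 1 Y ^ k = Fract 1 (Y ^ k)" by (induction k) (simp_all add: One_fract_def)
  finally show ?thesis by simp
qed

section \<open>The function field of a plane curve\<close>

lemma generic_local_ring_simps:
  "carrier (generic_local_ring F) = {Fract A B | A B k. homogeneous k A \<and> homogeneous k B \<and> \<not> F dvd B}"
  "x \<otimes>\<^bsub>generic_local_ring F\<^esub> y = x * y" "x \<oplus>\<^bsub>generic_local_ring F\<^esub> y = x + y"
  "\<one>\<^bsub>generic_local_ring F\<^esub> = 1" "\<zero>\<^bsub>generic_local_ring F\<^esub> = 0"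
  by (simp_all add: generic_local_ring_def ring_of_type_algebra_def)

context
  fixes F :: poly3
  assumes irr: "irreducible F"
begin

lemma Fract_in_generic:
  "homogeneous k A \<Longrightarrow> homogeneous k B \<Longrightarrow> \<not> F dvd B \<Longrightarrow> Fract A B \<in> carrier (generic_local_ring F)"
  by (auto simp: generic_local_ring_simps)

lemma F_not_dvd_1: "\<not> F dvd 1"
  using irr by (simp add: Factorial_Ring.irreducible_def)

lemma generic_add:
  assumes "x \<in> carrier (generic_local_ring F)" "y \<in> carrier (generic_local_ring F)"
  shows "x + y \<in> carrier (generic_local_ring F)"
proof -
  from assms obtain A B k C D l where "x = Fract A B" "homogeneous k A" "homogeneous k B" "\<not> F dvd B"
      "y = Fract C D" "homogeneous l C" "homogeneous l D" "\<not> F dvd D"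
    unfolding generic_local_ring_simps by blast
  note * = this
  have "B \<noteq> 0" "D \<noteq> 0" using * by auto
  then have "x + y = Fract (A * D + C * B) (B * D)" using * by simp
  moreover have "homogeneous (k + l) (A * D + C * B)"
  proof (rule homogeneous_add)
    show "homogeneous (k + l) (A * D)" using * by (intro homogeneous_mult)
    show "homogeneous (k + l) (C * B)" unfolding add.commute[of k] using * by (intro homogeneous_mult)
  qed
  moreover have "homogeneous (k + l) (B * D)" using * by (intro homogeneous_mult)
  moreover have "\<not> F dvd B * D" using * irreducible_poly3_dvd_mult_iff[OF irr] by simp
  ultimately show ?thesis using Fract_in_generic by simp
qed

lemma generic_mult:
  assumes "x \<in> carrier (generic_local_ring F)" "y \<in> carrier (generic_local_ring F)"
  shows "x * y \<in> carrier (generic_local_ring F)"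
proof -
  from assms obtain A B k C D l where "x = Fract A B" "homogeneous k A" "homogeneous k B" "\<not> F dvd B"
      "y = Fract C D" "homogeneous l C" "homogeneous l D" "\<not> F dvd D"
    unfolding generic_local_ring_simps by blast
  note * = this
  have "x * y = Fract (A * C) (B * D)" using * by simp
  moreover have "homogeneous (k + l) (A * C)" "homogeneous (k + l) (B * D)" using * by (auto intro: homogeneous_mult)
  moreover have "\<not> F dvd B * D" using * irreducible_poly3_dvd_mult_iff[OF irr] by simp
  ultimately show ?thesis using Fract_in_generic by simp
qed

lemma generic_const: "Fract (const c) 1 \<in> carrier (generic_local_ring F)"
  by (rule Fract_in_generic[of 0]) (auto simp: F_not_dvd_1)

lemma generic_01: "1 \<in> carrier (generic_local_ring F)" "0 \<in> carrier (generic_local_ring F)"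
  using generic_const[of 1] generic_const[of 0] by (simp_all add: One_fract_def Zero_fract_def const_def)

lemma generic_local_cring: "cring (generic_local_ring F)"
proof -
  have f: "cring (ring_of_type_algebra :: poly3 fract ring)" by (rule cring_from_type_algebra)
  interpret L: cring "ring_of_type_algebra :: poly3 fract ring" by (rule f)
  let ?L = "ring_of_type_algebra :: poly3 fract ring"
  have ops: "\<And>x y. x \<otimes>\<^bsub>?L\<^esub> y = x * y" "\<And>x y. x \<oplus>\<^bsub>?L\<^esub> y = x + y"
    "\<one>\<^bsub>?L\<^esub> = 1" "\<zero>\<^bsub>?L\<^esub> = 0" "carrier ?L = UNIV"
    by (simp_all add: ring_of_type_algebra_def)
  have minus: "\<ominus>\<^bsub>ring_of_type_algebra\<^esub> x = - x" for x :: "poly3 fract"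
    by (rule L.minus_equality) (simp_all add: ops)
  have "subcring (carrier (generic_local_ring F)) ring_of_type_algebra"
  proof (rule L.subcringI')
    show "subring (carrier (generic_local_ring F)) ring_of_type_algebra"
    proof (rule L.subringI)
      fix x assume x: "x \<in> carrier (generic_local_ring F)"
      have "Fract (const (- 1)) 1 = (- 1 :: poly3 fract)"
        by (simp add: One_fract_def const_def single_uminus)
      then have "- x = Fract (const (- 1)) 1 * x" by simp
      then show "\<ominus>\<^bsub>ring_of_type_algebra\<^esub> x \<in> carrier (generic_local_ring F)"
        unfolding minus using generic_mult[OF generic_const x] by simp
    qed (auto simp: ops generic_add generic_mult generic_01)
  qed
  then have "cring (ring_of_type_algebra \<lparr> carrier := carrier (generic_local_ring F) \<rparr>)"
    using L.subcring_iff[of "carrier (generic_local_ring F)"] by (simp add: ops)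
  then show ?thesis by (simp add: generic_local_ring_def)
qed

lemma Fract_in_ideal_iff:
  assumes "B \<noteq> 0" "\<not> F dvd B"
  shows "Fract A B \<in> generic_ideal F \<longleftrightarrow> F dvd A \<and> Fract A B \<in> carrier (generic_local_ring F)"
proof
  assume "Fract A B \<in> generic_ideal F"
  then obtain C D k where *: "Fract A B = Fract C D" "homogeneous k C" "homogeneous k D" "\<not> F dvd D" "F dvd C"
    unfolding generic_ideal_def by blast
  have "D \<noteq> 0" using * by auto
  then have "A * D = C * B" using *(1) assms(1) by (simp add: eq_fract)
  then have "F dvd A * D" using *(5) by simp
  then show "F dvd A \<and> Fract A B \<in> carrier (generic_local_ring F)"
    using * irreducible_poly3_dvd_mult_iff[OF irr] Fract_in_generic by auto
next
  assume "F dvd A \<and> Fract A B \<in> carrier (generic_local_ring F)"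
  then obtain C D k where *: "Fract A B = Fract C D" "homogeneous k C" "homogeneous k D" "\<not> F dvd D" "F dvd A"
    unfolding generic_local_ring_simps by blast
  have "D \<noteq> 0" using * by auto
  then have "A * D = C * B" using *(1) assms(1) by (simp add: eq_fract)
  then have "F dvd C * B" using *(5) by (metis dvd_mult2)
  then have "F dvd C" using irreducible_poly3_dvd_mult_iff[OF irr] assms(2) by blast
  then show "Fract A B \<in> generic_ideal F" using * unfolding generic_ideal_def by blast
qed

text \<open>
  The reciprocal of a fraction outside the ideal is again in the local ring, because its new
  denominator is not divisible by \<open>F\<close>. So a larger ideal contains a unit.
\<close>

lemma generic_maximalideal: "maximalideal (generic_ideal F) (generic_local_ring F)"
proof -
  interpret R: cring "generic_local_ring F" by (rule generic_local_cring)
  have rep: "\<exists>A B k. x = Fract A B \<and> homogeneous k A \<and> homogeneous k B \<and> \<not> F dvd B \<and> B \<noteq> 0"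
    if "x \<in> carrier (generic_local_ring F)" for x
    using that unfolding generic_local_ring_simps by auto
  have sub: "x \<in> carrier (generic_local_ring F)" if "x \<in> generic_ideal F" for x
    using that unfolding generic_ideal_def generic_local_ring_simps by blast
  have mult: "x * y \<in> generic_ideal F" if xI: "x \<in> generic_ideal F" and yI: "y \<in> carrier (generic_local_ring F)" for x y
  proof -
    obtain A B k where x: "x = Fract A B" "\<not> F dvd B" "B \<noteq> 0" using rep[OF sub[OF xI]] by blast
    obtain C D l where y: "y = Fract C D" "\<not> F dvd D" "D \<noteq> 0" using rep[OF yI] by blast
    have "F dvd A" using xI Fract_in_ideal_iff x by simp
    moreover have "\<not> F dvd B * D" using x y irreducible_poly3_dvd_mult_iff[OF irr] by simp
    ultimately show ?thesis
      using Fract_in_ideal_iff[of "B * D" "A * C"] x y generic_mult[OF sub[OF xI] yI] by simp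
  qed
  have add: "x + y \<in> generic_ideal F" if xI: "x \<in> generic_ideal F" and yI: "y \<in> generic_ideal F" for x y
  proof -
    obtain A B k where x: "x = Fract A B" "\<not> F dvd B" "B \<noteq> 0" using rep[OF sub[OF xI]] by blast
    obtain C D l where y: "y = Fract C D" "\<not> F dvd D" "D \<noteq> 0" using rep[OF sub[OF yI]] by blast
    have "F dvd A" "F dvd C" using xI yI Fract_in_ideal_iff x y by auto
    moreover have "\<not> F dvd B * D" using x y irreducible_poly3_dvd_mult_iff[OF irr] by simp
    ultimately show ?thesis
      using Fract_in_ideal_iff[of "B * D" "A * D + C * B"] x y generic_add[OF sub[OF xI] sub[OF yI]] by simp
  qed
  have zero: "0 \<in> generic_ideal F"
    using Fract_in_ideal_iff[of 1 0] F_not_dvd_1 generic_01 by (simp add: Zero_fract_def)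
  have one: "1 \<notin> generic_ideal F"
    using Fract_in_ideal_iff[of 1 1] F_not_dvd_1 by (simp add: One_fract_def)
  have minus: "\<ominus>\<^bsub>generic_local_ring F\<^esub> x = - x" if "x \<in> carrier (generic_local_ring F)" for x
  proof (rule R.minus_equality)
    have "Fract (const (- 1)) 1 = (- 1 :: poly3 fract)"
      by (simp add: One_fract_def const_def single_uminus)
    then have "- x = Fract (const (- 1)) 1 * x" by simp
    then show "- x \<in> carrier (generic_local_ring F)" using generic_mult[OF generic_const that] by simp
  qed (simp_all add: generic_local_ring_simps(3,5) that)
  have ideal: "ideal (generic_ideal F) (generic_local_ring F)"
  proof (rule idealI)
    show "ring (generic_local_ring F)" by (rule R.ring_axioms)
    have m: "- x \<in> generic_ideal F" if "x \<in> generic_ideal F" for x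
    proof -
      have "Fract (const (- 1)) 1 = (- 1 :: poly3 fract)"
        by (simp add: One_fract_def const_def single_uminus)
      then show ?thesis using mult[OF that generic_const[of "- 1"]] by simp
    qed
    show "subgroup (generic_ideal F) (add_monoid (generic_local_ring F))"
    proof (rule R.add.subgroupI)
      show "generic_ideal F \<subseteq> carrier (generic_local_ring F)" using sub by blast
      show "generic_ideal F \<noteq> {}" using zero by blast
      show "\<ominus>\<^bsub>generic_local_ring F\<^esub> a \<in> generic_ideal F" if "a \<in> generic_ideal F" for a
        using m[OF that] minus[OF sub[OF that]] by simp
      show "a \<oplus>\<^bsub>generic_local_ring F\<^esub> b \<in> generic_ideal F" if "a \<in> generic_ideal F" "b \<in> generic_ideal F" for a b
        using add[OF that] by (simp add: generic_local_ring_simps(3))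
    qed
  next
    fix a x assume "a \<in> generic_ideal F" "x \<in> carrier (generic_local_ring F)"
    then show "x \<otimes>\<^bsub>generic_local_ring F\<^esub> a \<in> generic_ideal F" "a \<otimes>\<^bsub>generic_local_ring F\<^esub> x \<in> generic_ideal F"
      using mult[of a x] by (simp_all add: generic_local_ring_simps(2) mult.commute)
  qed
  show ?thesis
  proof (rule maximalidealI[OF ideal])
    show "carrier (generic_local_ring F) \<noteq> generic_ideal F" using one generic_01 by blast
    fix J assume J: "ideal J (generic_local_ring F)" "generic_ideal F \<subseteq> J" "J \<subseteq> carrier (generic_local_ring F)"
    show "J = generic_ideal F \<or> J = carrier (generic_local_ring F)"
    proof (rule disjCI)
      assume "J \<noteq> carrier (generic_local_ring F)"
      show "J = generic_ideal F"
      proof (rule ccontr)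
        assume "J \<noteq> generic_ideal F"
        then obtain x where x: "x \<in> J" "x \<notin> generic_ideal F" using J(2) by blast
        then obtain A B k where AB: "x = Fract A B" "homogeneous k A" "homogeneous k B" "\<not> F dvd B" "B \<noteq> 0"
          using rep J(3) by blast
        have "\<not> F dvd A" using Fract_in_ideal_iff[of B A] AB x J(3) by blast
        then have "A \<noteq> 0" by auto
        have "Fract B A \<in> carrier (generic_local_ring F)" using AB \<open>\<not> F dvd A\<close> Fract_in_generic by blast
        then have "x \<otimes>\<^bsub>generic_local_ring F\<^esub> Fract B A \<in> J" using ideal.I_r_closed[OF J(1) x(1)] by blast
        moreover have "x \<otimes>\<^bsub>generic_local_ring F\<^esub> Fract B A = 1"
          using AB \<open>A \<noteq> 0\<close> by (simp add: generic_local_ring_simps(2) One_fract_def eq_fract mult.commute)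
        ultimately have "\<one>\<^bsub>generic_local_ring F\<^esub> \<in> J" by (simp add: generic_local_ring_simps(4))
        then show False using ideal.one_imp_carrier[OF J(1)] \<open>J \<noteq> carrier (generic_local_ring F)\<close> by blast
      qed
    qed
  qed
qed

end

section \<open>Projections and gonality\<close>

text \<open>
  Polynomials over a subring are lists with nonzero head. The coefficients that come from a curve
  may begin with elements that are zero in the function field.
\<close>

lemma (in ring) strip_leading_zeros:
  assumes "K \<subseteq> carrier R" "x \<in> carrier R" "set p \<subseteq> K" "\<exists>a\<in>set p. a \<noteq> \<zero>"
  shows "\<exists>q. q \<in> carrier (K[X]) \<and> q \<noteq> [] \<and> length q \<le> length p \<and> eval q x = eval p x"
  using assms(3,4)
proof (induction p)
  case (Cons a p)
  show ?case
  proof (cases "a = \<zero>")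
    case True
    then obtain q where q: "q \<in> carrier (K[X])" "q \<noteq> []" "length q \<le> length p" "eval q x = eval p x"
      using Cons by auto
    have "set p \<subseteq> carrier R" using Cons.prems assms(1) by auto
    then have "eval p x \<in> carrier R" using assms(2) by (rule eval_in_carrier)
    then have "eval (a # p) x = eval p x" using True assms(2) by simp
    then show ?thesis using q by (intro exI[of _ q]) auto
  next
    case False
    have "polynomial K (a # p)" using Cons.prems False by (simp add: polynomial_def)
    then have "a # p \<in> carrier (K[X])" by (simp add: univ_poly_carrier)
    then show ?thesis by (intro exI[of _ "a # p"]) auto
  qed
qed simp

lemma (in domain) simple_extension_dimension_le:
  assumes "subfield K R" "x \<in> carrier R" "set p \<subseteq> K" "\<exists>a\<in>set p. a \<noteq> \<zero>" "eval p x = \<zero>"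
  shows "\<exists>n < length p. dimension n K (simple_extension K x) \<and> subfield (simple_extension K x) R"
proof -
  have K: "K \<subseteq> carrier R" by (rule subfieldE(3)[OF assms(1)])
  obtain q where q: "q \<in> carrier (K[X])" "q \<noteq> []" "length q \<le> length p" "eval q x = \<zero>"
    using strip_leading_zeros[OF K assms(2,3,4)] assms(5) by auto
  have alg: "(algebraic over K) x" using algebraicI q by blast
  have "Polynomials.degree (Irr K x) \<le> Polynomials.degree q"
    by (rule pdivides_imp_degree_le[OF subfieldE(1)[OF assms(1)] IrrE(1)[OF assms(1,2) alg] q(1,2)])
      (rule Irr_minimal[OF assms(1,2) alg q(1,4)])
  moreover have "length q > 0" using q(2) by simp
  ultimately have "Polynomials.degree (Irr K x) < length p" using q(3) by linarith
  then show ?thesis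
    using dimension_simple_extension[OF assms(1,2) alg] simple_extension_is_subfield[OF assms(1,2)] alg by blast
qed

text \<open>
  The coefficient of the \<open>n\<close>-th power of the variable \<open>k\<close>, when \<open>F\<close> is viewed as a polynomial in
  that variable.
\<close>

definition fiber_form :: "poly3 \<Rightarrow> 3 \<Rightarrow> nat \<Rightarrow> poly3" where
  "fiber_form F k n = (\<Sum>m\<in>{m \<in> Poly_Mapping.keys F. Poly_Mapping.lookup m k = n}.
    Poly_Mapping.single (m - Poly_Mapping.single k n) (Poly_Mapping.lookup F m))"

lemma split_exponent:
  assumes "Poly_Mapping.lookup m k = n"
  shows "(m - Poly_Mapping.single k n) + Poly_Mapping.single k n = (m :: 3 \<Rightarrow>\<^sub>0 nat)"
  using assms by (intro poly_mapping_eqI) (auto simp: lookup_add lookup_minus lookup_single when_def)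

lemma fiber_form_sum:
  assumes "homogeneous d F"
  shows "(\<Sum>n\<le>d. fiber_form F k n * var k ^ n) = F"
proof -
  have le: "Poly_Mapping.lookup m k \<le> d" if "m \<in> Poly_Mapping.keys F" for m
  proof -
    have "Poly_Mapping.lookup m k \<le> mdeg m" unfolding mdeg_def by (rule member_le_sum) auto
    then show ?thesis using assms that by (simp add: homogeneous_def)
  qed
  have "fiber_form F k n * var k ^ n = (\<Sum>m\<in>{m \<in> Poly_Mapping.keys F. Poly_Mapping.lookup m k = n}.
      Poly_Mapping.single m (Poly_Mapping.lookup F m))" for n
    unfolding fiber_form_def sum_distrib_right var_power
    by (intro sum.cong refl) (simp add: mult_single split_exponent)
  then have "(\<Sum>n\<le>d. fiber_form F k n * var k ^ n) = (\<Sum>m\<in>Poly_Mapping.keys F. Poly_Mapping.single m (Poly_Mapping.lookup F m))"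
    using sum.group[of "Poly_Mapping.keys F" "{..d}" "\<lambda>m. Poly_Mapping.lookup m k" "\<lambda>m. Poly_Mapping.single m (Poly_Mapping.lookup F m)"] le
    by auto
  also have "\<dots> = insertion const var F"
    unfolding insertion_def by (simp add: monomial_eq_prod)
  finally show ?thesis by simp
qed

lemma fiber_form_keys:
  assumes "homogeneous d F" "m \<in> Poly_Mapping.keys (fiber_form F k n)"
  shows "mdeg m = d - n" "Poly_Mapping.lookup m k = 0"
proof -
  have "\<exists>m'\<in>{m \<in> Poly_Mapping.keys F. Poly_Mapping.lookup m k = n}. m = m' - Poly_Mapping.single k n"
  proof (rule ccontr)
    assume "\<not> ?thesis"
    then have "Poly_Mapping.lookup (fiber_form F k n) m = 0"
      unfolding fiber_form_def lookup_sum by (intro sum.neutral) (auto simp: lookup_single when_def)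
    then show False using assms(2) by (simp add: in_keys_iff)
  qed
  then obtain m' where m': "m' \<in> Poly_Mapping.keys F" "Poly_Mapping.lookup m' k = n" "m = m' - Poly_Mapping.single k n" by blast
  have "mdeg m + n = mdeg m'"
    unfolding m'(3) using split_exponent[OF m'(2)] by (metis mdeg_add mdeg_single)
  moreover have "mdeg m' = d" using m'(1) assms(1) by (simp add: homogeneous_def)
  ultimately show "mdeg m = d - n" by simp
  show "Poly_Mapping.lookup m k = 0" by (simp add: m' lookup_minus)
qed

lemma fiber_form_nonzero:
  assumes "m \<in> Poly_Mapping.keys F"
  shows "fiber_form F k (Poly_Mapping.lookup m k) \<noteq> 0"
proof -
  let ?n = "Poly_Mapping.lookup m k"
  have "Poly_Mapping.lookup (fiber_form F k ?n) (m - Poly_Mapping.single k ?n) =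
      (\<Sum>m'\<in>{m' \<in> Poly_Mapping.keys F. Poly_Mapping.lookup m' k = ?n}. if m' = m then Poly_Mapping.lookup F m' else 0)"
    unfolding fiber_form_def lookup_sum
  proof (rule sum.cong[OF refl])
    fix m' assume "m' \<in> {m' \<in> Poly_Mapping.keys F. Poly_Mapping.lookup m' k = ?n}"
    then have e: "Poly_Mapping.lookup m' k = ?n" by simp
    have "m' - Poly_Mapping.single k ?n = m - Poly_Mapping.single k ?n \<longleftrightarrow> m' = m"
    proof
      assume *: "m' - Poly_Mapping.single k ?n = m - Poly_Mapping.single k ?n"
      show "m' = m" using split_exponent[OF e] split_exponent[of m k, OF refl] unfolding * by (rule trans[OF sym])
    qed simp
    then show "Poly_Mapping.lookup (Poly_Mapping.single (m' - Poly_Mapping.single k ?n) (Poly_Mapping.lookup F m')) (m - Poly_Mapping.single k ?n)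
        = (if m' = m then Poly_Mapping.lookup F m' else 0)"
      by (simp add: lookup_single when_def)
  qed
  also have "\<dots> = Poly_Mapping.lookup F m" using assms by (simp add: sum.delta)
  also have "\<dots> \<noteq> 0" using assms by (simp add: in_keys_iff)
  finally show ?thesis by auto
qed

lemma complementary_indices: "\<exists>i j. i \<noteq> j \<and> j \<noteq> k \<and> (\<forall>l. l = i \<or> l = j \<or> l = (k :: 3))"
proof -
  have d: "(1::3) \<noteq> 2" "(1::3) \<noteq> 3" "(2::3) \<noteq> 3" by simp_all
  consider "k = 1" | "k = 2" | "k = 3" using exhaust_3 by blast
  then show ?thesis
  proof cases
    case 1
    have "l = 2 \<or> l = 3 \<or> l = k" for l using exhaust_3[of l] 1 by blast
    then show ?thesis using d 1 by (intro exI[of _ 2] exI[of _ 3] conjI allI) simp_all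
  next
    case 2
    have "l = 1 \<or> l = 3 \<or> l = k" for l using exhaust_3[of l] 2 by blast
    then show ?thesis using d 2 by (intro exI[of _ 1] exI[of _ 3] conjI allI) simp_all
  next
    case 3
    have "l = 1 \<or> l = 2 \<or> l = k" for l using exhaust_3[of l] 3 by blast
    then show ?thesis using d 3 by (intro exI[of _ 1] exI[of _ 2] conjI allI) simp_all
  qed
qed

lemma sum_Fract: "D \<noteq> 0 \<Longrightarrow> (\<Sum>n\<in>A. Fract (f n) D) = Fract (\<Sum>n\<in>A. f n) (D :: poly3)"
  by (induction A rule: infinite_finite_induct) (simp_all add: Zero_fract_def eq_fract algebra_simps)

context
  fixes F :: poly3
  assumes irr: "irreducible F"
begin

lemma function_field_field: "field (function_field F)"
  unfolding function_field_def
  by (rule maximalideal.quotient_is_field[OF generic_maximalideal[OF irr] generic_local_cring[OF irr]])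

lemma rcos_hom: "(\<lambda>a. generic_ideal F +>\<^bsub>generic_local_ring F\<^esub> a) \<in> Ring.ring_hom (generic_local_ring F) (function_field F)"
  unfolding function_field_def
  by (rule ideal.rcos_ring_hom[OF maximalideal.axioms(1)[OF generic_maximalideal[OF irr]]])

lemma rcos_surj:
  assumes "x \<in> carrier (function_field F)"
  shows "\<exists>a\<in>carrier (generic_local_ring F). x = generic_ideal F +>\<^bsub>generic_local_ring F\<^esub> a"
  using assms unfolding function_field_def FactRing_def by (auto simp: A_RCOSETS_def')

lemma rcos_eq_zero_iff:
  assumes "a \<in> carrier (generic_local_ring F)"
  shows "generic_ideal F +>\<^bsub>generic_local_ring F\<^esub> a = \<zero>\<^bsub>function_field F\<^esub> \<longleftrightarrow> a \<in> generic_ideal F"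
proof -
  interpret maximalideal "generic_ideal F" "generic_local_ring F" by (rule generic_maximalideal[OF irr])
  have z: "\<zero>\<^bsub>function_field F\<^esub> = generic_ideal F" by (simp add: function_field_def FactRing_def)
  show ?thesis unfolding z using a_rcos_const a_rcos_self[OF assms] by auto
qed

text \<open>
  The map is the projection \<open>[x\<^sub>i : x\<^sub>j]\<close> from a coordinate point whose variable \<open>x\<^sub>k\<close> occurs in \<open>F\<close>. The
  function field is generated over the field \<open>K\<close> of the line by \<open>z = x\<^sub>k / x\<^sub>j\<close>. Dividing
  \<open>F = \<Sum> F\<^sub>n x\<^sub>k\<^sup>n\<close> by \<open>x\<^sub>j\<^sup>d\<close> gives an equation for \<open>z\<close> with coefficients \<open>F\<^sub>n / x\<^sub>j\<^bsup>d - n\<^esup>\<close> in \<open>K\<close>. It is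
  nontrivial, since a nonzero \<open>F\<^sub>n\<close> with \<open>n > 0\<close> has smaller degree than \<open>F\<close> and thus is not zero on
  the curve.
\<close>

lemma exists_projection_of_degree_le:
  assumes hom: "homogeneous d F" and d: "d \<ge> 2"
  shows "\<exists>n\<le>d. \<exists>A B. rational_map_to_P1 F A B \<and> \<not> constant_map F A B \<and> has_map_degree F A B n"
proof -
  let ?R = "generic_local_ring F" and ?Q = "function_field F"
  define pr where "pr a = generic_ideal F +>\<^bsub>generic_local_ring F\<^esub> a" for a
  interpret Q: field "function_field F" by (rule function_field_field)
  have "F \<noteq> 0" using irr by auto
  then obtain m0 where m0: "m0 \<in> Poly_Mapping.keys F" by (metis all_not_in_conv keys_eq_empty)
  then have "mdeg m0 \<noteq> 0" using hom d by (auto simp: homogeneous_def)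
  then obtain k where k: "Poly_Mapping.lookup m0 k \<noteq> 0" unfolding mdeg_def by (metis sum.neutral)
  \<comment> \<open>The centre of projection is the point at which only the coordinate \<open>k\<close> is nonzero.\<close>
  obtain i j :: 3 where ij: "i \<noteq> j" "j \<noteq> k" "\<forall>l. l = i \<or> l = j \<or> l = k"
    using complementary_indices[of k] by blast
  have small: "\<not> F dvd A" if "homogeneous e A" "A \<noteq> 0" "e < d" for e A
    using homogeneous_dvd_degree_le[OF hom that(1,2)] that(3) by auto
  have var0: "var l \<noteq> 0" for l
  proof
    assume "var l = 0"
    then have "Poly_Mapping.lookup (var l) (Poly_Mapping.single l 1) = 0" by simp
    then show False by (simp add: var_def)
  qed
  have nvar: "\<not> F dvd var l" for l using small[OF homogeneous_var var0[of l]] d by simp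
  have R_hom: "pr (a + b) = pr a \<oplus>\<^bsub>?Q\<^esub> pr b" "pr (a * b) = pr a \<otimes>\<^bsub>?Q\<^esub> pr b" "pr a \<in> carrier ?Q"
    if "a \<in> carrier ?R" "b \<in> carrier ?R" for a b
    using ring_hom_add[OF rcos_hom that] ring_hom_mult[OF rcos_hom that] ring_hom_closed[OF rcos_hom that(1)]
    by (simp_all add: pr_def generic_local_ring_simps)
  have R_1: "pr 1 = \<one>\<^bsub>?Q\<^esub>" using ring_hom_one[OF rcos_hom] by (simp add: pr_def generic_local_ring_simps)
  have pr0: "pr a = \<zero>\<^bsub>?Q\<^esub> \<longleftrightarrow> a \<in> generic_ideal F" if "a \<in> carrier ?R" for a
    unfolding pr_def by (rule rcos_eq_zero_iff[OF that])
  note gen = generic_add[OF irr] generic_mult[OF irr] generic_01[OF irr] generic_const[OF irr]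
  have R_0: "pr 0 = \<zero>\<^bsub>?Q\<^esub>" using pr0[OF gen(4)] Fract_in_ideal_iff[OF irr, of 1 0] F_not_dvd_1[OF irr] gen(4)
    by (simp add: Zero_fract_def)
  have Y: "homogeneous n (var j ^ n)" "var j ^ n \<noteq> 0" "\<not> F dvd var j ^ n" for n
  proof -
    show "homogeneous n (var j ^ n)" using homogeneous_power[OF homogeneous_var, of n j] by simp
    show "var j ^ n \<noteq> 0" using var0 by simp
    show "\<not> F dvd var j ^ n"
      by (induction n) (use F_not_dvd_1[OF irr] nvar irreducible_poly3_dvd_mult_iff[OF irr] in auto)
  qed
  have frac: "Fract (var l) (var j) \<in> carrier ?R" for l
    by (rule Fract_in_generic[OF irr homogeneous_var homogeneous_var nvar])
  define t where "t = pr (Fract (var i) (var j))"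
  define z where "z = pr (Fract (var k) (var j))"
  define cs where "cs = range (\<lambda>c. pr (Fract (const c) 1))"
  define K where "K = generate_field ?Q (insert t cs)"
  have tz: "t \<in> carrier ?Q" "z \<in> carrier ?Q" "cs \<subseteq> carrier ?Q"
    using R_hom(3) frac gen(5) by (auto simp: t_def z_def cs_def)
  have K: "subfield K ?Q" unfolding K_def using tz by (intro Q.generate_field_is_subfield) auto
  have inK: "t \<in> K" "cs \<subseteq> K" unfolding K_def by (auto intro: generate_field.incl)
  have jj: "pr (Fract (var j) (var j)) = \<one>\<^bsub>?Q\<^esub>"
  proof -
    have "Fract (var j) (var j) = 1" using var0[of j] by (simp add: One_fract_def eq_fract)
    then show ?thesis by (simp only: R_1)
  qed
  \<comment> \<open>\<open>E\<close> will be \<open>K\<close> for the coefficients of the equation of \<open>z\<close>, and \<open>K(z)\<close> for arbitrary forms.\<close>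
  have closure: "Fract A (var j ^ e) \<in> carrier ?R \<and> pr (Fract A (var j ^ e)) \<in> E"
    if E: "subfield E ?Q" "cs \<subseteq> E" "t \<in> E" "homogeneous e A"
      "z \<in> E \<or> (\<forall>m\<in>Poly_Mapping.keys A. Poly_Mapping.lookup m k = 0)" for E A e
  proof -
    note Es = subringE[OF subfieldE(1)[OF E(1)]]
    have "insertion (\<lambda>c. Fract (const c) 1) (\<lambda>i. Fract (var i) (var j)) A \<in> {a \<in> carrier ?R. pr a \<in> E}"
    proof (rule insertion_closed)
      show "0 \<in> {a \<in> carrier ?R. pr a \<in> E}" "1 \<in> {a \<in> carrier ?R. pr a \<in> E}"
        by (simp_all only: mem_Collect_eq R_0 R_1 gen(3) gen(4) Es(2) Es(3) simp_thms)
      show "a + b \<in> {a \<in> carrier ?R. pr a \<in> E}" "a * b \<in> {a \<in> carrier ?R. pr a \<in> E}"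
        if "a \<in> {a \<in> carrier ?R. pr a \<in> E}" "b \<in> {a \<in> carrier ?R. pr a \<in> E}" for a b
        using that gen(1,2) Es(6,7) R_hom(1,2) by auto
      show "Fract (const c) 1 \<in> {a \<in> carrier ?R. pr a \<in> E}" for c
        using gen(5) E(2) by (auto simp: cs_def)
      fix m l assume "m \<in> Poly_Mapping.keys A" "Poly_Mapping.lookup m l \<noteq> 0"
      then have "l = k \<Longrightarrow> z \<in> E" using E(5) by auto
      moreover have "l = i \<or> l = j \<or> l = k" using ij(3) by blast
      ultimately show "Fract (var l) (var j) \<in> {a \<in> carrier ?R. pr a \<in> E}"
        using frac E(3) jj Es(3) by (auto simp: t_def z_def)
    qed
    then show ?thesis using fract_dehomogenize[OF E(4) var0[of j]] by simp
  qed
  define a where "a n = Fract (fiber_form F k n) (var j ^ (d - n))" for n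
  have ff_hom: "homogeneous (d - n) (fiber_form F k n)" for n
    using fiber_form_keys[OF hom] by (simp add: homogeneous_def)
  have a: "a n \<in> carrier ?R" "pr (a n) \<in> K" for n
    using closure[OF K inK(2,1) ff_hom[of n]] fiber_form_keys(2)[OF hom] unfolding a_def by blast+
  define \<zeta> where "\<zeta> = Fract (var k) (var j)"
  have \<zeta>: "\<zeta> \<in> carrier ?R" "pr \<zeta> = z" using frac by (auto simp: \<zeta>_def z_def)
  have pw: "\<zeta> ^ n \<in> carrier ?R \<and> pr (\<zeta> ^ n) = z [^]\<^bsub>?Q\<^esub> n" for n
  proof (induction n)
    case 0 then show ?case using gen R_1 by simp
  next
    case (Suc n)
    have "pr (\<zeta> ^ n * \<zeta>) = z [^]\<^bsub>?Q\<^esub> n \<otimes>\<^bsub>?Q\<^esub> z"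
      using Suc R_hom(2)[of "\<zeta> ^ n" \<zeta>] \<zeta> by simp
    moreover have "\<zeta> ^ n * \<zeta> \<in> carrier ?R" using Suc \<zeta>(1) by (intro gen(2)) simp_all
    ultimately show ?case by (simp only: power_Suc2 Q.nat_pow_Suc simp_thms)
  qed
  \<comment> \<open>Coefficient lists start with the leading coefficient, hence the reversal.\<close>
  have ev: "(\<Sum>n<N. a n * \<zeta> ^ n) \<in> carrier ?R \<and>
      Q.eval (map (\<lambda>n. pr (a n)) (rev [0..<N])) z = pr (\<Sum>n<N. a n * \<zeta> ^ n)" for N
  proof (induction N)
    case 0 then show ?case using gen R_0 by simp
  next
    case (Suc N)
    let ?s = "\<Sum>n<N. a n * \<zeta> ^ n"
    have t1: "a N * \<zeta> ^ N \<in> carrier ?R" using pw by (intro gen(2) a(1)) simp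
    have "Q.eval (map (\<lambda>n. pr (a n)) (rev [0..<Suc N])) z
       = (pr (a N) \<otimes>\<^bsub>?Q\<^esub> z [^]\<^bsub>?Q\<^esub> N) \<oplus>\<^bsub>?Q\<^esub> Q.eval (map (\<lambda>n. pr (a n)) (rev [0..<N])) z"
      by simp
    also have "\<dots> = pr (a N * \<zeta> ^ N) \<oplus>\<^bsub>?Q\<^esub> pr ?s"
      using Suc R_hom(2)[OF a(1), of "\<zeta> ^ N" N] pw[of N] by (simp only:)
    also have "\<dots> = pr (a N * \<zeta> ^ N + ?s)" using R_hom(1)[OF t1] Suc by simp
    finally show ?case using gen(1) t1 Suc by (simp add: add.commute)
  qed
  have zero: "(\<Sum>n<Suc d. a n * \<zeta> ^ n) = Fract F (var j ^ d)"
  proof -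
    have "a n * \<zeta> ^ n = Fract (fiber_form F k n * var k ^ n) (var j ^ d)" if "n \<le> d" for n
    proof -
      have "\<zeta> ^ n = Fract (var k ^ n) (var j ^ n)" unfolding \<zeta>_def by (induction n) (simp_all add: One_fract_def)
      moreover have "var j ^ (d - n) * var j ^ n = var j ^ d" using that by (simp add: power_add[symmetric])
      ultimately show ?thesis by (simp add: a_def)
    qed
    then have "(\<Sum>n\<le>d. a n * \<zeta> ^ n) = (\<Sum>n\<le>d. Fract (fiber_form F k n * var k ^ n) (var j ^ d))"
      by (intro sum.cong) auto
    also have "\<dots> = Fract F (var j ^ d)" by (simp only: sum_Fract[OF Y(2)] fiber_form_sum[OF hom])
    finally show ?thesis by (simp only: lessThan_Suc_atMost)
  qed
  define p where "p = map (\<lambda>n. pr (a n)) (rev [0..<Suc d])"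
  have p_eval: "Q.eval p z = \<zero>\<^bsub>?Q\<^esub>"
  proof -
    have "Fract F (var j ^ d) \<in> generic_ideal F"
      using Fract_in_ideal_iff[OF irr Y(2,3)] Fract_in_generic[OF irr hom Y(1,3)] by simp
    then show ?thesis using ev[of "Suc d"] pr0 unfolding p_def zero by simp
  qed
  have p_K: "set p \<subseteq> K" using a(2) by (auto simp: p_def)
  have p_nonzero: "\<exists>x\<in>set p. x \<noteq> \<zero>\<^bsub>?Q\<^esub>"
  proof -
    define n where "n = Poly_Mapping.lookup m0 k"
    have "n \<le> mdeg m0" unfolding n_def mdeg_def by (rule member_le_sum) auto
    then have n: "n \<le> d" "n > 0" using hom m0 k by (auto simp: homogeneous_def n_def)
    have "\<not> F dvd fiber_form F k n"
      using small[OF ff_hom fiber_form_nonzero[OF m0]] n unfolding n_def by simp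
    then have "pr (a n) \<noteq> \<zero>\<^bsub>?Q\<^esub>"
      using pr0[OF a(1)] Fract_in_ideal_iff[OF irr Y(2,3)] unfolding a_def by blast
    moreover have "n \<in> set (rev [0..<Suc d])" using n(1) unfolding set_rev set_upt by simp
    then have "pr (a n) \<in> set p" unfolding p_def set_map by (rule imageI)
    ultimately show ?thesis by (rule bexI)
  qed
  obtain n where n: "n < length p" "Q.dimension n K (Q.simple_extension K z)" "subfield (Q.simple_extension K z) ?Q"
    using Q.simple_extension_dimension_le[OF K tz(2) p_K p_nonzero p_eval] by (elim exE conjE)
  define E where "E = Q.simple_extension K z"
  have KE: "K \<subseteq> E" "z \<in> E"
    using Q.simple_extension_incl[OF subfieldE(3)[OF K] tz(2)] Q.simple_extension_mem[OF subfieldE(1)[OF K] tz(2)]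
    by (simp_all add: E_def)
  have E: "subfield E ?Q" using n(3) by (simp add: E_def)
  have "carrier ?Q \<subseteq> E"
  proof
    fix x assume "x \<in> carrier ?Q"
    from rcos_surj[OF this] have "\<exists>f\<in>carrier ?R. x = pr f" by (simp only: pr_def)
    then obtain f where f: "f \<in> carrier ?R" "x = pr f" by (elim bexE)
    from f(1) have "\<exists>A B e. f = Fract A B \<and> homogeneous e A \<and> homogeneous e B \<and> \<not> F dvd B"
      by (simp only: generic_local_ring_simps(1) mem_Collect_eq)
    then obtain A B e where AB: "f = Fract A B" "homogeneous e A" "homogeneous e B" "\<not> F dvd B"
      by (elim exE conjE)
    have B0: "B \<noteq> 0" using AB by auto
    let ?a = "Fract A (var j ^ e)" and ?b = "Fract B (var j ^ e)"
    have 1: "?a \<in> carrier ?R" "pr ?a \<in> E"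
      using closure[OF E order_trans[OF inK(2) KE(1)] subsetD[OF KE(1) inK(1)] AB(2) disjI1[OF KE(2)]] by simp_all
    have 2: "?b \<in> carrier ?R" "pr ?b \<in> E"
      using closure[OF E order_trans[OF inK(2) KE(1)] subsetD[OF KE(1) inK(1)] AB(3) disjI1[OF KE(2)]] by simp_all
    have "?b \<notin> generic_ideal F"
      using AB(4) by (simp only: Fract_in_ideal_iff[OF irr Y(2)[of e] Y(3)[of e], of B] simp_thms)
    then have b0: "pr ?b \<noteq> \<zero>\<^bsub>?Q\<^esub>" by (simp only: pr0[OF 2(1)] simp_thms)
    have "f * ?b = ?a" using B0 Y(2)[of e] by (simp add: AB(1) eq_fract)
    then have eq: "x \<otimes>\<^bsub>?Q\<^esub> pr ?b = pr ?a" using R_hom(2)[OF f(1) 2(1)] f(2) by simp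
    have binv: "inv\<^bsub>?Q\<^esub> (pr ?b) \<in> E" "pr ?b \<otimes>\<^bsub>?Q\<^esub> inv\<^bsub>?Q\<^esub> (pr ?b) = \<one>\<^bsub>?Q\<^esub>"
      using Q.subfield_m_inv[OF E] 2(2) b0 by auto
    have xc: "x \<in> carrier ?Q" "pr ?b \<in> carrier ?Q" "inv\<^bsub>?Q\<^esub> (pr ?b) \<in> carrier ?Q"
      using f R_hom(3) 2 binv(1) subfieldE(3)[OF E] by auto
    have "x = pr ?a \<otimes>\<^bsub>?Q\<^esub> inv\<^bsub>?Q\<^esub> (pr ?b)"
      unfolding eq[symmetric] using xc binv(2) by (simp add: Q.m_assoc)
    also have "\<dots> \<in> E" by (rule subringE(6)[OF subfieldE(1)[OF E] 1(2) binv(1)])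
    finally show "x \<in> E" .
  qed
  then have Ec: "E = carrier ?Q" by (rule equalityI[OF subfieldE(3)[OF E]])
  have "has_map_degree F (var i) (var j) n"
  proof -
    have "Q.dimension n K (carrier ?Q)" using n(2) unfolding E_def[symmetric] Ec .
    then show ?thesis unfolding has_map_degree_def K_def t_def cs_def pr_def rat_fun_def .
  qed
  moreover have "rational_map_to_P1 F (var i) (var j)"
    using nvar homogeneous_var unfolding rational_map_to_P1_def by blast
  moreover have "\<not> constant_map F (var i) (var j)"
  proof
    assume "constant_map F (var i) (var j)"
    then obtain b c where bc: "(b, c) \<noteq> (0, 0)" "F dvd const c * var i - const b * var j"
      unfolding constant_map_def by blast
    have lk: "Poly_Mapping.lookup (const c * var l) (Poly_Mapping.single l' 1) = (if l = l' then c else 0)" for c l l'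
    proof -
      have "Poly_Mapping.single l (1::nat) = Poly_Mapping.single l' 1 \<longleftrightarrow> l = l'"
      proof
        assume eq: "Poly_Mapping.single l (1::nat) = Poly_Mapping.single l' 1"
        have "Poly_Mapping.lookup (Poly_Mapping.single l (1::nat)) l' = 1" unfolding eq by simp
        then show "l = l'" by (simp add: lookup_single when_def split: if_splits)
      qed simp
      then show ?thesis by (simp add: const_def var_def mult_single lookup_single when_def)
    qed
    have nonzero: "const c * var i - const b * var j \<noteq> 0"
    proof
      assume "const c * var i - const b * var j = 0"
      then have "Poly_Mapping.lookup (const c * var i - const b * var j) (Poly_Mapping.single l 1) = 0" for l by simp
      from this[of i] this[of j] show False using ij(1) bc(1) by (simp add: lookup_minus lk[unfolded One_nat_def] split: if_splits)
    qed
    have "homogeneous 1 (const c * var i - const b * var j)"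
      using homogeneous_add[OF homogeneous_mult[OF homogeneous_const homogeneous_var, of c i] homogeneous_minus[OF homogeneous_mult[OF homogeneous_const homogeneous_var, of b j]]]
      by simp
    from small[OF this nonzero] show False using bc(2) d by simp
  qed
  moreover have "n \<le> d" using n(1) by (simp add: p_def)
  ultimately show ?thesis by blast
qed

lemma gonality_le_degree:
  assumes "homogeneous d F" "d \<ge> 2"
  shows "gonality F \<le> d"
proof -
  obtain n A B where n: "n \<le> d" "rational_map_to_P1 F A B" "\<not> constant_map F A B" "has_map_degree F A B n"
    using exists_projection_of_degree_le[OF assms] by blast
  then have "gonality F \<le> n" unfolding gonality_def by (intro Least_le) blast
  then show ?thesis using n(1) by simp
qed

end

section \<open>General position\<close>

text \<open>
  The determinant with rows \<open>a\<close>, \<open>b\<close>, \<open>c\<close>, expanded for calculations.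
\<close>

definition triple :: "complex ^ 3 \<Rightarrow> complex ^ 3 \<Rightarrow> complex ^ 3 \<Rightarrow> complex" where
  "triple a b c = a $ 1 * (b $ 2 * c $ 3 - b $ 3 * c $ 2) + a $ 2 * (b $ 3 * c $ 1 - b $ 1 * c $ 3)
    + a $ 3 * (b $ 1 * c $ 2 - b $ 2 * c $ 1)"

text \<open>The equation of the line through \<open>b\<close> and \<open>c\<close>.\<close>

definition cross_form :: "complex ^ 3 \<Rightarrow> complex ^ 3 \<Rightarrow> poly3" where
  "cross_form b c = lin (vector [b $ 2 * c $ 3 - b $ 3 * c $ 2, b $ 3 * c $ 1 - b $ 1 * c $ 3,
    b $ 1 * c $ 2 - b $ 2 * c $ 1])"

lemma evalp_cross_form: "evalp (cross_form b c) a = triple a b c"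
  by (simp add: cross_form_def evalp_lin sum_3 triple_def mult.commute)

lemma det_rows: "det (vector [a, b, c] :: complex ^ 3 ^ 3) = triple a b c"
  by (simp add: det_3 triple_def algebra_simps)

lemma invertible_rows: "invertible (vector [a, b, c] :: complex ^ 3 ^ 3) \<longleftrightarrow> triple a b c \<noteq> 0"
  by (simp add: invertible_det_nz det_rows)

lemma triple_linear1: "triple (a *s u + b *s w + c *s e) w e = a * triple u w e"
  by (simp add: triple_def algebra_simps)

lemma triple_linear2: "triple u (a *s u + b *s w + c *s e) e = b * triple u w e"
  by (simp add: triple_def algebra_simps)

lemma triple_linear3: "triple u w (a *s u + b *s w + c *s e) = c * triple u w e"
  by (simp add: triple_def algebra_simps)

lemma triple_collinear: "triple (a *s (u + x *s w + z *s e)) (a' *s (u + x *s w + z' *s e)) e = 0"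
  by (simp add: triple_def algebra_simps)

lemma triple_rotate: "triple a b c = triple b c a"
  by (simp add: triple_def algebra_simps)

lemma cramer3:
  assumes "triple u w e \<noteq> 0"
  shows "\<exists>a b c. v = a *s u + b *s w + c *s e"
proof -
  let ?T = "triple u w e"
  have "?T *s v = triple v w e *s u + triple u v e *s w + triple u w v *s e"
    unfolding Finite_Cartesian_Product.vec_eq_iff forall_3 by (simp add: triple_def algebra_simps)
  then have "(1 / ?T) *s (?T *s v) = (1 / ?T) *s (triple v w e *s u + triple u v e *s w + triple u w v *s e)"
    by simp
  then have "v = (triple v w e / ?T) *s u + (triple u v e / ?T) *s w + (triple u w v / ?T) *s e"
    using assms by (simp add: Finite_Cartesian_Product.vec_eq_iff algebra_simps)
  then show ?thesis by blast
qed

lemma coordinates_unique: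
  assumes "triple u w e \<noteq> 0" "a *s u + b *s w + c *s e = a' *s u + b' *s w + c' *s e"
  shows "a = a' \<and> b = b' \<and> c = c'"
proof -
  have "a * triple u w e = a' * triple u w e" by (metis triple_linear1 assms(2))
  moreover have "b * triple u w e = b' * triple u w e" by (metis triple_linear2 assms(2))
  moreover have "c * triple u w e = c' * triple u w e" by (metis triple_linear3 assms(2))
  ultimately show ?thesis using assms(1) by simp
qed

text \<open>
  A linear form that vanishes on a basis is zero. There is no inner product involved: the pairing
  is bilinear over the complex numbers.
\<close>

lemma orthogonal_to_frame:
  assumes "triple u w e \<noteq> 0"
    and "(\<Sum>i\<in>UNIV. g $ i * u $ i) = 0" "(\<Sum>i\<in>UNIV. g $ i * w $ i) = 0" "(\<Sum>i\<in>UNIV. g $ i * e $ i) = 0"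
  shows "g = 0"
proof -
  have z: "(\<Sum>i\<in>UNIV. g $ i * y $ i) = 0" for y
  proof -
    obtain a b c where y: "y = a *s u + b *s w + c *s e" using cramer3[OF assms(1)] by blast
    have "(\<Sum>i\<in>UNIV. g $ i * y $ i) = a * (\<Sum>i\<in>UNIV. g $ i * u $ i) + b * (\<Sum>i\<in>UNIV. g $ i * w $ i) + c * (\<Sum>i\<in>UNIV. g $ i * e $ i)"
      by (simp add: y sum_3 algebra_simps)
    then show "(\<Sum>i\<in>UNIV. g $ i * y $ i) = 0" by (simp only: assms mult_zero_right add_0_left)
  qed
  have "g $ j = 0" for j
  proof -
    have "(\<Sum>i\<in>UNIV. g $ i * (axis j 1 :: complex ^ 3) $ i) = g $ j"
      by (simp add: axis_def if_distrib[of "\<lambda>x. _ * x"] cong: if_cong)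
    then show "g $ j = 0" using z by simp
  qed
  then show ?thesis by (simp add: Finite_Cartesian_Product.vec_eq_iff)
qed

lemma cross_form_nonzero:
  assumes "b \<noteq> 0" "\<And>c. a \<noteq> c *s b"
  shows "cross_form a b \<noteq> 0"
proof
  assume "cross_form a b = 0"
  then have t: "triple v a b = 0" for v
    using evalp_cross_form[of a b v] by (simp add: evalp_def)
  have ax: "a $ 2 * b $ 3 = a $ 3 * b $ 2" "a $ 3 * b $ 1 = a $ 1 * b $ 3" "a $ 1 * b $ 2 = a $ 2 * b $ 1"
    using t[of "vector [1, 0, 0]"] t[of "vector [0, 1, 0]"] t[of "vector [0, 0, 1]"] by (simp_all add: triple_def)
  obtain i where i: "b $ i \<noteq> 0" using assms(1) by (auto simp: Finite_Cartesian_Product.vec_eq_iff)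
  have "a $ j * b $ i = a $ i * b $ j" for j
    using exhaust_3[of i] exhaust_3[of j] ax by (elim disjE) simp_all
  then have "a = (a $ i / b $ i) *s b" using i by (simp add: Finite_Cartesian_Product.vec_eq_iff field_simps)
  then show False using assms(2) by blast
qed

text \<open>
  The centre \<open>e\<close> of projection avoids the given curves and all lines that join two of the given points;
  the second vector \<open>w\<close> avoids the lines that join \<open>e\<close> to these points, and \<open>u\<close> is one of them.
  Then the points lie in the affine chart \<open>u + x w + z e\<close> and have distinct abscissas \<open>x\<close>. A
  given curve through each point ensures that \<open>e\<close> is none of them.
\<close>

lemma general_position:
  assumes V: "finite V" "V \<noteq> {}" "0 \<notin> V" and FF: "finite FF" "0 \<notin> FF"
    and zero: "\<And>v. v \<in> V \<Longrightarrow> \<exists>F\<in>FF. \<exists>k. homogeneous k F \<and> evalp F v = 0"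
    and indep: "\<And>v v' c. v \<in> V \<Longrightarrow> v' \<in> V \<Longrightarrow> v \<noteq> v' \<Longrightarrow> v \<noteq> c *s v'"
  shows "\<exists>u w e. triple u w e \<noteq> 0 \<and> (\<forall>F\<in>FF. evalp F e \<noteq> 0) \<and>
    (\<forall>v\<in>V. \<exists>a x z. a \<noteq> 0 \<and> v = a *s (u + x *s w + z *s e)) \<and>
    (\<forall>v\<in>V. \<forall>v'\<in>V. \<forall>a x z a' z'. v = a *s (u + x *s w + z *s e) \<longrightarrow>
      v' = a' *s (u + x *s w + z' *s e) \<longrightarrow> v = v')"
proof -
  define P where "P = {(v, v'). v \<in> V \<and> v' \<in> V \<and> v \<noteq> v'}"
  have "finite P" by (rule finite_subset[of _ "V \<times> V"]) (auto simp: P_def V(1))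
  have "\<exists>e. \<forall>F\<in>FF \<union> (\<lambda>(v, v'). cross_form v v') ` P. evalp F e \<noteq> 0"
  proof (rule ex_evalp_nonzero)
    show "finite (FF \<union> (\<lambda>(v, v'). cross_form v v') ` P)" using FF(1) \<open>finite P\<close> by simp
    fix F assume "F \<in> FF \<union> (\<lambda>(v, v'). cross_form v v') ` P"
    then consider "F \<in> FF" | v v' where "v \<in> V" "v' \<in> V" "v \<noteq> v'" "F = cross_form v v'" by (auto simp: P_def)
    then show "F \<noteq> 0"
    proof cases
      case 1 then show ?thesis using FF(2) by auto
    next
      case 2
      have "v' \<noteq> 0" using 2(2) V(3) by auto
      then show ?thesis unfolding 2(4) by (rule cross_form_nonzero) (rule indep[OF 2(1-3)])
    qed
  qed
  then obtain e where e0: "\<forall>F\<in>FF \<union> (\<lambda>(v, v'). cross_form v v') ` P. evalp F e \<noteq> 0" by (elim exE)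
  have e1: "evalp F e \<noteq> 0" if "F \<in> FF" for F using e0 that by simp
  have e2: "evalp (cross_form v v') e \<noteq> 0" if "(v, v') \<in> P" for v v'
  proof -
    have "cross_form v v' \<in> (\<lambda>(v, v'). cross_form v v') ` P"
      by (rule image_eqI[OF _ that]) simp
    then show "evalp (cross_form v v') e \<noteq> 0" using e0 by simp
  qed
  have "\<exists>w. \<forall>F\<in>(\<lambda>v. cross_form e v) ` V. evalp F w \<noteq> 0"
  proof (rule ex_evalp_nonzero)
    show "finite ((\<lambda>v. cross_form e v) ` V)" using V(1) by simp
    fix F assume "F \<in> (\<lambda>v. cross_form e v) ` V"
    then obtain v where v: "v \<in> V" "F = cross_form e v" by (elim imageE)
    have "v \<noteq> 0" using v(1) V(3) by auto
    moreover have "e \<noteq> c *s v" for c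
    proof
      assume ev: "e = c *s v"
      obtain G k where G: "G \<in> FF" "homogeneous k G" "evalp G v = 0" using zero[OF v(1)] by (elim bexE exE conjE)
      have "evalp G e = 0" unfolding ev evalp_homogeneous[OF G(2)] G(3) by simp
      then show False using e1[OF G(1)] by simp
    qed
    ultimately show "F \<noteq> 0" unfolding v(2) by (rule cross_form_nonzero)
  qed
  then obtain w where w0: "\<forall>F\<in>(\<lambda>v. cross_form e v) ` V. evalp F w \<noteq> 0" by (elim exE)
  have w: "evalp (cross_form e v) w \<noteq> 0" if "v \<in> V" for v using w0 that by simp
  have t: "triple v w e \<noteq> 0" if "v \<in> V" for v
    using w[OF that] by (simp only: evalp_cross_form triple_rotate[of v w e] simp_thms)
  obtain u where u: "u \<in> V" using V(2) by blast
  have rep: "\<exists>a x z. a \<noteq> 0 \<and> v = a *s (u + x *s w + z *s e)" if "v \<in> V" for v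
  proof -
    obtain a b c where v: "v = a *s u + b *s w + c *s e" using cramer3[OF t[OF u], of v] by (elim exE)
    have "triple v w e = a * triple u w e" unfolding v by (rule triple_linear1)
    then have "a \<noteq> 0" using t[OF that] by auto
    moreover from this have "v = a *s (u + (b / a) *s w + (c / a) *s e)"
      unfolding v by (simp add: Finite_Cartesian_Product.vec_eq_iff algebra_simps)
    ultimately show "\<exists>a x z. a \<noteq> 0 \<and> v = a *s (u + x *s w + z *s e)" by blast
  qed
  have inj: "v = v'" if "v \<in> V" "v' \<in> V" "v = a *s (u + x *s w + z *s e)" "v' = a' *s (u + x *s w + z' *s e)"
    for v v' a x z a' z'
  proof (rule ccontr)
    assume "v \<noteq> v'"
    then have "(v, v') \<in> P" using that(1,2) by (simp add: P_def)
    then have "evalp (cross_form v v') e \<noteq> 0" by (rule e2)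
    then have "triple v v' e \<noteq> 0" by (simp only: evalp_cross_form triple_rotate[of e v v'] simp_thms)
    then show False unfolding that(3,4) by (simp only: triple_collinear simp_thms)
  qed
  have A: "\<forall>F\<in>FF. evalp F e \<noteq> 0" by (rule ballI) (rule e1)
  have B: "\<forall>v\<in>V. \<exists>a x z. a \<noteq> 0 \<and> v = a *s (u + x *s w + z *s e)" by (rule ballI) (rule rep)
  have C: "\<forall>v\<in>V. \<forall>v'\<in>V. \<forall>a x z a' z'. v = a *s (u + x *s w + z *s e) \<longrightarrow>
      v' = a' *s (u + x *s w + z' *s e) \<longrightarrow> v = v'"
    by (intro ballI allI impI) (rule inj)
  show ?thesis
    by (rule exI[of _ u], rule exI[of _ w], rule exI[of _ e]) (intro conjI t[OF u] A B C)
qed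

section \<open>Resultants along the fibres of a projection\<close>

text \<open>
  The hypothesis says that \<open>r\<close> is \<open>q\<close> with its coefficients in the reverse order, shifted to degree \<open>D\<close>.
  Only values off zero are available, so the identity of polynomials is obtained after
  multiplication by the variable.
\<close>

lemma poly_reflected_degree:
  fixes r q :: "complex poly"
  assumes "\<And>x. x \<noteq> 0 \<Longrightarrow> poly r x = x ^ D * poly q (1 / x)"
  shows "degree r \<le> D \<and> coeff r D = poly q 0"
proof -
  let ?m = "degree q"
  have "[:0, 1:] * (monom 1 ?m * r - monom 1 D * reflect_poly q) = 0"
  proof -
    have "\<forall>x. poly ([:0, 1:] * (monom 1 ?m * r - monom 1 D * reflect_poly q)) x = 0"
    proof
      fix x :: complex
      show "poly ([:0, 1:] * (monom 1 ?m * r - monom 1 D * reflect_poly q)) x = 0"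
      proof (cases "x = 0")
        case False
        then have "poly (reflect_poly q) x = x ^ ?m * poly q (1 / x)"
          by (simp add: poly_reflect_poly_nz inverse_eq_divide)
        then show ?thesis using assms[OF False] by (simp add: poly_monom)
      qed simp
    qed
    then show ?thesis by (simp only: poly_all_0_iff_0)
  qed
  then have "monom 1 ?m * r - monom 1 D * reflect_poly q = 0" by (metis mult_eq_0_iff pCons_eq_0_iff zero_neq_one)
  then have eq: "monom 1 ?m * r = monom 1 D * reflect_poly q" by (simp only: right_minus_eq)
  have c: "coeff r (D + k) = coeff (reflect_poly q) (?m + k)" for k
    using arg_cong[OF eq, of "\<lambda>p. coeff p (?m + (D + k))"] by (simp add: coeff_monom_mult)
  have "coeff r i = 0" if Di: "D < i" for i
  proof -
    obtain k where k: "i = D + k" "k > 0" using less_imp_add_positive[OF Di] by auto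
    have "degree (reflect_poly q) \<le> ?m" by (rule degree_reflect_poly_le)
    then have "coeff (reflect_poly q) (?m + k) = 0" using k(2) by (intro coeff_eq_0) simp
    then show "coeff r i = 0" using c[of k] k(1) by simp
  qed
  then have "degree r \<le> D" by (intro degree_le) simp
  moreover have "coeff r D = poly q 0"
    using c[of 0] by (simp add: coeff_reflect_poly poly_0_coeff_0)
  ultimately show ?thesis by simp
qed

text \<open>
  \<open>L v\<close> and \<open>M v\<close> are polynomials on the line through \<open>v\<close> in direction \<open>e\<close> that behave like the
  restrictions of forms of degrees \<open>d\<close> and \<open>n\<close> that do not vanish at \<open>e\<close>; \<open>f u w\<close> and \<open>g u w\<close> collect the
  restrictions to the lines through the points \<open>u + x w\<close>. The two instances are a pair of forms,
  and a form together with its derivative in direction \<open>e\<close>. Both Bezout's theorem and the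
  discriminant bound need the same facts about the resultant as a function on the lines through \<open>e\<close>.
\<close>

locale resultant_family =
  fixes L M :: "complex ^ 3 \<Rightarrow> complex poly" and f g :: "complex ^ 3 \<Rightarrow> complex ^ 3 \<Rightarrow> complex poly poly"
    and d n :: nat and a b :: complex and e :: "complex ^ 3"
  assumes L: "degree (L v) = d" "coeff (L v) d = a" "a \<noteq> 0"
    and M: "degree (M v) = n" "coeff (M v) n = b" "b \<noteq> 0"
    and L_scale: "s \<noteq> 0 \<Longrightarrow> poly (L (s *s v)) (s * z) = s ^ d * poly (L v) z"
    and M_scale: "s \<noteq> 0 \<Longrightarrow> poly (M (s *s v)) (s * z) = s ^ n * poly (M v) z"
    and L_shift: "poly (L (v + c *s e)) z = poly (L v) (z + c)"
    and M_shift: "poly (M (v + c *s e)) z = poly (M v) (z + c)"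
    and f: "map_poly (\<lambda>p. poly p x) (f u w) = L (u + x *s w)" "degree (f u w) = d"
    and g: "map_poly (\<lambda>p. poly p x) (g u w) = M (u + x *s w)" "degree (g u w) = n"
begin

definition R :: "complex ^ 3 \<Rightarrow> complex" where "R v = resultant (L v) (M v)"

definition resP :: "complex ^ 3 \<Rightarrow> complex ^ 3 \<Rightarrow> complex poly" where "resP u w = resultant (f u w) (g u w)"

lemma nz: "L v \<noteq> 0" "M v \<noteq> 0"
proof -
  show "L v \<noteq> 0" using L(2)[of v] L(3) by auto
  show "M v \<noteq> 0" using M(2)[of v] M(3) by auto
qed

lemma poly_resP: "poly (resP u w) x = R (u + x *s w)"
proof -
  have "resultant (L (u + x *s w)) (M (u + x *s w)) = poly (resP u w) x"
    using comm_ring_hom.resultant_map_poly[OF poly_hom[of x], of "f u w" "g u w"] unfolding f(1) g(1) resP_def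
    by (simp only: f(2) g(2) L(1) M(1) simp_thms)
  then show ?thesis unfolding R_def by (rule sym)
qed

lemma R_scale: "s \<noteq> 0 \<Longrightarrow> R (s *s v) = s ^ (d * n) * R v"
  unfolding R_def
  using resultant_substitution[OF nz(1)[of v] nz(2)[of v], of s "L (s *s v)" "M (s *s v)" 0]
  by (simp add: L M L_scale M_scale)

lemma R_shift: "R (v + c *s e) = R v"
  unfolding R_def
  using resultant_substitution[OF nz(1)[of v] nz(2)[of v], of 1 "L (v + c *s e)" "M (v + c *s e)" "- c"]
  by (simp add: L M L_shift M_shift)

lemma R_eq_0_iff: "R v = 0 \<longleftrightarrow> (\<exists>z. poly (L v) z = 0 \<and> poly (M v) z = 0)"
  unfolding R_def by (rule complex_resultant_eq_0_iff[OF nz])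

text \<open>
  Since \<open>R\<close> scales with degree \<open>d n\<close>, exchanging \<open>u\<close> and \<open>w\<close> reverses the coefficients of the
  resultant. In particular the top coefficient is the value of \<open>R\<close> at \<open>w\<close>.
\<close>

lemma degree_resP: "degree (resP u w) \<le> d * n \<and> coeff (resP u w) (d * n) = R w"
proof -
  have "poly (resP u w) x = x ^ (d * n) * poly (resP w u) (1 / x)" if "x \<noteq> 0" for x
  proof -
    have "u + x *s w = x *s (w + (1 / x) *s u)" using that by (simp add: Finite_Cartesian_Product.vec_eq_iff algebra_simps)
    then show "poly (resP u w) x = x ^ (d * n) * poly (resP w u) (1 / x)"
      by (simp only: poly_resP R_scale[OF that])
  qed
  from poly_reflected_degree[OF this] show ?thesis by (simp add: poly_resP)
qed

text \<open>
  The resultant depends only on the line through \<open>e\<close>, so the base point may be moved to any point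
  of the chart. Local questions about a zero thus reduce to the zero at the origin.
\<close>

lemma resP_shift: "resP (u + x0 *s w + z0 *s e) w = pcompose (resP u w) [:x0, 1:]"
proof -
  have "poly (resP (u + x0 *s w + z0 *s e) w) x = poly (pcompose (resP u w) [:x0, 1:]) x" for x
  proof -
    have "u + x0 *s w + z0 *s e + x *s w = (u + (x0 + x) *s w) + z0 *s e"
      by (simp add: Finite_Cartesian_Product.vec_eq_iff algebra_simps)
    then have "poly (resP (u + x0 *s w + z0 *s e) w) x = R (u + (x0 + x) *s w)"
      unfolding poly_resP by (simp only: R_shift)
    also have "\<dots> = poly (pcompose (resP u w) [:x0, 1:]) x" by (simp add: poly_resP poly_pcompose)
    finally show "poly (resP (u + x0 *s w + z0 *s e) w) x = poly (pcompose (resP u w) [:x0, 1:]) x" .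
  qed
  then show ?thesis by (simp only: poly_eq_poly_eq_iff[symmetric] fun_eq_iff) simp
qed

lemma power_dvd_resP_shift:
  "[:0, 1:] ^ k dvd resP (u + x0 *s w + z0 *s e) w \<longleftrightarrow> [:- x0, 1:] ^ k dvd resP u w"
proof -
  have "pcompose [:x0, 1:] [:- x0, 1:] = [:0, 1 :: complex:]" by (simp add: pcompose_pCons)
  then have 1: "pcompose (pcompose (resP u w) [:x0, 1:]) [:- x0, 1:] = resP u w"
    by (simp only: pcompose_assoc[symmetric] pcompose_idR)
  have pw: "pcompose ([:y, 1:] ^ k) [:z, 1:] = [:y + z, 1:] ^ k" for y z :: complex and k
    by (induction k) (simp_all only: power_0 power_Suc pcompose_mult pcompose_1, simp add: pcompose_pCons)
  show ?thesis unfolding resP_shift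
  proof
    assume "[:0, 1:] ^ k dvd pcompose (resP u w) [:x0, 1:]"
    then obtain q where q: "pcompose (resP u w) [:x0, 1:] = [:0, 1:] ^ k * q" by (rule dvdE)
    have "resP u w = pcompose ([:0, 1:] ^ k * q) [:- x0, 1:]" unfolding q[symmetric] 1 ..
    also have "\<dots> = [:- x0, 1:] ^ k * pcompose q [:- x0, 1:]" unfolding pcompose_mult pw by simp
    finally show "[:- x0, 1:] ^ k dvd resP u w" by (rule dvdI)
  next
    assume "[:- x0, 1:] ^ k dvd resP u w"
    then obtain q where q: "resP u w = [:- x0, 1:] ^ k * q" by (rule dvdE)
    have "pcompose (resP u w) [:x0, 1:] = [:0, 1:] ^ k * pcompose q [:x0, 1:]"
      unfolding q pcompose_mult pw by simp
    then show "[:0, 1:] ^ k dvd pcompose (resP u w) [:x0, 1:]" by (rule dvdI)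
  qed
qed

text \<open>
  For \<open>s \<noteq> 0\<close> the value \<open>R (s u + t w)\<close> is, up to the factor \<open>s ^ (d * n)\<close>, a value of the resultant, so \<open>Q\<close>
  would vanish off the line \<open>s = 0\<close>.
\<close>

lemma resP_nonzero:
  assumes "Q \<noteq> (0 :: complex poly poly)" "\<And>s t. poly (poly Q [:t:]) s = R (s *s u + t *s w)"
  shows "resP u w \<noteq> 0"
proof
  assume z: "resP u w = 0"
  have "poly (poly ([:[:0, 1:]:] * Q) [:t:]) s = 0" for t s
  proof (cases "s = 0")
    case False
    have "s *s u + t *s w = s *s (u + (t / s) *s w)" using False by (simp add: Finite_Cartesian_Product.vec_eq_iff algebra_simps)
    then have "R (s *s u + t *s w) = R (s *s (u + (t / s) *s w))" by (rule arg_cong)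
    also have "\<dots> = s ^ (d * n) * poly (resP u w) (t / s)" unfolding poly_resP by (rule R_scale[OF False])
    also have "\<dots> = 0" by (simp add: z)
    finally have "poly (poly Q [:t:]) s = 0" unfolding assms(2) .
    then show ?thesis by simp
  qed simp
  then have "[:[:0, 1:]:] * Q = 0" by (rule poly_poly_eq_0)
  moreover have "[:[:0, 1:]:] \<noteq> (0 :: complex poly poly)" by simp
  ultimately show False using assms(1) by (simp only: mult_eq_0_iff simp_thms)
qed

end

lemma poly_line_poly_scale:
  assumes "homogeneous d F"
  shows "poly (line_poly F (s *s v) e) (s * z) = s ^ d * poly (line_poly F v e) z"
proof -
  have "s *s v + (s * z) *s e = s *s (v + z *s e)" by (simp add: Finite_Cartesian_Product.vec_eq_iff algebra_simps)
  then show ?thesis by (simp only: poly_line_poly evalp_homogeneous[OF assms])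
qed

lemma poly_line_poly_shift: "poly (line_poly F (v + c *s e) e) z = poly (line_poly F v e) (z + c)"
proof -
  have "v + c *s e + z *s e = v + (z + c) *s e" by (simp add: Finite_Cartesian_Product.vec_eq_iff algebra_simps)
  then show ?thesis by (simp only: poly_line_poly)
qed

lemma degree_line_poly:
  assumes "homogeneous d F" "evalp F e \<noteq> 0"
  shows "degree (line_poly F v e) = d"
  using line_poly_degree[OF assms(1), of v e] assms(2) by (intro antisym le_degree) simp_all

lemma degree_plane_poly:
  assumes "homogeneous d F" "evalp F e \<noteq> 0"
  shows "degree (plane_poly F u w e) = d"
  using plane_poly_degree[OF assms(1), of u w e] assms(2) by (intro antisym le_degree) simp_all

lemma degree_to_poly:
  assumes "homogeneous d F" "evalp F (B $ 3) \<noteq> 0"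
  shows "degree (to_poly B F) = d"
  using to_poly_degree[OF assms(1), of B] assms(2) by (intro antisym le_degree) simp_all

lemma forms_resultant_family:
  assumes "homogeneous d F" "homogeneous n G" "evalp F e \<noteq> 0" "evalp G e \<noteq> 0"
  shows "resultant_family (\<lambda>v. line_poly F v e) (\<lambda>v. line_poly G v e) (\<lambda>u w. plane_poly F u w e)
    (\<lambda>u w. plane_poly G u w e) d n (evalp F e) (evalp G e) e"
  using assms
  by unfold_locales (simp_all add: degree_line_poly degree_plane_poly line_poly_degree poly_line_poly_scale
    poly_line_poly_shift map_plane_poly)

section \<open>The discriminant bounds the multiplicities\<close>

lemma map_poly_pderiv:
  assumes "comm_ring_hom h"
  shows "map_poly h (pderiv p) = pderiv (map_poly h p)"
proof -
  interpret comm_ring_hom h by fact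
  show ?thesis by (intro poly_eqI) (simp add: coeff_map_poly coeff_pderiv hom_mult hom_of_nat del: of_nat_Suc)
qed

lemma poly_pderiv_line_poly_scale:
  assumes "homogeneous d F" "d > 0" "s \<noteq> 0"
  shows "poly (pderiv (line_poly F (s *s v) e)) (s * z) = s ^ (d - 1) * poly (pderiv (line_poly F v e)) z"
proof -
  have sc: "poly (line_poly F (s *s v) e) (z * s) = s ^ d * poly (line_poly F v e) z" for z
    using poly_line_poly_scale[OF assms(1), of s v e z] by (simp only: mult.commute[of z s])
  have "pcompose (line_poly F (s *s v) e) [:0, s:] = smult (s ^ d) (line_poly F v e)"
    by (simp only: poly_eq_poly_eq_iff[symmetric] fun_eq_iff) (simp add: poly_pcompose sc)
  from arg_cong[OF this, of "\<lambda>p. poly (pderiv p) z"]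
  have "s * poly (pderiv (line_poly F (s *s v) e)) (s * z) = s ^ d * poly (pderiv (line_poly F v e)) z"
    by (simp add: pderiv_pcompose poly_pcompose pderiv_smult pderiv_pCons mult.commute)
  moreover have "s ^ d = s * s ^ (d - 1)" using assms(2) by (cases d) simp_all
  ultimately show ?thesis using assms(3) by simp
qed

lemma poly_pderiv_line_poly_shift:
  "poly (pderiv (line_poly F (v + c *s e) e)) z = poly (pderiv (line_poly F v e)) (z + c)"
proof -
  have "line_poly F (v + c *s e) e = pcompose (line_poly F v e) [:c, 1:]"
    by (simp only: poly_eq_poly_eq_iff[symmetric] fun_eq_iff)
      (simp add: poly_pcompose poly_line_poly_shift add.commute)
  then show ?thesis by (simp add: pderiv_pcompose poly_pcompose pderiv_pCons add.commute)
qed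

lemma discriminant_resultant_family:
  assumes "homogeneous d F" "evalp F e \<noteq> 0" "d > 0"
  shows "resultant_family (\<lambda>v. line_poly F v e) (\<lambda>v. pderiv (line_poly F v e)) (\<lambda>u w. plane_poly F u w e)
    (\<lambda>u w. pderiv (plane_poly F u w e)) d (d - 1) (evalp F e) (of_nat d * evalp F e) e"
  using assms
  by unfold_locales (simp_all add: degree_line_poly degree_plane_poly line_poly_degree poly_line_poly_scale
    poly_line_poly_shift map_plane_poly poly_pderiv_line_poly_scale poly_pderiv_line_poly_shift degree_pderiv
    coeff_pderiv map_poly_pderiv[OF poly_hom])

text \<open>
  A vanishing discriminant would give an irreducible polynomial a common factor with its
  derivative, which has smaller degree. The argument takes place in the factorial ring in all
  three variables, where irreducibility is known; the statement about the affine equation follows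
  by \<open>resP_nonzero\<close>.
\<close>

lemma discriminant_nonzero:
  assumes "homogeneous d F" "irreducible F" "d > 0" "triple u w e \<noteq> 0" "evalp F e \<noteq> 0"
  shows "resultant (plane_poly F u w e) (pderiv (plane_poly F u w e)) \<noteq> 0"
proof -
  interpret fam: resultant_family "\<lambda>v. line_poly F v e" "\<lambda>v. pderiv (line_poly F v e)" "\<lambda>u w. plane_poly F u w e"
    "\<lambda>u w. pderiv (plane_poly F u w e)" d "d - 1" "evalp F e" "of_nat d * evalp F e" e
    by (rule discriminant_resultant_family[OF assms(1,5,3)])
  define B :: "complex ^ 3 ^ 3" where "B = vector [u, w, e]"
  define T where "T = to_poly B F"
  have B: "B $ 1 = u" "B $ 2 = w" "B $ 3 = e" by (simp_all add: B_def)
  have T: "irreducible T"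
    unfolding T_def by (rule irreducible_to_poly[OF _ assms(2)]) (simp add: B_def invertible_rows assms(4))
  have deg: "degree T = d" unfolding T_def by (rule degree_to_poly[OF assms(1)]) (simp add: B assms(5))
  have degp: "degree (pderiv T) = d - 1" using deg by (simp add: degree_pderiv)
  have "resultant T (pderiv T) \<noteq> 0"
  proof
    assume "resultant T (pderiv T) = 0"
    then have dg: "degree (gcd T (pderiv T)) \<noteq> 0" by (simp only: resultant_0_gcd simp_thms)
    define g where "g = gcd T (pderiv T)"
    have gd: "g dvd T" "g dvd pderiv T" "degree g \<noteq> 0" using dg by (simp_all add: g_def)
    from gd(1) obtain h where h: "T = g * h" by (rule dvdE)
    from Factorial_Ring.irreducibleD[OF T this] show False
    proof
      assume "g dvd 1"
      then have "degree g \<le> degree (1 :: complex poly poly poly)" by (rule dvd_imp_degree_le) simp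
      then show False using gd(3) by simp
    next
      assume "h dvd 1"
      then obtain k where k: "1 = h * k" by (rule dvdE)
      have "T * k = g * (h * k)" unfolding h by (rule mult.assoc)
      then have "g = T * k" by (simp only: k[symmetric] mult_1_right)
      then have "T dvd g" by (rule dvdI)
      then have "T dvd pderiv T" using gd(2) by (rule dvd_trans)
      moreover have "pderiv T \<noteq> 0" using deg assms(3) by (simp add: pderiv_eq_0_iff)
      ultimately have "degree T \<le> degree (pderiv T)" by (rule dvd_imp_degree_le)
      then show False using deg degp assms(3) by simp
    qed
  qed
  moreover have "poly (poly (resultant T (pderiv T)) [:t:]) s = fam.R (s *s u + t *s w)" for s t
  proof -
    have m: "map_poly (\<lambda>p. poly (poly p [:t:]) s) T = line_poly F (s *s u + t *s w) e"
      unfolding T_def map_to_poly B ..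
    have mp: "map_poly (\<lambda>p. poly (poly p [:t:]) s) (pderiv T) = pderiv (line_poly F (s *s u + t *s w) e)"
      unfolding map_poly_pderiv[OF poly2_hom] m ..
    show ?thesis
      using comm_ring_hom.resultant_map_poly[OF poly2_hom[of t s], of T "pderiv T"] unfolding m mp fam.R_def
      by (simp add: deg degp degree_line_poly[OF assms(1,5)] degree_pderiv)
  qed
  ultimately have "fam.resP u w \<noteq> 0" by (rule fam.resP_nonzero)
  then show ?thesis unfolding fam.resP_def .
qed

lemma line_poly_scale_point:
  assumes "homogeneous d F" "c \<noteq> 0"
  shows "line_poly F (c *s v) y = smult (c ^ d) (line_poly F v ((1 / c) *s y))"
proof -
  have "(\<lambda>i. [:(c *s v) $ i, y $ i:]) = (\<lambda>i. [:c:] * [:v $ i, ((1 / c) *s y) $ i:])"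
    using assms(2) by (simp add: fun_eq_iff)
  then have "line_poly F (c *s v) y = [:c:] ^ d * line_poly F v ((1 / c) *s y)"
    unfolding line_poly_def by (simp only: insertion_homogeneous[OF assms(1)])
  also have "[:c:] ^ d = [:c ^ d:]" by (induction d) (simp_all add: pCons_one)
  finally show ?thesis by simp
qed

text \<open>
  The coefficient of \<open>t ^ n\<close> in \<open>F (v + t (w + \<beta> e))\<close> is a polynomial in \<open>\<beta>\<close> whose coefficients are the
  coefficients of \<open>x\<^sup>k z\<^sup>j\<close> with \<open>k + j = n\<close> in the affine equation. It vanishes for all \<open>\<beta>\<close> if \<open>n < m\<close>.
\<close>

lemma dvd_coeff_plane_poly:
  assumes "\<And>y n. n < m \<Longrightarrow> coeff (line_poly F v y) n = 0"
  shows "[:0, 1:] ^ (m - j) dvd coeff (plane_poly F v w e) j"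
proof -
  let ?P = "plane_poly F v w e"
  have "coeff (coeff ?P j) k = 0" if kj: "k + j < m" for k
  proof (cases "j \<le> degree ?P")
    case True
    let ?n = "k + j"
    define c where "c i = (if i \<le> ?n then coeff (coeff ?P i) (?n - i) else 0)" for i
    have "poly (\<Sum>i\<le>degree ?P. monom (c i) i) \<beta> = 0" for \<beta>
    proof -
      have "poly ?P [:0, \<beta>:] = line_poly F v (w + \<beta> *s e)"
        unfolding plane_poly_def line_poly_def by (subst hom_insertion[OF poly_hom]) (simp add: mult.commute)
      then have "coeff (poly ?P [:0, \<beta>:]) ?n = 0" using assms[OF kj] by simp
      moreover have "[:0, \<beta>:] ^ i = monom (\<beta> ^ i) i" for i
        by (induction i) (simp_all add: monom_altdef pCons_one mult.commute)
      then have "coeff (poly ?P [:0, \<beta>:]) ?n = (\<Sum>i\<le>degree ?P. coeff (monom (\<beta> ^ i) i * coeff ?P i) ?n)"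
        by (simp add: poly_altdef coeff_sum mult.commute)
      moreover have "coeff (monom (\<beta> ^ i) i * coeff ?P i) ?n = c i * \<beta> ^ i" for i
        by (simp add: coeff_monom_mult c_def)
      ultimately show ?thesis by (simp add: poly_sum poly_monom)
    qed
    then have "(\<Sum>i\<le>degree ?P. monom (c i) i) = 0" by (simp only: poly_all_0_iff_0[symmetric] simp_thms)
    then have "coeff (\<Sum>i\<le>degree ?P. monom (c i) i) j = 0" by simp
    then have "c j = 0" using True by (simp add: coeff_sum)
    then show ?thesis by (simp add: c_def)
  next
    case False
    then have "coeff ?P j = 0" by (simp add: coeff_eq_0)
    then show ?thesis by simp
  qed
  then have "monom 1 (m - j) dvd coeff ?P j" unfolding monom_1_dvd_iff' by simp
  then show ?thesis by (simp add: monom_altdef)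
qed

lemma sum_orders_le_degree:
  fixes r :: "'a::idom poly"
  assumes "r \<noteq> 0" "finite V" "inj_on x V" "\<And>v. v \<in> V \<Longrightarrow> [:- x v, 1:] ^ k v dvd r"
  shows "(\<Sum>v\<in>V. k v) \<le> degree r"
proof -
  have "(\<Sum>v\<in>V. k v) \<le> (\<Sum>v\<in>V. count (proots r) (x v))"
  proof (rule sum_mono)
    fix v assume "v \<in> V"
    then have "[:- x v, 1:] ^ k v dvd r" by (rule assms(4))
    then have "k v \<le> order (x v) r" using assms(1) by (simp only: order_divides) simp
    then show "k v \<le> count (proots r) (x v)" using assms(1) by simp
  qed
  also have "\<dots> = (\<Sum>y\<in>x ` V. count (proots r) y)" by (simp only: sum.reindex[OF assms(3)] comp_def)
  also have "\<dots> \<le> (\<Sum>y\<in>x ` V \<union> set_mset (proots r). count (proots r) y)"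
    by (intro sum_mono2) (use assms(2) in auto)
  also have "\<dots> = (\<Sum>y\<in>set_mset (proots r). count (proots r) y)"
    by (intro sum.mono_neutral_right) (use assms(2) in \<open>auto simp: not_in_iff simp del: count_proots set_count_proots\<close>)
  also have "\<dots> = size (proots r)" by (simp only: size_multiset_overloaded_eq)
  also have "\<dots> \<le> degree r" by (rule size_proots_le)
  finally show ?thesis .
qed

text \<open>
  The order of the curve at a point is expressed by the lines through the point: \<open>m v\<close> is a bound for
  the order of vanishing on each of them. The order of the derivative is at least one less, so the
  discriminant vanishes to order \<open>m v * (m v - 1)\<close> at the abscissa of \<open>v\<close>, and its degree bounds the
  number of its zeros.
\<close>

theorem sum_multiplicities_le:
  assumes F: "homogeneous d F" "irreducible F" "d > 0"
    and V: "finite V" "0 \<notin> V"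
    and indep: "\<And>v v' c. v \<in> V \<Longrightarrow> v' \<in> V \<Longrightarrow> v \<noteq> v' \<Longrightarrow> v \<noteq> c *s v'"
    and order: "\<And>v y n. v \<in> V \<Longrightarrow> n < m v \<Longrightarrow> coeff (line_poly F v y) n = 0"
    and pos: "\<And>v. v \<in> V \<Longrightarrow> m v > 0"
  shows "(\<Sum>v\<in>V. m v * (m v - 1)) \<le> d * (d - 1)"
proof (cases "V = {}")
  case False
  have F0: "F \<noteq> 0" using F(2) by auto
  have on: "evalp F v = 0" if "v \<in> V" for v
  proof -
    have "evalp F v = coeff (line_poly F v 0) 0"
      using poly_line_poly[of F v 0 0] by (simp add: poly_0_coeff_0)
    then show ?thesis using order[OF that pos[OF that]] by simp
  qed
  have "\<exists>u w e. triple u w e \<noteq> 0 \<and> (\<forall>F\<in>{F}. evalp F e \<noteq> 0) \<and>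
    (\<forall>v\<in>V. \<exists>a x z. a \<noteq> 0 \<and> v = a *s (u + x *s w + z *s e)) \<and>
    (\<forall>v\<in>V. \<forall>v'\<in>V. \<forall>a x z a' z'. v = a *s (u + x *s w + z *s e) \<longrightarrow>
      v' = a' *s (u + x *s w + z' *s e) \<longrightarrow> v = v')"
  proof (rule general_position[OF V(1) False V(2)])
    show "\<exists>G\<in>{F}. \<exists>k. homogeneous k G \<and> evalp G v = 0" if "v \<in> V" for v using F(1) on[OF that] by auto
  qed (use F0 indep in auto)
  then obtain u w e where T: "triple u w e \<noteq> 0" and e: "\<forall>F\<in>{F}. evalp F e \<noteq> 0"
    and rep: "\<forall>v\<in>V. \<exists>a x z. a \<noteq> 0 \<and> v = a *s (u + x *s w + z *s e)"
    and inj: "\<forall>v\<in>V. \<forall>v'\<in>V. \<forall>a x z a' z'. v = a *s (u + x *s w + z *s e) \<longrightarrow>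
      v' = a' *s (u + x *s w + z' *s e) \<longrightarrow> v = v'" by (elim exE conjE)
  from e have e: "evalp F e \<noteq> 0" by simp
  interpret fam: resultant_family "\<lambda>v. line_poly F v e" "\<lambda>v. pderiv (line_poly F v e)" "\<lambda>u w. plane_poly F u w e"
    "\<lambda>u w. pderiv (plane_poly F u w e)" d "d - 1" "evalp F e" "of_nat d * evalp F e" e
    by (rule discriminant_resultant_family[OF F(1) e F(3)])
  from bchoice[OF rep] obtain a where "\<forall>v\<in>V. \<exists>x z. a v \<noteq> 0 \<and> v = a v *s (u + x *s w + z *s e)" by (elim exE)
  from bchoice[OF this] obtain x where "\<forall>v\<in>V. \<exists>z. a v \<noteq> 0 \<and> v = a v *s (u + x v *s w + z *s e)" by (elim exE)
  from bchoice[OF this] obtain z where axz: "\<forall>v\<in>V. a v \<noteq> 0 \<and> v = a v *s (u + x v *s w + z v *s e)" by (elim exE)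
  have "inj_on x V"
  proof (rule inj_onI)
    fix v v' assume v: "v \<in> V" "v' \<in> V" "x v = x v'"
    have 1: "v = a v *s (u + x v *s w + z v *s e)" using axz v(1) by blast
    have 2: "v' = a v' *s (u + x v *s w + z v' *s e)" unfolding v(3) using axz v(2) by blast
    show "v = v'" by (rule inj[rule_format, OF v(1,2) 1 2])
  qed
  have "(\<Sum>v\<in>V. m v * (m v - 1)) \<le> degree (fam.resP u w)"
  proof (rule sum_orders_le_degree[OF _ V(1) \<open>inj_on x V\<close>])
    show "fam.resP u w \<noteq> 0" unfolding fam.resP_def by (rule discriminant_nonzero[OF F T e])
    fix v assume v: "v \<in> V"
    have av: "a v \<noteq> 0" "v = a v *s (u + x v *s w + z v *s e)" using axz v by blast+
    let ?v = "u + x v *s w + z v *s e"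
    have v': "?v = (1 / a v) *s v" using av by (simp add: Finite_Cartesian_Product.vec_eq_iff field_simps)
    have ord: "coeff (line_poly F ?v y) n = 0" if "n < m v" for y n
      unfolding v' using av(1) order[OF v that] by (simp add: line_poly_scale_point[OF F(1)])
    have deg: "degree (plane_poly F ?v w e) = d" by (rule degree_plane_poly[OF F(1) e])
    have md: "m v \<le> d"
    proof (rule ccontr)
      assume "\<not> m v \<le> d"
      then have "coeff (line_poly F ?v e) d = 0" using ord by simp
      then show False using line_poly_degree(2)[OF F(1), of ?v e] e by simp
    qed
    have "[:0, 1:] ^ (m v * (m v - 1)) dvd fam.resP ?v w"
      unfolding fam.resP_def
    proof (rule power_dvd_resultant)
      show "[:0, 1:] ^ (m v - j) dvd coeff (plane_poly F ?v w e) j" for j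
        by (rule dvd_coeff_plane_poly) (rule ord)
      show "[:0, 1:] ^ (m v - 1 - j) dvd coeff (pderiv (plane_poly F ?v w e)) j" for j
      proof -
        have "[:0, 1:] ^ (m v - Suc j) dvd coeff (plane_poly F ?v w e) (Suc j)"
          by (rule dvd_coeff_plane_poly) (rule ord)
        then show ?thesis unfolding coeff_pderiv by (intro dvd_mult) simp
      qed
    qed (use deg md in \<open>simp_all add: degree_pderiv\<close>)
    then show "[:- x v, 1:] ^ (m v * (m v - 1)) dvd fam.resP u w"
      by (simp only: fam.power_dvd_resP_shift)
  qed
  also have "\<dots> \<le> d * (d - 1)" using fam.degree_resP[of u w] by simp
  finally show ?thesis .
qed simp

section \<open>Simple zeros of resultants\<close>

lemma coeff_poly_at_linear:
  fixes f :: "complex poly poly"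
  shows "coeff (poly f [:0, c:]) 0 = coeff (coeff f 0) 0"
    and "coeff (poly f [:0, c:]) 1 = coeff (coeff f 0) 1 + c * coeff (coeff f 1) 0"
proof -
  have 0: "coeff (poly p [:0, c:]) 0 = coeff (coeff p 0) 0" for p :: "complex poly poly"
    by (cases p) simp
  show "coeff (poly f [:0, c:]) 0 = coeff (coeff f 0) 0" by (rule 0)
  obtain a p where f: "f = pCons a p" by (cases f)
  have "coeff (poly f [:0, c:]) 1 = coeff a 1 + c * coeff (poly p [:0, c:]) 0" by (simp add: f)
  then show "coeff (poly f [:0, c:]) 1 = coeff (coeff f 0) 1 + c * coeff (coeff f 1) 0" unfolding 0 by (simp add: f)
qed

lemma poly_eval_eval: "poly (map_poly (\<lambda>p. poly p x) g) (poly q x) = poly (poly g q) (x :: complex)"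
  by (induction g) (simp_all add: map_poly_hom_pCons[OF poly_hom])

lemma coeff_1_mult: "coeff (p * q) 1 = coeff p 0 * coeff q 1 + coeff p 1 * coeff (q :: 'a::comm_semiring_1 poly) 0"
  by (simp add: coeff_mult)

lemma square_dvd_imp_coeff:
  assumes "[:0, 1:] ^ 2 dvd (p :: complex poly)"
  shows "coeff p 0 = 0" "coeff p 1 = 0"
proof -
  have "monom 1 2 dvd p" using assms by (simp add: monom_altdef)
  then have "\<forall>k<2. coeff p k = 0" by (simp only: monom_1_dvd_iff')
  then show "coeff p 0 = 0" "coeff p 1 = 0" by simp_all
qed

lemma square_dvdI:
  assumes "coeff p 0 = 0" "coeff p 1 = 0"
  shows "[:0, 1:] ^ 2 dvd (p :: complex poly)"
proof -
  have "coeff p k = 0" if "k < 2" for k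
  proof -
    have "k = 0 \<or> k = 1" using that by linarith
    then show ?thesis using assms by auto
  qed
  then have "monom 1 2 dvd p" by (simp only: monom_1_dvd_iff') simp
  then show ?thesis by (simp add: monom_altdef)
qed

text \<open>
  The branch of \<open>f\<close> through the origin is a graph \<open>z = \<zeta>(x)\<close>, here needed up to first order: modulo \<open>x\<^sup>2\<close> the
  linear polynomial \<open>\<zeta>\<close> is a root of \<open>f\<close>. So \<open>f\<close> may be replaced by \<open>f' = (z - \<zeta>) q\<close>, and
  \<open>Res(f', g) = g(\<zeta>) Res(q, g)\<close>. The first factor has a simple zero by the Jacobian criterion. The
  second one is not zero at the origin, since \<open>0\<close> is a simple root of \<open>f\<close> there and its only
  common root with \<open>g\<close>.
\<close>

lemma resultant_simple_zero_if_graph: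
  fixes f g :: "complex poly poly"
  assumes df: "\<And>x. degree (map_poly (\<lambda>p. poly p x) f) = degree f" "degree f > 0"
    and dg: "\<And>x. degree (map_poly (\<lambda>p. poly p x) g) = degree g" "degree g > 0"
    and zero: "coeff (coeff f 0) 0 = 0" "coeff (coeff g 0) 0 = 0"
    and jac: "coeff (coeff f 0) 1 * coeff (coeff g 1) 0 \<noteq> coeff (coeff f 1) 0 * coeff (coeff g 0) 1"
    and fz: "coeff (coeff f 1) 0 \<noteq> 0"
    and uniq: "\<And>z. poly (map_poly (\<lambda>p. poly p 0) f) z = 0 \<Longrightarrow> poly (map_poly (\<lambda>p. poly p 0) g) z = 0 \<Longrightarrow> z = 0"
  shows "\<not> [:0, 1:] ^ 2 dvd resultant f g"
proof
  assume sq: "[:0, 1:] ^ 2 dvd resultant f g"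
  let ?ev = "\<lambda>x. map_poly (\<lambda>p. poly p (x :: complex))"
  \<comment> \<open>The slope at the origin of the branch \<open>f = 0\<close>.\<close>
  define c where "c = - coeff (coeff f 0) 1 / coeff (coeff f 1) 0"
  define \<zeta> where "\<zeta> = [:0, c:]"
  define q where "q = synthetic_div f \<zeta>"
  define \<epsilon> where "\<epsilon> = poly f \<zeta>"
  define f' where "f' = [:- \<zeta>, 1:] * q"
  have f: "f = f' + [:\<epsilon>:]" unfolding f'_def q_def \<epsilon>_def by (rule synthetic_div_correct'[symmetric])
  have e: "[:0, 1:] ^ 2 dvd \<epsilon>"
    by (rule square_dvdI) (simp_all add: \<epsilon>_def \<zeta>_def coeff_poly_at_linear[unfolded One_nat_def] zero c_def fz[unfolded One_nat_def])
  have q0: "q \<noteq> 0" unfolding q_def using df(2) by (simp add: synthetic_div_eq_0_iff)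
  have dq: "degree q = degree f - 1" unfolding q_def by (rule degree_synthetic_div)
  have "degree f' = degree [:- \<zeta>, 1:] + degree q" unfolding f'_def by (rule degree_mult_eq[OF _ q0]) simp
  then have df': "degree f' = degree f" using dq df(2) by simp
  have "[:0, 1:] ^ 2 dvd resultant f g - resultant f' g"
  proof (rule resultant_diff_dvd[OF df'])
    fix j
    have "coeff f j - coeff f' j = (if j = 0 then \<epsilon> else 0)" unfolding f by (simp add: coeff_pCons split: nat.split)
    then show "[:0, 1:] ^ 2 dvd coeff f j - coeff f' j" using e by simp
  qed
  from dvd_diff[OF sq this] have sq': "[:0, 1:] ^ 2 dvd resultant f' g" by simp
  have evf': "?ev x f' = [:- poly \<zeta> x, 1:] * ?ev x q" for x
  proof -
    interpret h: comm_ring_hom "map_poly (\<lambda>p. poly p x)" by (rule map_poly_comm_ring_hom[OF poly_hom])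
    have "?ev x [:- \<zeta>, 1:] = [:- poly \<zeta> x, 1:]" by (simp add: map_poly_hom_pCons[OF poly_hom])
    then show ?thesis unfolding f'_def by (simp only: h.hom_mult)
  qed
  have lc: "coeff (?ev x f') (degree f) \<noteq> 0" for x
  proof -
    have "coeff (?ev x f) (degree f) \<noteq> 0"
      using df(1)[of x] df(2) by (metis degree_0 leading_coeff_0_iff less_irrefl)
    moreover have "coeff f (degree f) = coeff f' (degree f)"
      using df(2) by (subst f) (simp add: coeff_pCons split: nat.split)
    ultimately show ?thesis by (simp add: coeff_map_poly)
  qed
  have evq0: "?ev x q \<noteq> 0" for x
  proof
    assume "?ev x q = 0"
    then have "?ev x f' = 0" unfolding evf' by (simp only: mult_zero_right)
    then show False using lc[of x] by simp
  qed
  have evdf': "degree (?ev x f') = degree f'" for x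
  proof (rule antisym)
    show "degree (?ev x f') \<le> degree f'" by (rule degree_map_poly_le)
    show "degree f' \<le> degree (?ev x f')" unfolding df' by (rule le_degree) (rule lc)
  qed
  have evdq: "degree (?ev x q) = degree q" for x
  proof -
    have "degree (?ev x f') = degree [:- poly \<zeta> x, 1:] + degree (?ev x q)"
      unfolding evf' by (rule degree_mult_eq[OF _ evq0]) simp
    moreover have "degree [:- poly \<zeta> x, 1:] = 1" by simp
    ultimately show ?thesis using evdf'[of x] df' dq by linarith
  qed
  have evg0: "?ev x g \<noteq> 0" for x using dg(1)[of x] dg(2) by auto
  have res: "resultant f' g = poly g \<zeta> * resultant q g"
  proof -
    have "poly (resultant f' g) x = poly (poly g \<zeta> * resultant q g) x" for x
    proof -
      have 1: "poly (resultant f' g) x = resultant (?ev x f') (?ev x g)"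
        by (rule comm_ring_hom.resultant_map_poly[OF poly_hom[of x] evdf' dg(1), symmetric])
      have 2: "resultant (?ev x f') (?ev x g) = poly (?ev x g) (poly \<zeta> x) * resultant (?ev x q) (?ev x g)"
        unfolding evf' by (rule resultant_linear_factor[OF evq0 evg0])
      have 3: "resultant (?ev x q) (?ev x g) = poly (resultant q g) x"
        by (rule comm_ring_hom.resultant_map_poly[OF poly_hom[of x] evdq dg(1)])
      show "poly (resultant f' g) x = poly (poly g \<zeta> * resultant q g) x"
        unfolding 1 2 3 poly_eval_eval poly_mult ..
    qed
    then show ?thesis by (simp only: poly_eq_poly_eq_iff[symmetric] fun_eq_iff) simp
  qed
  have "coeff (poly g \<zeta> * resultant q g) 1 = 0"
    using square_dvd_imp_coeff(2)[OF sq'] unfolding res .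
  then have "coeff (poly g \<zeta>) 1 * coeff (resultant q g) 0 = 0"
    unfolding coeff_1_mult \<zeta>_def coeff_poly_at_linear(1) zero by simp
  moreover have "coeff (poly g \<zeta>) 1 \<noteq> 0"
    unfolding \<zeta>_def coeff_poly_at_linear(2) c_def using jac fz by (simp add: field_simps)
  ultimately have "poly (resultant q g) 0 = 0" by (simp add: poly_0_coeff_0)
  then have "resultant (?ev 0 q) (?ev 0 g) = 0"
    using comm_ring_hom.resultant_map_poly[OF poly_hom[of 0] evdq dg(1)] by simp
  then obtain z where z: "poly (?ev 0 q) z = 0" "poly (?ev 0 g) z = 0"
    by (simp only: complex_resultant_eq_0_iff[OF evq0 evg0]) (elim exE conjE)
  have ev0: "?ev 0 f = [:0, 1:] * ?ev 0 q"
  proof -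
    interpret h: comm_ring_hom "map_poly (\<lambda>p. poly p (0 :: complex))" by (rule map_poly_comm_ring_hom[OF poly_hom])
    have "?ev 0 f = ?ev 0 f' + ?ev 0 [:\<epsilon>:]" by (subst f) (rule h.hom_add)
    also have "?ev 0 [:\<epsilon>:] = 0"
    proof -
      have "poly \<epsilon> 0 = 0" using square_dvd_imp_coeff(1)[OF e] by (simp add: poly_0_coeff_0)
      then show ?thesis by (simp only: map_poly_hom_pCons[OF poly_hom] map_poly_0) simp
    qed
    also have "?ev 0 f' = [:0, 1:] * ?ev 0 q" unfolding evf' by (simp add: \<zeta>_def)
    finally show ?thesis by simp
  qed
  have "poly (?ev 0 f) z = 0" unfolding ev0 poly_mult z(1) by simp
  then have "z = 0" using z(2) by (rule uniq)
  then have "coeff (?ev 0 q) 0 = 0" using z(1) by (simp add: poly_0_coeff_0)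
  then have "coeff (?ev 0 f) 1 = 0" unfolding ev0 by simp
  then show False using fz by (simp add: coeff_map_poly poly_0_coeff_0)
qed

text \<open>
  If \<open>f\<close> is not smooth over the \<open>x\<close>-axis, then \<open>g\<close> is by the Jacobian criterion, and the roles of the
  two polynomials can be exchanged.
\<close>

lemma resultant_simple_zero:
  fixes f g :: "complex poly poly"
  assumes df: "\<And>x. degree (map_poly (\<lambda>p. poly p x) f) = degree f" "degree f > 0"
    and dg: "\<And>x. degree (map_poly (\<lambda>p. poly p x) g) = degree g" "degree g > 0"
    and zero: "coeff (coeff f 0) 0 = 0" "coeff (coeff g 0) 0 = 0"
    and jac: "coeff (coeff f 0) 1 * coeff (coeff g 1) 0 \<noteq> coeff (coeff f 1) 0 * coeff (coeff g 0) 1"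
    and uniq: "\<And>z. poly (map_poly (\<lambda>p. poly p 0) f) z = 0 \<Longrightarrow> poly (map_poly (\<lambda>p. poly p 0) g) z = 0 \<Longrightarrow> z = 0"
  shows "\<not> [:0, 1:] ^ 2 dvd resultant f g"
proof (cases "coeff (coeff f 1) 0 = 0")
  case False
  show ?thesis by (rule resultant_simple_zero_if_graph[OF df dg zero jac False uniq])
next
  case True
  then have gz: "coeff (coeff g 1) 0 \<noteq> 0" using jac by auto
  have jac': "coeff (coeff g 0) 1 * coeff (coeff f 1) 0 \<noteq> coeff (coeff g 1) 0 * coeff (coeff f 0) 1"
    using jac by (simp only: mult.commute)
  have uniq': "z = 0" if "poly (map_poly (\<lambda>p. poly p 0) g) z = 0" "poly (map_poly (\<lambda>p. poly p 0) f) z = 0" for z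
    by (rule uniq[OF that(2,1)])
  have "\<not> [:0, 1:] ^ 2 dvd resultant g f"
    by (rule resultant_simple_zero_if_graph[OF dg df zero(2,1) jac' gz uniq'])
  moreover have "resultant g f = (- 1) ^ (degree g * degree f) * resultant f g" by (rule resultant_swap)
  ultimately show ?thesis by (metis dvd_mult)
qed

section \<open>Gradients\<close>

lemma coeff_0_line_poly: "coeff (line_poly F v y) 0 = evalp F v"
  using poly_line_poly[of F v y 0] by (simp add: poly_0_coeff_0)

lemma line_poly_hom: "comm_ring_hom (\<lambda>F. line_poly F v y)"
  unfolding line_poly_def by (rule comm_ring_hom_insertion) (standard, simp_all add: pCons_one)

lemma gradient_nth: "gradient F v $ i = coeff (line_poly F v (axis i 1)) 1"
proof -
  have "gradient F v $ i = deriv (poly (line_poly F v (axis i 1))) 0"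
    by (simp add: gradient_def poly_line_poly[abs_def, symmetric])
  also have "\<dots> = poly (pderiv (line_poly F v (axis i 1))) 0" by (rule DERIV_imp_deriv[OF poly_DERIV])
  also have "\<dots> = coeff (line_poly F v (axis i 1)) 1" by (simp add: poly_0_coeff_0 coeff_pderiv)
  finally show ?thesis .
qed

lemma coeff_1_line_poly_mult:
  "coeff (line_poly (P * Q) v y) 1 = evalp P v * coeff (line_poly Q v y) 1 + evalp Q v * coeff (line_poly P v y) 1"
proof -
  interpret comm_ring_hom "\<lambda>F. line_poly F v y" by (rule line_poly_hom)
  show ?thesis unfolding hom_mult coeff_1_mult coeff_0_line_poly by (simp only: mult.commute)
qed

lemma gradient_mult: "gradient (P * Q) v = evalp P v *s gradient Q v + evalp Q v *s gradient P v"
  unfolding Finite_Cartesian_Product.vec_eq_iff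
  by (simp only: vector_add_component vector_smult_component gradient_nth coeff_1_line_poly_mult simp_thms)

text \<open>
  Both sides are derivations of the polynomial ring at \<open>v\<close>, so it suffices to compare them on constants
  and variables.
\<close>

lemma coeff_1_line_poly: "coeff (line_poly F v y) 1 = (\<Sum>i\<in>UNIV. gradient F v $ i * y $ i)"
proof -
  let ?T = "{F. coeff (line_poly F v y) 1 = (\<Sum>i\<in>UNIV. coeff (line_poly F v (axis i 1)) 1 * y $ i)}"
  interpret h: comm_ring_hom "\<lambda>F. line_poly F v y" for y by (rule line_poly_hom)
  have c: "line_poly (const a) v y = [:a:]" for a y
    unfolding line_poly_def by (rule insertion_const) (standard, simp_all add: pCons_one)
  have vr: "line_poly (var i) v y = [:v $ i, y $ i:]" for i y
    unfolding line_poly_def by (rule insertion_var) (standard, simp_all add: pCons_one)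
  have "insertion const var F \<in> ?T"
  proof (rule insertion_closed)
    show c': "const a \<in> ?T" for a by (simp add: c)
    show "0 \<in> ?T" by simp
    show "1 \<in> ?T" using c'[of 1] by (simp add: const_def)
    show "var i \<in> ?T" for i
      by (simp add: vr axis_def if_distrib[of "\<lambda>x. x * _"] cong: if_cong)
    show "P + Q \<in> ?T" if "P \<in> ?T" "Q \<in> ?T" for P Q
      using that by (simp add: h.hom_add ring_distribs sum.distrib)
    show "P * Q \<in> ?T" if "P \<in> ?T" "Q \<in> ?T" for P Q
      using that unfolding mem_Collect_eq coeff_1_line_poly_mult
      by (simp only: sum_distrib_left sum.distrib ring_distribs mult.assoc)
  qed
  then show ?thesis by (simp add: gradient_nth)
qed

section \<open>Transversal intersections\<close>

lemma frame_exists: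
  assumes "e \<noteq> 0"
  shows "\<exists>u w. triple u w e \<noteq> 0"
proof -
  obtain i where i: "e $ i \<noteq> 0" using assms by (auto simp: Finite_Cartesian_Product.vec_eq_iff)
  consider "i = 1" | "i = 2" | "i = 3" using exhaust_3 by blast
  then show ?thesis
  proof cases
    case 1
    then have "triple (vector [0, 1, 0]) (vector [0, 0, 1]) e \<noteq> 0" using i by (simp add: triple_def)
    then show ?thesis by blast
  next
    case 2
    then have "triple (vector [0, 0, 1]) (vector [1, 0, 0]) e \<noteq> 0" using i by (simp add: triple_def)
    then show ?thesis by blast
  next
    case 3
    then have "triple (vector [1, 0, 0]) (vector [0, 1, 0]) e \<noteq> 0" using i by (simp add: triple_def)
    then show ?thesis by blast
  qed
qed

text \<open>A vector that completes two others to a basis is nonzero.\<close>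

lemma frame_point_nonzero:
  assumes "triple u w e \<noteq> 0"
  shows "u + x *s w + z *s e \<noteq> 0" "w + z *s e \<noteq> 0"
proof -
  have "triple (u + x *s w + z *s e) w e = triple u w e" using triple_linear1[of 1 u x w z e] by simp
  moreover have "triple 0 w e = 0" by (simp add: triple_def)
  ultimately show "u + x *s w + z *s e \<noteq> 0" using assms by (metis (no_types))
  have "triple u (w + z *s e) e = triple u w e" using triple_linear2[of u 0 1 w z e] by simp
  moreover have "triple u 0 e = 0" by (simp add: triple_def)
  ultimately show "w + z *s e \<noteq> 0" using assms by (metis (no_types))
qed

lemma evalp_at_0: "homogeneous d F \<Longrightarrow> d > 0 \<Longrightarrow> evalp F 0 = 0"
  using evalp_homogeneous[of d F 0 0] by (cases d) simp_all

lemma complex_poly_has_root: "degree p > 0 \<Longrightarrow> \<exists>z. poly p z = (0 :: complex)"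
  by (rule fundamental_theorem_of_algebra) (simp add: constant_degree)

lemma form_has_zero:
  assumes "homogeneous d F" "d > 0" "F \<noteq> 0"
  shows "\<exists>v. v \<noteq> 0 \<and> evalp F v = 0"
proof -
  obtain e where e: "evalp F e \<noteq> 0" using evalp_eq_0_imp[of F] assms(3) by auto
  then have "e \<noteq> 0" using evalp_at_0[OF assms(1,2)] by auto
  from frame_exists[OF this] obtain u w where T: "triple u w e \<noteq> 0" by (elim exE)
  have "degree (line_poly F (u + 0 *s w) e) > 0" using degree_line_poly[OF assms(1) e] assms(2) by simp
  from complex_poly_has_root[OF this] obtain z where "poly (line_poly F (u + 0 *s w) e) z = 0" by (elim exE)
  then have "evalp F (u + 0 *s w + z *s e) = 0" unfolding poly_line_poly .
  then show ?thesis using frame_point_nonzero(1)[OF T] by blast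
qed

lemma gradient_0: "gradient 0 v = 0"
proof -
  interpret comm_ring_hom "\<lambda>F. line_poly F v y" for y by (rule line_poly_hom)
  show ?thesis by (simp add: Finite_Cartesian_Product.vec_eq_iff gradient_nth)
qed

lemma meet_transversally_sym: "meet_transversally G H \<Longrightarrow> meet_transversally H G"
  unfolding meet_transversally_def by (metis add.commute)

lemma meet_transversally_gradients:
  assumes "meet_transversally G H" "v \<noteq> 0" "evalp G v = 0" "evalp H v = 0"
    and "a *s gradient G v + b *s gradient H v = 0"
  shows "a = 0" "b = 0"
  using assms unfolding meet_transversally_def by blast+

text \<open>
  The zero form would meet any curve at every point with zero gradient, and \<open>H\<close> has points over the
  complex numbers.
\<close>

lemma meet_transversally_nonzero:
  assumes "meet_transversally G H" "homogeneous d H" "d > 0"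
  shows "G \<noteq> 0"
proof
  assume G: "G = 0"
  have "\<exists>v. v \<noteq> 0 \<and> evalp H v = 0"
  proof (cases "H = 0")
    case True
    then have "axis 1 1 \<noteq> (0 :: complex ^ 3) \<and> evalp H (axis 1 1) = 0" by (simp add: evalp_def axis_eq_0_iff)
    then show ?thesis by blast
  qed (rule form_has_zero[OF assms(2,3)])
  then obtain v where v: "v \<noteq> 0" "evalp H v = 0" by blast
  have "evalp G v = 0" by (simp add: G evalp_def)
  moreover have "1 *s gradient G v + 0 *s gradient H v = 0" by (simp add: G gradient_0)
  ultimately show False using meet_transversally_gradients(1)[OF assms(1) v(1) _ v(2)] by fastforce
qed

text \<open>
  If the resultant vanished, the two forms would have a common factor \<open>p\<close> of positive degree in \<open>z\<close>. At a
  zero of \<open>p\<close> both gradients are multiples of the gradient of \<open>p\<close>, which contradicts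
  transversality.
\<close>

lemma transversal_resultant_nonzero:
  assumes G: "homogeneous d G" and H: "homogeneous d H" and "d > 0" and tr: "meet_transversally G H"
    and T: "triple u w e \<noteq> 0" and e: "evalp G e \<noteq> 0" "evalp H e \<noteq> 0"
  shows "resultant (plane_poly G u w e) (plane_poly H u w e) \<noteq> 0"
proof -
  interpret fam: resultant_family "\<lambda>v. line_poly G v e" "\<lambda>v. line_poly H v e" "\<lambda>u w. plane_poly G u w e"
    "\<lambda>u w. plane_poly H u w e" d d "evalp G e" "evalp H e" e
    by (rule forms_resultant_family[OF G H e])
  define B :: "complex ^ 3 ^ 3" where "B = vector [u, w, e]"
  have B: "B $ 1 = u" "B $ 2 = w" "B $ 3 = e" by (simp_all add: B_def)
  have inv: "invertible B" by (simp add: B_def invertible_rows T)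
  define P where "P = gcd (to_poly B G) (to_poly B H)"
  have dG: "degree (to_poly B G) = d" by (rule degree_to_poly[OF G]) (simp add: B e)
  have dH: "degree (to_poly B H) = d" by (rule degree_to_poly[OF H]) (simp add: B e)
  have ev: "map_poly (\<lambda>p. poly (poly p [:t:]) s) (to_poly B F) = line_poly F (s *s u + t *s w) e" for s t F
    unfolding map_to_poly B ..
  have "resultant (to_poly B G) (to_poly B H) \<noteq> 0"
  proof
    assume "resultant (to_poly B G) (to_poly B H) = 0"
    then have dP: "degree P \<noteq> 0" unfolding P_def by (simp only: resultant_0_gcd simp_thms)
    have "P dvd to_poly B G" "P dvd to_poly B H" unfolding P_def by (rule gcd_dvd1, rule gcd_dvd2)
    then obtain Q1 Q2 where Q: "to_poly B G = P * Q1" "to_poly B H = P * Q2" by (elim dvdE)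
    from to_poly_inverse[OF inv] obtain L where L: "\<forall>F. from_poly L (to_poly B F) = F"
      "\<forall>P. to_poly B (from_poly L P) = P" by (elim exE conjE)
    interpret S: comm_ring_hom "from_poly L" by (rule from_poly_hom)
    define p where "p = from_poly L P"
    have Gp: "G = p * from_poly L Q1" unfolding p_def S.hom_mult[symmetric] Q(1)[symmetric] using L(1) by simp
    have Hp: "H = p * from_poly L Q2" unfolding p_def S.hom_mult[symmetric] Q(2)[symmetric] using L(1) by simp
    let ?lp = "\<lambda>F. line_poly F (1 *s u + 0 *s w) e"
    interpret lp: comm_ring_hom ?lp by (rule line_poly_hom)
    have evP: "map_poly (\<lambda>q. poly (poly q [:0:]) 1) P = ?lp p"
      using ev[of 0 1 p] L(2) by (simp add: p_def)
    have evQ: "map_poly (\<lambda>q. poly (poly q [:0:]) 1) Q1 = ?lp (from_poly L Q1)"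
      using ev[of 0 1 "from_poly L Q1"] L(2) by simp
    have eq: "?lp G = ?lp p * ?lp (from_poly L Q1)" by (subst Gp) (rule lp.hom_mult)
    have dl: "degree (?lp G) = d" by (rule degree_line_poly[OF G e(1)])
    have nz: "?lp p \<noteq> 0" "?lp (from_poly L Q1) \<noteq> 0" using dl \<open>d > 0\<close> unfolding eq by auto
    have "P \<noteq> 0" "Q1 \<noteq> 0" using dG \<open>d > 0\<close> unfolding Q by auto
    then have "degree P + degree Q1 = d" using degree_mult_eq[of P Q1] dG unfolding Q by simp
    moreover have "degree (?lp p) + degree (?lp (from_poly L Q1)) = d"
      using degree_mult_eq[OF nz] dl unfolding eq by simp
    moreover have "degree (?lp (from_poly L Q1)) \<le> degree Q1" unfolding evQ[symmetric] by (rule degree_map_poly_le)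
    ultimately have "degree (?lp p) > 0" using dP by linarith
    from complex_poly_has_root[OF this] obtain z where "poly (?lp p) z = 0" by (elim exE)
    then have pv: "evalp p (1 *s u + 0 *s w + z *s e) = 0" unfolding poly_line_poly .
    let ?v = "1 *s u + 0 *s w + z *s e"
    have v0: "?v \<noteq> 0" using frame_point_nonzero(1)[OF T, of 0 z] by simp
    interpret evh: comm_ring_hom "\<lambda>F. evalp F ?v" by (rule evalp_hom)
    have zG: "evalp G ?v = 0" by (subst Gp) (simp only: evh.hom_mult pv mult_zero_left)
    have zH: "evalp H ?v = 0" by (subst Hp) (simp only: evh.hom_mult pv mult_zero_left)
    have gG: "gradient G ?v = evalp (from_poly L Q1) ?v *s gradient p ?v"
      by (subst Gp) (simp only: gradient_mult pv, simp)
    have gH: "gradient H ?v = evalp (from_poly L Q2) ?v *s gradient p ?v"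
      by (subst Hp) (simp only: gradient_mult pv, simp)
    have "evalp (from_poly L Q2) ?v *s gradient G ?v + (- evalp (from_poly L Q1) ?v) *s gradient H ?v = 0"
      unfolding gG gH by (simp add: Finite_Cartesian_Product.vec_eq_iff)
    from meet_transversally_gradients(2)[OF tr v0 zG zH this]
    have "evalp (from_poly L Q1) ?v = 0" by simp
    then have "1 *s gradient G ?v + 0 *s gradient H ?v = 0" unfolding gG by simp
    from meet_transversally_gradients(1)[OF tr v0 zG zH this] show False by simp
  qed
  moreover have "poly (poly (resultant (to_poly B G) (to_poly B H)) [:t:]) s = fam.R (s *s u + t *s w)" for s t
    using comm_ring_hom.resultant_map_poly[OF poly2_hom[of t s], of "to_poly B G" "to_poly B H"] unfolding ev fam.R_def
    by (simp add: dG dH degree_line_poly[OF G e(1)] degree_line_poly[OF H e(2)])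
  ultimately have "fam.resP u w \<noteq> 0" by (rule fam.resP_nonzero)
  then show ?thesis unfolding fam.resP_def .
qed

lemma euler_relation:
  assumes "homogeneous d F" "evalp F v = 0"
  shows "(\<Sum>i\<in>UNIV. gradient F v $ i * v $ i) = 0"
proof -
  have "line_poly F v v = 0"
  proof (rule line_poly_eq_0)
    fix t
    have "v + t *s v = (1 + t) *s v" by (simp add: Finite_Cartesian_Product.vec_eq_iff algebra_simps)
    then show "evalp F (v + t *s v) = 0" by (simp only: evalp_homogeneous[OF assms(1)] assms(2) mult_zero_right)
  qed
  then show ?thesis using coeff_1_line_poly[of F v v] by simp
qed

text \<open>
  By the Euler relation both gradients are orthogonal to \<open>v\<close>. If the Jacobian with respect to \<open>w\<close> and \<open>e\<close>
  vanished, some combination of the gradients would be orthogonal to \<open>w\<close> and \<open>e\<close> as well, hence zero.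
\<close>

lemma transversal_simple_zero:
  assumes G: "homogeneous d G" and H: "homogeneous d H" and d: "d > 0" and tr: "meet_transversally G H"
    and T: "triple v w e \<noteq> 0" and e: "evalp G e \<noteq> 0" "evalp H e \<noteq> 0"
    and z: "evalp G v = 0" "evalp H v = 0"
    and uniq: "\<And>z. evalp G (v + z *s e) = 0 \<Longrightarrow> evalp H (v + z *s e) = 0 \<Longrightarrow> z = 0"
  shows "\<not> [:0, 1:] ^ 2 dvd resultant (plane_poly G v w e) (plane_poly H v w e)"
proof -
  have v0: "v \<noteq> 0" using T by (auto simp: triple_def)
  have c0: "coeff (plane_poly F v w e) 0 = line_poly F v w" for F
  proof -
    have "coeff (plane_poly F v w e) 0 = poly (plane_poly F v w e) 0" by (simp add: poly_0_coeff_0)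
    also have "\<dots> = line_poly F v w"
      unfolding plane_poly_def line_poly_def by (subst hom_insertion[OF poly_hom]) simp
    finally show ?thesis .
  qed
  have m0: "map_poly (\<lambda>p. poly p 0) (plane_poly F v w e) = line_poly F v e" for F
    unfolding map_plane_poly by simp
  have c1: "coeff (coeff (plane_poly F v w e) 1) 0 = coeff (line_poly F v e) 1" for F
    unfolding m0[symmetric] by (simp add: coeff_map_poly poly_0_coeff_0)
  let ?D = "\<lambda>F y. \<Sum>i\<in>UNIV. gradient F v $ i * y $ i"
  have jac: "?D G w * ?D H e \<noteq> ?D G e * ?D H w"
  proof
    assume J: "?D G w * ?D H e = ?D G e * ?D H w"
    have "\<exists>a b. (a \<noteq> 0 \<or> b \<noteq> 0) \<and> a * ?D G w + b * ?D H w = 0 \<and> a * ?D G e + b * ?D H e = 0"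
    proof (cases "?D H e = 0 \<and> ?D G e = 0")
      case True
      show ?thesis
      proof (cases "?D H w = 0 \<and> ?D G w = 0")
        case t: True
        show ?thesis by (rule exI[of _ 1], rule exI[of _ 0]) (simp add: True t)
      next
        case False
        then show ?thesis using True by (intro exI[of _ "?D H w"] exI[of _ "- ?D G w"]) auto
      qed
    next
      case False
      then show ?thesis using J by (intro exI[of _ "?D H e"] exI[of _ "- ?D G e"]) (auto simp: mult.commute)
    qed
    then obtain a b where ab: "a \<noteq> 0 \<or> b \<noteq> 0" "a * ?D G w + b * ?D H w = 0" "a * ?D G e + b * ?D H e = 0"
      by (elim exE conjE)
    define g where "g = a *s gradient G v + b *s gradient H v"
    have lin: "(\<Sum>i\<in>UNIV. g $ i * y $ i) = a * ?D G y + b * ?D H y" for y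
      unfolding g_def by (simp add: ring_distribs sum.distrib sum_distrib_left mult.assoc)
    have "(\<Sum>i\<in>UNIV. g $ i * v $ i) = 0"
      using lin[of v] by (simp add: euler_relation[OF G z(1)] euler_relation[OF H z(2)])
    moreover have "(\<Sum>i\<in>UNIV. g $ i * w $ i) = 0" using lin[of w] ab(2) by simp
    moreover have "(\<Sum>i\<in>UNIV. g $ i * e $ i) = 0" using lin[of e] ab(3) by simp
    ultimately have "g = 0" by (rule orthogonal_to_frame[OF T])
    then have g0: "a *s gradient G v + b *s gradient H v = 0" by (simp only: g_def)
    show False using meet_transversally_gradients[OF tr v0 z g0] ab(1) by simp
  qed
  show ?thesis
  proof (rule resultant_simple_zero)
    show "degree (map_poly (\<lambda>p. poly p x) (plane_poly G v w e)) = degree (plane_poly G v w e)" for x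
      unfolding map_plane_poly by (simp add: degree_line_poly[OF G e(1)] degree_plane_poly[OF G e(1)])
    show "degree (map_poly (\<lambda>p. poly p x) (plane_poly H v w e)) = degree (plane_poly H v w e)" for x
      unfolding map_plane_poly by (simp add: degree_line_poly[OF H e(2)] degree_plane_poly[OF H e(2)])
    show "degree (plane_poly G v w e) > 0" "degree (plane_poly H v w e) > 0"
      using d by (simp_all add: degree_plane_poly[OF G e(1)] degree_plane_poly[OF H e(2)])
    show "coeff (coeff (plane_poly G v w e) 0) 0 = 0" "coeff (coeff (plane_poly H v w e) 0) 0 = 0"
      by (simp_all add: c0 coeff_0_line_poly z)
    show "coeff (coeff (plane_poly G v w e) 0) 1 * coeff (coeff (plane_poly H v w e) 1) 0 \<noteq>
        coeff (coeff (plane_poly G v w e) 1) 0 * coeff (coeff (plane_poly H v w e) 0) 1"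
      unfolding c0 c1 coeff_1_line_poly by (rule jac)
    fix y assume "poly (map_poly (\<lambda>p. poly p 0) (plane_poly G v w e)) y = 0"
      "poly (map_poly (\<lambda>p. poly p 0) (plane_poly H v w e)) y = 0"
    then show "y = 0" unfolding m0 poly_line_poly by (rule uniq)
  qed
qed

section \<open>Bezout's theorem for transversal intersections\<close>

lemma proj_point_scale:
  assumes "c \<noteq> 0"
  shows "proj_point (c *s v) = proj_point v"
proof (rule equalityI; rule subsetI)
  fix w assume "w \<in> proj_point (c *s v)"
  then obtain a where a: "a \<noteq> 0" "w = a *s (c *s v)" unfolding proj_point_def by blast
  have "w = (a * c) *s v" unfolding a(2) by (simp add: Finite_Cartesian_Product.vec_eq_iff)
  moreover have "a * c \<noteq> 0" using a(1) assms by simp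
  ultimately show "w \<in> proj_point v" unfolding proj_point_def by blast
next
  fix w assume "w \<in> proj_point v"
  then obtain a where a: "a \<noteq> 0" "w = a *s v" unfolding proj_point_def by blast
  have "w = (a / c) *s (c *s v)" unfolding a(2) using assms by (simp add: Finite_Cartesian_Product.vec_eq_iff)
  moreover have "a / c \<noteq> 0" using a(1) assms by simp
  ultimately show "w \<in> proj_point (c *s v)" unfolding proj_point_def by blast
qed

lemma in_proj_point: "v \<in> proj_point v"
  unfolding proj_point_def by (auto intro: exI[of _ 1])

lemma proj_pointE:
  assumes "w \<in> proj_point v"
  shows "\<exists>c. c \<noteq> 0 \<and> w = c *s v"
  using assms unfolding proj_point_def by blast

lemma proj_point_in_curve_iff:
  assumes "homogeneous k F" "v \<noteq> 0"
  shows "proj_point v \<in> curve_points F \<longleftrightarrow> evalp F v = 0"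
proof
  assume "proj_point v \<in> curve_points F"
  then show "evalp F v = 0" unfolding curve_points_def using in_proj_point by blast
next
  assume z: "evalp F v = 0"
  have "evalp F w = 0" if w: "w \<in> proj_point v" for w
  proof -
    obtain c where "w = c *s v" using proj_pointE[OF w] by (elim exE conjE)
    then show ?thesis by (simp only: evalp_homogeneous[OF assms(1)] z mult_zero_right)
  qed
  then show "proj_point v \<in> curve_points F"
    unfolding curve_points_def proj_plane_def using assms(2) by auto
qed

definition coord_vector :: "(complex ^ 3) set \<Rightarrow> complex ^ 3" where
  "coord_vector p = (SOME v. v \<in> p)"

lemma coord_vector:
  assumes "p \<in> proj_plane"
  shows "coord_vector p \<noteq> 0" "proj_point (coord_vector p) = p"
proof -
  obtain v where v: "v \<noteq> 0" "p = proj_point v" using assms unfolding proj_plane_def by auto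
  have "coord_vector p \<in> proj_point v"
    unfolding coord_vector_def v(2) by (rule someI[where P = "\<lambda>w. w \<in> proj_point v", OF in_proj_point])
  from proj_pointE[OF this] obtain c where c: "c \<noteq> 0" "coord_vector p = c *s v" by (elim exE conjE)
  show "coord_vector p \<noteq> 0" using c v(1) by (auto simp: Finite_Cartesian_Product.vec_eq_iff)
  have "proj_point (coord_vector p) = proj_point v" unfolding c(2) by (rule proj_point_scale[OF c(1)])
  then show "proj_point (coord_vector p) = p" by (simp only: v(2)[symmetric])
qed

lemma coord_vectors_independent:
  assumes "Z \<subseteq> proj_plane" "v \<in> coord_vector ` Z" "v' \<in> coord_vector ` Z" "v \<noteq> v'"
  shows "v \<noteq> c *s v'"
proof
  assume eq: "v = c *s v'"
  obtain p where p: "p \<in> Z" "v = coord_vector p" using assms(2) by (elim imageE)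
  obtain q where q: "q \<in> Z" "v' = coord_vector q" using assms(3) by (elim imageE)
  have "v \<noteq> 0" unfolding p(2) by (rule coord_vector(1)) (use assms(1) p(1) in auto)
  then have "c \<noteq> 0" using eq by auto
  then have "proj_point v = proj_point v'" unfolding eq by (rule proj_point_scale)
  moreover have "proj_point v = p" unfolding p(2) by (rule coord_vector(2)) (use assms(1) p(1) in auto)
  moreover have "proj_point v' = q" unfolding q(2) by (rule coord_vector(2)) (use assms(1) q(1) in auto)
  ultimately show False using assms(4) p(2) q(2) by simp
qed

lemma curve_points_subset: "curve_points F \<subseteq> proj_plane"
  by (auto simp: curve_points_def)

text \<open>
  In the chart \<open>u + x w + z e\<close> the abscissas of common points are zeros of the resultant, and each line
  through \<open>e\<close> contains finitely many points of the first curve. The remaining points lie on the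
  line through \<open>w\<close> and \<open>e\<close>.
\<close>

lemma transversal_intersection_finite:
  assumes G: "homogeneous d G" and H: "homogeneous d H" and d: "d > 0" and tr: "meet_transversally G H"
  shows "finite (curve_points G \<inter> curve_points H)"
proof -
  have nz: "G \<noteq> 0" "H \<noteq> 0"
    using meet_transversally_nonzero[OF tr H d] meet_transversally_nonzero[OF meet_transversally_sym[OF tr] G d] by auto
  obtain e where e: "evalp G e \<noteq> 0" "evalp H e \<noteq> 0" using ex_evalp_nonzero[of "{G, H}"] nz by auto
  have e0: "e \<noteq> 0" using evalp_at_0[OF G d] e(1) by auto
  obtain u w where T: "triple u w e \<noteq> 0" using frame_exists[OF e0] by (elim exE)
  interpret fam: resultant_family "\<lambda>v. line_poly G v e" "\<lambda>v. line_poly H v e" "\<lambda>u w. plane_poly G u w e"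
    "\<lambda>u w. plane_poly H u w e" d d "evalp G e" "evalp H e" e
    by (rule forms_resultant_family[OF G H e])
  have r0: "fam.resP u w \<noteq> 0" unfolding fam.resP_def by (rule transversal_resultant_nonzero[OF G H d tr T e])
  let ?Rt = "{x. poly (fam.resP u w) x = 0}"
  let ?Z = "\<lambda>v. {z. poly (line_poly G v e) z = 0}"
  have fZ: "finite (?Z v)" for v by (rule poly_roots_finite[OF fam.nz(1)])
  let ?A = "(\<lambda>(x, z). proj_point (u + x *s w + z *s e)) ` (SIGMA x:?Rt. ?Z (u + x *s w))"
  let ?B = "(\<lambda>z. proj_point (w + z *s e)) ` ?Z w"
  have "curve_points G \<inter> curve_points H \<subseteq> ?A \<union> ?B"
  proof
    fix p assume p: "p \<in> curve_points G \<inter> curve_points H"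
    then have pp: "p \<in> proj_plane" using curve_points_subset by blast
    define v where "v = coord_vector p"
    have v: "v \<noteq> 0" "proj_point v = p" unfolding v_def by (rule coord_vector[OF pp])+
    have z: "evalp G v = 0" "evalp H v = 0"
      using p proj_point_in_curve_iff[OF G v(1)] proj_point_in_curve_iff[OF H v(1)] unfolding v(2) by auto
    obtain a b c where abc: "v = a *s u + b *s w + c *s e" using cramer3[OF T, of v] by (elim exE)
    have zero: "evalp F y = 0" if "homogeneous d F" "evalp F v = 0" "v = k *s y" "k \<noteq> 0" for F y k
      using that evalp_homogeneous[OF that(1), of k y] by simp
    show "p \<in> ?A \<union> ?B"
    proof (cases "a = 0")
      case False
      have vy: "v = a *s (u + (b / a) *s w + (c / a) *s e)"
        unfolding abc using False by (simp add: Finite_Cartesian_Product.vec_eq_iff algebra_simps)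
      have 1: "poly (line_poly G (u + (b / a) *s w) e) (c / a) = 0" "poly (line_poly H (u + (b / a) *s w) e) (c / a) = 0"
        unfolding poly_line_poly by (rule zero[OF G z(1) vy False], rule zero[OF H z(2) vy False])
      then have "fam.R (u + (b / a) *s w) = 0" unfolding fam.R_eq_0_iff by (intro exI conjI)
      then have "poly (fam.resP u w) (b / a) = 0" unfolding fam.poly_resP .
      moreover have "p = proj_point (u + (b / a) *s w + (c / a) *s e)"
        unfolding v(2)[symmetric] by (subst vy) (rule proj_point_scale[OF False])
      ultimately show ?thesis using 1(1) by (intro UnI1 image_eqI[of _ _ "(b / a, c / a)"]) auto
    next
      case True
      have "b \<noteq> 0"
      proof
        assume b: "b = 0"
        have vc: "v = c *s e" unfolding abc True b by (simp add: Finite_Cartesian_Product.vec_eq_iff)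
        have "c \<noteq> 0" using v(1) vc by auto
        then show False using zero[OF G z(1) vc] e(1) by simp
      qed
      have vy: "v = b *s (w + (c / b) *s e)"
        unfolding abc True using \<open>b \<noteq> 0\<close> by (simp add: Finite_Cartesian_Product.vec_eq_iff algebra_simps)
      have 1: "poly (line_poly G w e) (c / b) = 0"
        unfolding poly_line_poly by (rule zero[OF G z(1) vy \<open>b \<noteq> 0\<close>])
      moreover have "p = proj_point (w + (c / b) *s e)"
        unfolding v(2)[symmetric] by (subst vy) (rule proj_point_scale[OF \<open>b \<noteq> 0\<close>])
      ultimately show ?thesis by (intro UnI2 image_eqI[of _ _ "c / b"]) auto
    qed
  qed
  moreover have "finite (?A \<union> ?B)"
    by (intro finite_UnI finite_imageI finite_SigmaI fZ poly_roots_finite[OF r0])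
  ultimately show ?thesis by (rule finite_subset)
qed

text \<open>
  Finiteness of the intersection makes general position applicable to the common points. Then no
  common point lies on the line through \<open>w\<close> and \<open>e\<close>, so the resultant has full degree \<open>d * d\<close>; it has the
  abscissas as its zeros, and all of them are simple.
\<close>

theorem transversal_intersection_card:
  assumes G: "homogeneous d G" and H: "homogeneous d H" and d: "d > 0" and tr: "meet_transversally G H"
  shows "card (curve_points G \<inter> curve_points H) = d ^ 2"
proof -
  let ?Z = "curve_points G \<inter> curve_points H"
  have nz: "G \<noteq> 0" "H \<noteq> 0"
    using meet_transversally_nonzero[OF tr H d] meet_transversally_nonzero[OF meet_transversally_sym[OF tr] G d] by auto
  have fin: "finite ?Z" by (rule transversal_intersection_finite[OF assms])
  have sub: "?Z \<subseteq> proj_plane" using curve_points_subset by blast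
  have cv: "coord_vector p \<noteq> 0" "proj_point (coord_vector p) = p" "evalp G (coord_vector p) = 0" "evalp H (coord_vector p) = 0"
    if p: "p \<in> ?Z" for p
  proof -
    have pp: "p \<in> proj_plane" using p sub by blast
    show n: "coord_vector p \<noteq> 0" "proj_point (coord_vector p) = p" by (rule coord_vector[OF pp])+
    show "evalp G (coord_vector p) = 0" "evalp H (coord_vector p) = 0"
      using p proj_point_in_curve_iff[OF G n(1)] proj_point_in_curve_iff[OF H n(1)] unfolding n(2) by auto
  qed
  obtain v0 where v0: "v0 \<noteq> 0" "evalp G v0 = 0" using form_has_zero[OF G d nz(1)] by (elim exE conjE)
  \<comment> \<open>General position needs a point; for an empty intersection a point of the first curve serves as such.\<close>
  define V where "V = (if ?Z = {} then {v0} else coord_vector ` ?Z)"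
  have VZ: "coord_vector p \<in> V" if "p \<in> ?Z" for p using that by (auto simp: V_def)
  have V0: "v \<noteq> 0 \<and> evalp G v = 0" if "v \<in> V" for v
    using that v0 cv(1,3) by (auto simp: V_def split: if_splits)
  have "\<exists>u w e. triple u w e \<noteq> 0 \<and> (\<forall>F\<in>{G, H}. evalp F e \<noteq> 0) \<and>
    (\<forall>v\<in>V. \<exists>a x z. a \<noteq> 0 \<and> v = a *s (u + x *s w + z *s e)) \<and>
    (\<forall>v\<in>V. \<forall>v'\<in>V. \<forall>a x z a' z'. v = a *s (u + x *s w + z *s e) \<longrightarrow>
      v' = a' *s (u + x *s w + z' *s e) \<longrightarrow> v = v')"
  proof (rule general_position)
    show "finite V" "V \<noteq> {}" using fin by (auto simp: V_def)
    show "0 \<notin> V" using V0 by blast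
    show "finite {G, H}" "0 \<notin> {G, H}" using nz by auto
    show "\<exists>F\<in>{G, H}. \<exists>k. homogeneous k F \<and> evalp F v = 0" if "v \<in> V" for v using G V0[OF that] by blast
    show "v \<noteq> c *s v'" if "v \<in> V" "v' \<in> V" "v \<noteq> v'" for v v' c
    proof (cases "?Z = {}")
      case True
      then show ?thesis using that by (simp add: V_def)
    next
      case False
      then have "V = coord_vector ` ?Z" by (simp add: V_def)
      then show ?thesis using coord_vectors_independent[OF sub _ _ that(3)] that(1,2) by simp
    qed
  qed
  then obtain u w e where T: "triple u w e \<noteq> 0" and e': "\<forall>F\<in>{G, H}. evalp F e \<noteq> 0"
    and rep: "\<forall>v\<in>V. \<exists>a x z. a \<noteq> 0 \<and> v = a *s (u + x *s w + z *s e)"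
    and inj: "\<forall>v\<in>V. \<forall>v'\<in>V. \<forall>a x z a' z'. v = a *s (u + x *s w + z *s e) \<longrightarrow>
      v' = a' *s (u + x *s w + z' *s e) \<longrightarrow> v = v'" by (elim exE conjE)
  from e' have e: "evalp G e \<noteq> 0" "evalp H e \<noteq> 0" by simp_all
  interpret fam: resultant_family "\<lambda>v. line_poly G v e" "\<lambda>v. line_poly H v e" "\<lambda>u w. plane_poly G u w e"
    "\<lambda>u w. plane_poly H u w e" d d "evalp G e" "evalp H e" e
    by (rule forms_resultant_family[OF G H e])
  let ?r = "fam.resP u w"
  have r0: "?r \<noteq> 0" unfolding fam.resP_def by (rule transversal_resultant_nonzero[OF G H d tr T e])
  have point: "\<exists>p\<in>?Z. \<exists>c. c \<noteq> 0 \<and> coord_vector p = c *s y" if y: "y \<noteq> 0" "evalp G y = 0" "evalp H y = 0" for y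
  proof -
    have pZ: "proj_point y \<in> ?Z"
      using proj_point_in_curve_iff[OF G y(1)] proj_point_in_curve_iff[OF H y(1)] y(2,3) by blast
    have "coord_vector (proj_point y) \<in> proj_point y" using in_proj_point[of "coord_vector (proj_point y)"] cv(2)[OF pZ] by simp
    from proj_pointE[OF this] show ?thesis using pZ by blast
  qed
  have affine: "a \<noteq> 0 \<and> x = x' \<and> z = z'"
    if "c *s (u + x *s w + z *s e) = a *s (u + x' *s w + z' *s e)" "c \<noteq> 0" for a c x x' z z'
  proof -
    have "c *s u + (c * x) *s w + (c * z) *s e = a *s u + (a * x') *s w + (a * z') *s e"
      using that(1) by (simp add: Finite_Cartesian_Product.vec_eq_iff algebra_simps)
    from coordinates_unique[OF T this] show ?thesis using that(2) by auto
  qed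
  \<comment> \<open>A common point on the line through \<open>w\<close> and \<open>e\<close> would be outside of the chart.\<close>
  have "fam.R w \<noteq> 0"
  proof
    assume "fam.R w = 0"
    then obtain z where "poly (line_poly G w e) z = 0" "poly (line_poly H w e) z = 0"
      unfolding fam.R_eq_0_iff by (elim exE conjE)
    then have "evalp G (w + z *s e) = 0" "evalp H (w + z *s e) = 0" unfolding poly_line_poly .
    from point[OF frame_point_nonzero(2)[OF T] this] obtain p c where p: "p \<in> ?Z" "c \<noteq> 0" "coord_vector p = c *s (w + z *s e)"
      by (elim bexE exE conjE)
    from bspec[OF rep VZ[OF p(1)]] obtain a x z' where a: "a \<noteq> 0" "coord_vector p = a *s (u + x *s w + z' *s e)" by blast
    have "0 *s u + c *s w + (c * z) *s e = a *s u + (a * x) *s w + (a * z') *s e"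
      using a(2) unfolding p(3) by (simp add: Finite_Cartesian_Product.vec_eq_iff algebra_simps)
    from coordinates_unique[OF T this] show False using a(1) by simp
  qed
  then have "coeff ?r (d * d) \<noteq> 0" using fam.degree_resP[of u w] by simp
  then have "d * d \<le> degree ?r" by (rule le_degree)
  then have deg: "degree ?r = d * d" using fam.degree_resP[of u w] by simp
  have "\<forall>p\<in>?Z. \<exists>x. \<exists>a z. a \<noteq> 0 \<and> coord_vector p = a *s (u + x *s w + z *s e)"
  proof (rule ballI)
    fix p assume "p \<in> ?Z"
    from bspec[OF rep VZ[OF this]] show "\<exists>x. \<exists>a z. a \<noteq> 0 \<and> coord_vector p = a *s (u + x *s w + z *s e)" by blast
  qed
  from bchoice[OF this] obtain x where x: "\<forall>p\<in>?Z. \<exists>a z. a \<noteq> 0 \<and> coord_vector p = a *s (u + x p *s w + z *s e)"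
    by (elim exE)
  have "bij_betw x ?Z {y. poly ?r y = 0}"
  proof (rule bij_betw_imageI)
    show "inj_on x ?Z"
    proof (rule inj_onI)
      fix p q assume p: "p \<in> ?Z" and q: "q \<in> ?Z" and pq: "x p = x q"
      obtain a z where a: "coord_vector p = a *s (u + x p *s w + z *s e)" using bspec[OF x p] by blast
      obtain a' z' where a': "coord_vector q = a' *s (u + x p *s w + z' *s e)" unfolding pq using bspec[OF x q] by blast
      have "coord_vector p = coord_vector q" by (rule inj[rule_format, OF VZ[OF p] VZ[OF q] a a'])
      then have "proj_point (coord_vector p) = proj_point (coord_vector q)" by (rule arg_cong)
      then show "p = q" unfolding cv(2)[OF p] cv(2)[OF q] .
    qed
    show "x ` ?Z = {y. poly ?r y = 0}"
    proof (rule Set.set_eqI, rule iffI)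
      fix y assume "y \<in> x ` ?Z"
      then obtain p where p: "p \<in> ?Z" "y = x p" by (elim imageE)
      obtain a z where a: "a \<noteq> 0" "coord_vector p = a *s (u + y *s w + z *s e)" unfolding p(2) using bspec[OF x p(1)] by blast
      have "evalp G (u + y *s w + z *s e) = 0" using cv(3)[OF p(1)] a(1) unfolding a(2) evalp_homogeneous[OF G] by simp
      moreover have "evalp H (u + y *s w + z *s e) = 0" using cv(4)[OF p(1)] a(1) unfolding a(2) evalp_homogeneous[OF H] by simp
      ultimately have "fam.R (u + y *s w) = 0" unfolding fam.R_eq_0_iff poly_line_poly by (intro exI conjI)
      then show "y \<in> {y. poly ?r y = 0}" by (simp add: fam.poly_resP)
    next
      fix y assume "y \<in> {y. poly ?r y = 0}"
      then have "fam.R (u + y *s w) = 0" by (simp add: fam.poly_resP)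
      then obtain z where z: "evalp G (u + y *s w + z *s e) = 0" "evalp H (u + y *s w + z *s e) = 0"
        unfolding fam.R_eq_0_iff poly_line_poly by (elim exE conjE)
      from point[OF frame_point_nonzero(1)[OF T] z] obtain p c where p: "p \<in> ?Z" "c \<noteq> 0" "coord_vector p = c *s (u + y *s w + z *s e)"
        by (elim bexE exE conjE)
      obtain a z' where a: "coord_vector p = a *s (u + x p *s w + z' *s e)" using bspec[OF x p(1)] by blast
      from affine[OF a[unfolded p(3)] p(2)] have "y = x p" by simp
      then show "y \<in> x ` ?Z" using p(1) by blast
    qed
  qed
  then have "card ?Z = card {y. poly ?r y = 0}" by (rule bij_betw_same_card)
  also have "\<dots> = degree ?r"
  proof -
    have simple: "order y ?r \<le> 1" if y: "poly ?r y = 0" for y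
    proof (rule ccontr)
      assume "\<not> order y ?r \<le> 1"
      then have "[:- y, 1:] ^ 2 dvd ?r" using r0 by (simp only: order_divides) simp
      have "fam.R (u + y *s w) = 0" using y by (simp add: fam.poly_resP)
      then obtain z where z: "evalp G (u + y *s w + z *s e) = 0" "evalp H (u + y *s w + z *s e) = 0"
        unfolding fam.R_eq_0_iff poly_line_poly by (elim exE conjE)
      let ?v = "u + y *s w + z *s e"
      have "[:0, 1:] ^ 2 dvd fam.resP ?v w" using \<open>[:- y, 1:] ^ 2 dvd ?r\<close> by (simp only: fam.power_dvd_resP_shift)
      moreover have "\<not> [:0, 1:] ^ 2 dvd resultant (plane_poly G ?v w e) (plane_poly H ?v w e)"
      proof (rule transversal_simple_zero[OF G H d tr _ e z])
        show "triple ?v w e \<noteq> 0" using triple_linear1[of 1 u y w z e] T by simp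
        fix t assume t: "evalp G (?v + t *s e) = 0" "evalp H (?v + t *s e) = 0"
        have eq: "?v + t *s e = u + y *s w + (z + t) *s e" by (simp add: Finite_Cartesian_Product.vec_eq_iff algebra_simps)
        from point[OF frame_point_nonzero(1)[OF T] z] obtain p c where p: "p \<in> ?Z" "c \<noteq> 0" "coord_vector p = c *s ?v"
          by (elim bexE exE conjE)
        from point[OF frame_point_nonzero(1)[OF T] t[unfolded eq]] obtain q b
          where q: "q \<in> ?Z" "b \<noteq> 0" "coord_vector q = b *s (u + y *s w + (z + t) *s e)"
          by (elim bexE exE conjE)
        have "coord_vector p = coord_vector q" by (rule inj[rule_format, OF VZ[OF p(1)] VZ[OF q(1)] p(3) q(3)])
        then have "c *s ?v = b *s (u + y *s w + (z + t) *s e)" using p(3) q(3) by simp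
        from affine[OF this p(2)] show "t = 0" by simp
      qed
      ultimately show False unfolding fam.resP_def by blast
    qed
    have one: "count (proots ?r) y = 1" if y: "y \<in> set_mset (proots ?r)" for y
    proof -
      have root: "poly ?r y = 0" using y r0 by simp
      then have "order y ?r \<noteq> 0" using order_root[of ?r y] r0 by simp
      then have "order y ?r = 1" using simple[OF root] by linarith
      then show ?thesis using r0 by simp
    qed
    have "degree ?r = size (proots ?r)" by (rule size_proots_complex[symmetric])
    also have "\<dots> = (\<Sum>y\<in>set_mset (proots ?r). count (proots ?r) y)" by (rule size_multiset_overloaded_eq)
    also have "\<dots> = (\<Sum>y\<in>set_mset (proots ?r). 1)" by (rule sum.cong[OF refl one])
    also have "\<dots> = card {y. poly ?r y = 0}" using r0 by simp
    finally show ?thesis by (rule sym)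
  qed
  finally show ?thesis unfolding deg by (simp add: power2_eq_square)
qed

section \<open>The self-intersection number\<close>

lemma gradient_power: "gradient (F ^ n) v = (of_nat n * evalp F v ^ (n - 1)) *s gradient F v"
proof (induction n)
  case 0
  interpret comm_ring_hom "\<lambda>F. line_poly F v y" for y by (rule line_poly_hom)
  show ?case by (simp add: Finite_Cartesian_Product.vec_eq_iff gradient_nth)
next
  case (Suc n)
  interpret ev: comm_ring_hom "\<lambda>F. evalp F v" by (rule evalp_hom)
  have "evalp F v * (of_nat n * evalp F v ^ (n - 1)) = of_nat n * evalp F v ^ n" by (cases n) simp_all
  then show ?case
    unfolding power_Suc gradient_mult Suc
    by (simp add: Finite_Cartesian_Product.vec_eq_iff ev.hom_power ring_distribs mult.assoc[symmetric])
qed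

lemma gradient_var: "gradient (var j) v = axis j 1"
proof -
  have "line_poly (var j) v y = [:v $ j, y $ j:]" for y
    unfolding line_poly_def by (rule insertion_var) (standard, simp_all add: pCons_one)
  then show ?thesis by (simp add: Finite_Cartesian_Product.vec_eq_iff gradient_nth axis_def)
qed

lemma gradient_diff: "gradient (F - G) v = gradient F v - gradient G v"
proof -
  interpret ring_hom "\<lambda>F. line_poly F v y" for y
    using line_poly_hom[of v y] by (simp add: comm_ring_hom_def)
  show ?thesis by (simp add: Finite_Cartesian_Product.vec_eq_iff gradient_nth hom_minus)
qed

text \<open>
  The curves \<open>x\<^sub>1\<^sup>d = x\<^sub>3\<^sup>d\<close> and \<open>x\<^sub>2\<^sup>d = x\<^sub>3\<^sup>d\<close> are unions of lines through two different points, and all three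
  coordinates are nonzero at their common points.
\<close>

lemma transversal_pair_exists:
  assumes "d > 0"
  shows "\<exists>G H. homogeneous d G \<and> homogeneous d H \<and> meet_transversally G H"
proof -
  define G where "G = var 1 ^ d - var 3 ^ d"
  define H where "H = var 2 ^ d - var 3 ^ d"
  have pw: "homogeneous d (var i ^ d)" for i using homogeneous_power[OF homogeneous_var, of d i] by simp
  have hom: "homogeneous d G" "homogeneous d H"
    unfolding G_def H_def diff_conv_add_uminus by (intro homogeneous_add homogeneous_minus pw)+
  have ev: "evalp G v = v $ 1 ^ d - v $ 3 ^ d" "evalp H v = v $ 2 ^ d - v $ 3 ^ d" for v
  proof -
    interpret ring_hom "\<lambda>F. evalp F v" using evalp_hom[of v] by (simp add: comm_ring_hom_def)
    have "evalp (var i) v = v $ i" for i by (simp add: evalp_def id_hom)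
    then show "evalp G v = v $ 1 ^ d - v $ 3 ^ d" "evalp H v = v $ 2 ^ d - v $ 3 ^ d"
      unfolding G_def H_def hom_minus hom_power by simp_all
  qed
  have gr: "gradient (var i ^ d) v = (of_nat d * v $ i ^ (d - 1)) *s axis i 1" for i v
    unfolding gradient_power gradient_var by (simp add: evalp_def id_hom)
  have "meet_transversally G H"
    unfolding meet_transversally_def
  proof (intro allI impI)
    fix v a b
    assume v: "v \<noteq> 0 \<and> evalp G v = 0 \<and> evalp H v = 0"
      and ab: "a *s gradient G v + b *s gradient H v = 0"
    have eq: "v $ 1 ^ d = v $ 3 ^ d" "v $ 2 ^ d = v $ 3 ^ d" using v by (simp_all add: ev)
    have nz: "v $ 1 \<noteq> 0" "v $ 2 \<noteq> 0"
    proof -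
      have "v $ 3 \<noteq> 0"
      proof
        assume z: "v $ 3 = 0"
        then have "v $ 1 = 0" "v $ 2 = 0" using eq assms by (simp_all add: zero_power)
        then have "v = 0" using z unfolding Finite_Cartesian_Product.vec_eq_iff forall_3 by simp
        then show False using v by simp
      qed
      then show "v $ 1 \<noteq> 0" "v $ 2 \<noteq> 0" using eq assms by (metis power_not_zero zero_power)+
    qed
    have c1: "(a *s gradient G v + b *s gradient H v) $ 1 = a * (of_nat d * v $ 1 ^ (d - 1))"
      by (simp add: G_def H_def gradient_diff gr axis_def)
    have c2: "(a *s gradient G v + b *s gradient H v) $ 2 = b * (of_nat d * v $ 2 ^ (d - 1))"
      by (simp add: G_def H_def gradient_diff gr axis_def)
    show "a = 0 \<and> b = 0"
      using c1 c2 nz assms unfolding ab by simp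
  qed
  then show ?thesis using hom by blast
qed

text \<open>
  The example of a transversal pair makes the number unique: without it every number would satisfy
  the defining condition.
\<close>

theorem self_intersection_eq:
  assumes F: "homogeneous d F" "F \<noteq> 0" and d: "d > 0"
  shows "self_intersection F = d ^ 2"
proof -
  have k: "k = d" if "homogeneous k F" for k
  proof -
    obtain m where "m \<in> Poly_Mapping.keys F" using F(2) by (metis all_not_in_conv keys_eq_empty)
    then show ?thesis using that F(1) unfolding homogeneous_def by auto
  qed
  obtain G H where GH: "homogeneous d G" "homogeneous d H" "meet_transversally G H"
    using transversal_pair_exists[OF d] by (elim exE conjE)
  show ?thesis
    unfolding self_intersection_def
  proof (rule the_equality)
    show "\<forall>k G H. homogeneous k F \<and> homogeneous k G \<and> homogeneous k H \<and> meet_transversally G H \<longrightarrow>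
        card (curve_points G \<inter> curve_points H) = d ^ 2"
    proof (intro allI impI)
      fix k G H assume h: "homogeneous k F \<and> homogeneous k G \<and> homogeneous k H \<and> meet_transversally G H"
      then have "k = d" using k by simp
      then show "card (curve_points G \<inter> curve_points H) = d ^ 2"
        using transversal_intersection_card[of d G H] h d by simp
    qed
    fix n assume "\<forall>k G H. homogeneous k F \<and> homogeneous k G \<and> homogeneous k H \<and> meet_transversally G H \<longrightarrow>
        card (curve_points G \<inter> curve_points H) = n"
    then have "card (curve_points G \<inter> curve_points H) = n" using F(1) GH by simp
    then show "n = d ^ 2" using transversal_intersection_card[OF GH(1,2) d GH(3)] by simp
  qed
qed

section \<open>Multiplicity and the order of vanishing along lines\<close>

lemma X_power_dvd_insertion:
  assumes "\<And>m. m \<in> Poly_Mapping.keys A \<Longrightarrow> N \<le> mdeg m"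
  shows "[:0, 1:] ^ N dvd insertion (\<lambda>c. [:c:]) (\<lambda>j. [:0, y j:]) A"
  unfolding insertion_def
proof (rule dvd_sum)
  fix m assume "m \<in> Poly_Mapping.keys A"
  then have N: "N \<le> sum (Poly_Mapping.lookup m) UNIV" using assms by (simp add: mdeg_def)
  have "[:0, y j:] = [:0, 1:] * [:y j:]" for j by simp
  then have "(\<Prod>j\<in>UNIV. [:0, y j:] ^ Poly_Mapping.lookup m j) =
      (\<Prod>j\<in>UNIV. [:0, 1:] ^ Poly_Mapping.lookup m j) * (\<Prod>j\<in>UNIV. [:y j:] ^ Poly_Mapping.lookup m j)"
    by (simp only: power_mult_distrib prod.distrib)
  also have "(\<Prod>j\<in>UNIV. [:0, 1 :: complex:] ^ Poly_Mapping.lookup m j) = [:0, 1:] ^ sum (Poly_Mapping.lookup m) UNIV"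
    by (simp only: power_sum)
  finally have "[:0, 1:] ^ sum (Poly_Mapping.lookup m) UNIV dvd (\<Prod>j\<in>UNIV. [:0, y j:] ^ Poly_Mapping.lookup m j)"
    by (rule dvdI)
  then have "[:0, 1:] ^ N dvd (\<Prod>j\<in>UNIV. [:0, y j:] ^ Poly_Mapping.lookup m j)"
    by (rule dvd_trans[OF le_imp_power_dvd[OF N]])
  then show "[:0, 1:] ^ N dvd [:Poly_Mapping.lookup A m:] * (\<Prod>j\<in>UNIV. [:0, y j:] ^ Poly_Mapping.lookup m j)"
    by (rule dvd_mult)
qed

text \<open>
  In directions inside the chart the restriction of \<open>F\<close> to a line is the restriction of the local
  equation to a line through the origin.
\<close>

lemma coeff_line_poly_in_chart:
  assumes "\<And>m. m \<in> Poly_Mapping.keys (local_equation F v i) \<Longrightarrow> N \<le> mdeg m" "y $ i = 0" "n < N"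
  shows "coeff (line_poly F v y) n = 0"
proof -
  have ch: "comm_ring_hom (\<lambda>c::complex. [:c:])" by standard (simp_all add: pCons_one)
  let ?g = "insertion (\<lambda>c. [:c:]) (\<lambda>j. [:0, y $ j:])"
  interpret g: comm_ring_hom ?g by (rule comm_ring_hom_insertion[OF ch])
  have "?g (local_equation F v i) =
      insertion (\<lambda>c. ?g (const c)) (\<lambda>j. ?g (const (v $ j) + (if j = i then 0 else var j))) F"
    unfolding local_equation_def by (rule hom_insertion[OF comm_ring_hom_insertion[OF ch]])
  also have "(\<lambda>c. ?g (const c)) = (\<lambda>c. [:c:])" by (simp add: ch)
  also have "(\<lambda>j. ?g (const (v $ j) + (if j = i then 0 else var j))) = (\<lambda>j. [:v $ j, y $ j:])"
    using assms(2) by (simp add: fun_eq_iff g.hom_add ch)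
  finally have "?g (local_equation F v i) = line_poly F v y" by (simp only: line_poly_def)
  then have "[:0, 1:] ^ N dvd line_poly F v y"
    using X_power_dvd_insertion[of "local_equation F v i" N "($) y"] assms(1) by simp
  then have "monom 1 N dvd line_poly F v y" by (simp add: monom_altdef)
  then show ?thesis using assms(3) by (simp only: monom_1_dvd_iff')
qed

text \<open>
  Write \<open>y = y' + y\<^sub>i v\<close> with \<open>y'\<close> inside the chart. Then \<open>v + t y = s (v + (t / s) y')\<close> with
  \<open>s = 1 + t y\<^sub>i\<close>, and the factor \<open>s\<close> is a unit at \<open>t = 0\<close>. Homogeneity turns this into an expansion
  of \<open>F (v + t y)\<close> whose terms have at least the orders of those of \<open>F (v + t y')\<close>.
\<close>

lemma coeff_line_poly_all_directions:
  assumes F: "homogeneous d F" and v: "v $ i = 1"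
    and chart: "\<And>y n. y $ i = 0 \<Longrightarrow> n < N \<Longrightarrow> coeff (line_poly F v y) n = 0" and n: "n < N"
  shows "coeff (line_poly F v y) n = 0"
proof -
  define y' where "y' = y - (y $ i) *s v"
  have y'i: "y' $ i = 0" by (simp add: y'_def v)
  let ?a = "\<lambda>k. coeff (line_poly F v y') k"
  \<comment> \<open>The factor \<open>[:1, y $ i:]\<close> in the next step covers the one value of \<open>t\<close> where \<open>s\<close> vanishes.\<close>
  let ?S = "\<Sum>k\<le>d. monom (?a k) k * [:1, y $ i:] ^ (d - k)"
  have "poly ([:1, y $ i:] * (line_poly F v y - ?S)) t = 0" for t
  proof (cases "1 + t * y $ i = 0")
    case False
    let ?s = "1 + t * y $ i"
    have "?s *s (v + (t / ?s) *s y') = ?s *s v + t *s y'"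
      using False by (simp add: Finite_Cartesian_Product.vec_eq_iff distrib_left)
    also have "\<dots> = v + t *s y"
      by (simp add: Finite_Cartesian_Product.vec_eq_iff y'_def algebra_simps)
    finally have "v + t *s y = ?s *s (v + (t / ?s) *s y')" ..
    then have "poly (line_poly F v y) t = ?s ^ d * poly (line_poly F v y') (t / ?s)"
      by (simp only: poly_line_poly evalp_homogeneous[OF F])
    also have "poly (line_poly F v y') (t / ?s) = (\<Sum>k\<le>d. ?a k * (t / ?s) ^ k)"
      unfolding poly_altdef
      by (rule sum.mono_neutral_left) (use line_poly_degree(1)[OF F, of v y'] in \<open>auto simp: coeff_eq_0\<close>)
    also have "?s ^ d * \<dots> = (\<Sum>k\<le>d. ?a k * t ^ k * ?s ^ (d - k))"
      unfolding sum_distrib_left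
    proof (rule sum.cong[OF refl])
      fix k assume "k \<in> {..d}"
      then have "?s ^ d = ?s ^ k * ?s ^ (d - k)" by (simp add: power_add[symmetric])
      then show "?s ^ d * (?a k * (t / ?s) ^ k) = ?a k * t ^ k * ?s ^ (d - k)"
        using False by (simp add: power_divide)
    qed
    also have "\<dots> = poly ?S t" by (simp add: poly_sum poly_monom)
    finally show ?thesis by simp
  next
    case True
    then have "poly [:1, y $ i:] t = 0" by simp
    then show ?thesis unfolding poly_mult by (simp only: mult_zero_left)
  qed
  then have "[:1, y $ i:] * (line_poly F v y - ?S) = 0" by (intro iffD1[OF poly_all_0_iff_0] allI)
  moreover have "[:1, y $ i:] \<noteq> 0" by simp
  ultimately have "line_poly F v y - ?S = 0" by (simp only: mult_eq_0_iff simp_thms)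
  then have eq: "line_poly F v y = ?S" by (rule iffD1[OF right_minus_eq])
  have "coeff (monom (?a k) k * [:1, y $ i:] ^ (d - k)) n = 0" for k
    using chart[OF y'i, of k] n by (cases "n < k") (auto simp: coeff_monom_mult)
  then show ?thesis unfolding eq by (simp add: coeff_sum)
qed

text \<open>
  The multiplicity is defined by a least value over all charts, so it is a lower bound for the order of
  the local equation in one chart; any coordinate that is nonzero at the point provides one.
\<close>

lemma multiplicity_order:
  assumes F: "homogeneous d F" and v: "v \<noteq> 0" and n: "n < multiplicity_at F (proj_point v)"
  shows "coeff (line_poly F v y) n = 0"
proof -
  obtain i where i: "v $ i \<noteq> 0" using v by (auto simp: Finite_Cartesian_Product.vec_eq_iff)
  define v' where "v' = (1 / v $ i) *s v"
  have v': "v' $ i = 1" "v = (v $ i) *s v'" using i by (simp_all add: v'_def Finite_Cartesian_Product.vec_eq_iff)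
  have mem: "v' \<in> proj_point v" unfolding proj_point_def v'_def using i by auto
  have chart: "multiplicity_at F (proj_point v) \<le> mdeg m" if "m \<in> Poly_Mapping.keys (local_equation F v' i)" for m
    unfolding multiplicity_at_def
  proof (rule Least_le)
    show "\<exists>w\<in>proj_point v. \<exists>j. w $ j = 1 \<and> (\<exists>m'\<in>Poly_Mapping.keys (local_equation F w j). mdeg m' = mdeg m)"
      by (rule bexI[OF _ mem], rule exI[of _ i]) (use v'(1) that in blast)
  qed
  have "coeff (line_poly F v' y) n = 0" for y
    by (rule coeff_line_poly_all_directions[OF F v'(1) _ n], rule coeff_line_poly_in_chart[OF chart])
  then show ?thesis by (subst v'(2)) (simp add: line_poly_scale_point[OF F i])
qed

section \<open>The inequality\<close>

text \<open>
  The two cases compare the sum \<open>S\<close> of the multiplicities with the degree; see the introduction.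
  If \<open>S\<close> is large, passing from \<open>m - 1\<close> to \<open>m - 3/2\<close> saves \<open>S/2\<close>. If it is small, each multiplicity is
  bounded by what the other points leave, and \<open>S \<ge> 6\<close> allows to replace \<open>S\<close> by \<open>d\<close>.
\<close>

lemma multiplicity_sum_inequality:
  fixes m :: "nat \<Rightarrow> nat" and d s g :: nat
  assumes s: "s \<ge> 3" and d: "d \<ge> 1" and m: "\<And>i. i \<in> {1..s} \<Longrightarrow> m i \<ge> 2"
    and sum: "(\<Sum>i=1..s. m i * (m i - 1)) \<le> d * (d - 1)" and g: "g \<le> d"
  shows "(\<Sum>i=1..s. real (m i) * (real (m i) - 3 / 2)) + 3 / 2 * real g < real d ^ 2"
proof -
  define S where "S = (\<Sum>i=1..s. real (m i))"
  have split: "(\<Sum>i=1..s. real (m i) * (real (m i) - 3 / 2)) = (\<Sum>i=1..s. real (m i) * real (m i)) - 3 / 2 * S"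
    by (simp add: S_def right_diff_distrib sum_subtractf sum_distrib_left mult.commute)
  have others: "real (m i) \<le> S - 4" if i: "i \<in> {1..s}" for i
  proof -
    have "S = real (m i) + (\<Sum>j\<in>{1..s} - {i}. real (m j))" unfolding S_def by (rule sum.remove[OF _ i]) simp
    moreover have "(\<Sum>j\<in>{1..s} - {i}. 2 :: real) \<le> (\<Sum>j\<in>{1..s} - {i}. real (m j))"
    proof (rule sum_mono)
      fix j assume "j \<in> {1..s} - {i}"
      then have "m j \<ge> 2" using m by blast
      then show "2 \<le> real (m j)" by simp
    qed
    moreover have "(\<Sum>j\<in>{1..s} - {i}. 2 :: real) = real (s - 1) * 2" using i by simp
    moreover have "real (s - 1) \<ge> 2" using s by simp
    ultimately show ?thesis by linarith
  qed
  have S6: "S \<ge> 6"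
    using others[of 1] m[of 1] s by simp
  have gd: "real g \<le> real d" using g by simp
  show ?thesis
  proof (cases "S > real d")
    case True
    have "(\<Sum>i=1..s. real (m i) * real (m i)) = (\<Sum>i=1..s. real (m i * (m i - 1))) + S"
      unfolding S_def sum.distrib[symmetric]
    proof (rule sum.cong[OF refl])
      fix i assume "i \<in> {1..s}"
      then have "m i \<ge> 1" using m by fastforce
      then show "real (m i) * real (m i) = real (m i * (m i - 1)) + real (m i)"
        by (simp add: of_nat_diff algebra_simps)
    qed
    moreover have "(\<Sum>i=1..s. real (m i * (m i - 1))) \<le> real (d * (d - 1))"
      using sum by (simp only: of_nat_sum[symmetric] of_nat_le_iff)
    moreover have "real (d * (d - 1)) = real d ^ 2 - real d"
      using d by (simp add: of_nat_diff power2_eq_square algebra_simps)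
    ultimately show ?thesis unfolding split using True gd by linarith
  next
    case False
    have "(\<Sum>i=1..s. real (m i) * real (m i)) \<le> (\<Sum>i=1..s. (S - 4) * real (m i))"
      by (intro sum_mono mult_right_mono others) simp_all
    also have "\<dots> = (S - 4) * S" by (simp add: S_def sum_distrib_left)
    finally have "(\<Sum>i=1..s. real (m i) * (real (m i) - 3 / 2)) \<le> S * (S - 11 / 2)"
      unfolding split by (simp add: algebra_simps)
    also have "\<dots> \<le> real d * (real d - 11 / 2)" using False S6 by (intro mult_mono) simp_all
    also have "\<dots> = real d ^ 2 - 11 / 2 * real d" by (simp add: power2_eq_square algebra_simps)
    finally show ?thesis using gd False S6 by linarith
  qed
qed

theorem lemma2p4:
  fixes C :: poly3 and d s :: nat and p :: "nat \<Rightarrow> (complex ^ 3) set" and m :: "nat \<Rightarrow> nat"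
  assumes "irreducible_plane_curve d C"
    and "d \<ge> 3"
    and "s \<ge> 3"
    and "bij_betw p {1..s} (singular_locus C)"
    and "\<And>i. i \<in> {1..s} \<Longrightarrow> m i = multiplicity_at C (p i)"
    and "\<And>i. i \<in> {1..s} \<Longrightarrow> m i \<ge> 2"
    and "\<And>i j. 1 \<le> i \<Longrightarrow> i \<le> j \<Longrightarrow> j \<le> s \<Longrightarrow> m i \<ge> m j"
  shows "self_intersection C = d ^ 2 \<and>
    real d ^ 2 > (\<Sum>i = 1..s. real (m i) * (real (m i) - 3 / 2)) + 3 / 2 * real (gonality C)"
proof
  have C: "homogeneous d C" "irreducible C" using assms(1) by (auto simp: irreducible_plane_curve_def)
  then have C0: "C \<noteq> 0" by auto
  show "self_intersection C = d ^ 2" by (rule self_intersection_eq[OF C(1) C0]) (use assms(2) in simp)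
  define q where "q i = coord_vector (p i)" for i
  have pp: "p i \<in> proj_plane" if "i \<in> {1..s}" for i
    using bij_betwE[OF assms(4)] that unfolding singular_locus_def curve_points_def by blast
  have q: "q i \<noteq> 0" "proj_point (q i) = p i" if "i \<in> {1..s}" for i
    unfolding q_def by (rule coord_vector[OF pp[OF that]])+
  have inj: "inj_on q {1..s}"
  proof (rule inj_onI)
    fix i j assume i: "i \<in> {1..s}" and j: "j \<in> {1..s}" and "q i = q j"
    then have "p i = p j" using q(2)[OF i] q(2)[OF j] by simp
    then show "i = j" using inj_onD[OF bij_betw_imp_inj_on[OF assms(4)]] i j by blast
  qed
  have V: "q ` {1..s} = coord_vector ` (p ` {1..s})" by (simp only: q_def[abs_def] image_image)
  have mult: "multiplicity_at C (proj_point (q i)) = m i" if "i \<in> {1..s}" for i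
    using q(2)[OF that] assms(5)[OF that] by simp
  have "(\<Sum>v\<in>q ` {1..s}. multiplicity_at C (proj_point v) * (multiplicity_at C (proj_point v) - 1)) \<le> d * (d - 1)"
  proof (rule sum_multiplicities_le[OF C])
    show "d > 0" using assms(2) by simp
    show "finite (q ` {1..s})" by simp
    show "0 \<notin> q ` {1..s}"
    proof
      assume "0 \<in> q ` {1..s}"
      then obtain i where "i \<in> {1..s}" "0 = q i" by (elim imageE)
      then show False using q(1) by simp
    qed
    show "v \<noteq> c *s v'" if "v \<in> q ` {1..s}" "v' \<in> q ` {1..s}" "v \<noteq> v'" for v v' c
    proof (rule coord_vectors_independent[OF _ _ _ that(3)])
      show "p ` {1..s} \<subseteq> proj_plane" using pp by (rule image_subsetI)
      show "v \<in> coord_vector ` p ` {1..s}" "v' \<in> coord_vector ` p ` {1..s}" using that(1,2) unfolding V .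
    qed
    show "coeff (line_poly C v y) n = 0" if v: "v \<in> q ` {1..s}" and n: "n < multiplicity_at C (proj_point v)" for v y n
    proof (rule multiplicity_order[OF C(1) _ n])
      obtain i where "i \<in> {1..s}" "v = q i" using v by (elim imageE)
      then show "v \<noteq> 0" using q(1) by simp
    qed
    show "multiplicity_at C (proj_point v) > 0" if v: "v \<in> q ` {1..s}" for v
    proof -
      obtain i where i: "i \<in> {1..s}" "v = q i" using v by (elim imageE)
      have "m i \<ge> 2" by (rule assms(6)[OF i(1)])
      then show ?thesis unfolding i(2) mult[OF i(1)] by simp
    qed
  qed
  also have "(\<Sum>v\<in>q ` {1..s}. multiplicity_at C (proj_point v) * (multiplicity_at C (proj_point v) - 1)) =
      (\<Sum>i=1..s. m i * (m i - 1))"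
    unfolding sum.reindex[OF inj] by (intro sum.cong refl) (simp add: mult)
  finally have sum: "(\<Sum>i=1..s. m i * (m i - 1)) \<le> d * (d - 1)" .
  have gon: "gonality C \<le> d" by (rule gonality_le_degree[OF C(2,1)]) (use assms(2) in simp)
  show "(\<Sum>i=1..s. real (m i) * (real (m i) - 3 / 2)) + 3 / 2 * real (gonality C) < real d ^ 2"
    by (rule multiplicity_sum_inequality[OF assms(3) _ assms(6) sum gon]) (use assms(2) in simp_all)
qed

end
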